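(* Let $G$ be a $3$-dimensional Lie group with Lie algebra $\mathfrak{g}$, $g$ a left-invariant pseudo-Riemannian metric on $G$ and $(v_a)_{1\le a\le3}$ a $g$-orthonormal basis of $\mathfrak{g}$ with $\epsilon_a=g(v_a,v_a)$, $\epsilon_1=\epsilon_2=-\epsilon_3$, and, for some $\alpha\in\mathbb{R}$, $$[v_1,v_2]=\epsilon_3L(v_3),\quad[v_2,v_3]=\epsilon_1L(v_1),\quad[v_3,v_1]=\epsilon_2L(v_2),\qquad L=L_5(\alpha)=\begin{pmatrix}\alpha&\frac1{\sqrt2}&0\\\frac1{\sqrt2}&\alpha&\frac1{\sqrt2}\\0&-\frac1{\sqrt2}&\alpha\end{pmatrix}$$ (with the convention $L(v_a)=\sum_bL_{ba}v_b$). Let $E_{H,F}$ be a Courant algebroid of type $B_3$ over $G$ with left-invariant $H=h\,v_1^*\wedge v_2^*\wedge v_3^*$ and $F=\frac12F_{ab}v_a^*\wedge v_b^*\neq0$, and $\delta\in(\mathfrak{g}\oplus\mathfrak{g}^*\oplus\mathbb{R})^*$ a left-invariant divergence operator, $\delta_A=\delta(e_A)$. The metric $E_-=\{X-g(X)\mid X\in TG\}$ defined on $E_{H,F}$ is generalized Einstein with divergence $\delta$ if and only if $$\alpha=h=F_{13}=0,\quad F_{23}=-F_{12},\quad(F_{12})^2=-\epsilon_1-\frac{\delta_1}{\sqrt2},$$ $$\delta_0=\delta_2=\delta_5=0,\quad\delta_1=\delta_3=\delta_4=\delta_6,\quad\epsilon_1+\frac{\delta_1}{\sqrt2}<0.$$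 In this case the Lie algebra $\mathfrak{g}$ is isomorphic to $\mathfrak{e}(1,1)$.
   Context: $\mathfrak{e}(1,1)$ is the Lie algebra of the isometry group of $\mathbb{R}^{1,1}$. Basis of $\tilde E=\mathfrak{g}\oplus\mathfrak{g}^*\oplus\mathbb{R}$: $e_0=1$, $e_a=v_a+g(v_a)$, $e_{a+3}=v_a-g(v_a)$ for $1\le a\le3$, where $g(X)=g(X,\cdot)$; $F_{ab}=F(v_a,v_b)$. Courant algebroid of type $B_3$: for left-invariant $H\in\Omega^3(G)$, $F\in\Omega^2(G)$ with $dF=0$, $E=E_{H,F}$ is the bundle $TG\oplus T^*G\oplus\mathbb{R}$ with anchor $\pi$ the projection to $TG$, scalar product $\langle X+\xi+\lambda,Y+\eta+\mu\rangle=\frac12(\xi(Y)+\eta(X))+\lambda\mu$ and Dorfman bracket $$[X+\xi+\lambda,Y+\eta+\mu]_{H,F}=\mathcal{L}_X(Y+\eta)-i_Yd\xi+2\mu\,d\lambda+i_Xi_YH-2(\mu\, i_XF-\lambda\, i_YF)+X(\mu)-Y(\lambda)+F(X,Y).$$ Left-invariant sections of $E$ (for the action of $G$ by left translations, trivial on the $\mathbb{R}$-fibre) form $\tilde E$. For $E_-=\{X-g(X)\mid X\in TG\}$ put $E_+=E_-^\perp$. A generalized connection is a linear map $D:\Gamma(E)\to\Gamma(E^*\otimes E)$ with $D_u(fv)=\pi(u)(f)v+fD_uv$ and $\pi(u)\langle v,w\rangle=\langle D_uv,w\rangle+\langle v,D_uw\rangle$. Its torsion is $T^D(u,v,w)=\langle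 D_uv-D_vu-[u,v]_{H,F},w\rangle+\langle v,D_wu\rangle$; $D$ is Levi-Civita for $E_-$ if $T^D=0$ and $D_u\Gamma(E_-)\subset\Gamma(E_-)$ for all $u$. A divergence operator is an additive map $\delta:\Gamma(E)\to C^\infty(G)$ with $\delta(fu)=\pi(u)(f)+f\delta(u)$; it is left-invariant if constant on left-invariant sections, and is then identified with an element of $\tilde E^*$; $\delta^D(u)=\mathrm{tr}\,Du$. For a Levi-Civita generalized connection $D$ of $E_-$ with $\delta^D=\delta$, put $R^D(u,v)w=D_uD_vw-D_vD_uw-D_{[u,v]_{H,F}}w$ and $\mathrm{Ric}^{\delta,+}(u,v)=\mathrm{tr}(E_+\ni w\mapsto R^D(w,u)v)$ ($u\in E_-,v\in E_+$), $\mathrm{Ric}^{\delta,-}(u,v)=\mathrm{tr}(E_-\ni w\mapsto R^D(w,u)v)$ ($u\in E_+,v\in E_-$). These are tensors depending only on $(E_-,\delta)$. $E_-$ is generalized Einstein with divergence $\delta$ if $\mathrm{Ric}^{\delta,+}=0$ and $\mathrm{Ric}^{\delta,-}=0$. *)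

theory Defs
  imports "HOL-Analysis.Analysis" "HOL-Library.Function_Algebras"
begin

section \<open>Smooth manifolds and Lie groups\<close>

text \<open>Only used for open \<open>S\<close> in a Euclidean space.\<close>

primrec Ck_on :: "nat \<Rightarrow> 'a::euclidean_space set \<Rightarrow> ('a \<Rightarrow> 'b::real_normed_vector) \<Rightarrow> bool" where
  "Ck_on 0 S f \<longleftrightarrow> continuous_on S f"
| "Ck_on (Suc k) S f \<longleftrightarrow>
     (\<exists>f'. (\<forall>x\<in>S. (f has_derivative f' x) (at x)) \<and> (\<forall>w. Ck_on k S (\<lambda>x. f' x w)))"

definition smooth_on :: "'a::euclidean_space set \<Rightarrow> ('a \<Rightarrow> 'b::real_normed_vector) \<Rightarrow> bool" where
  "smooth_on S f \<longleftrightarrow> (\<forall>k. Ck_on k S f)"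

type_synonym ('g, 'm) atlas = "('g set \<times> ('g \<Rightarrow> 'm)) set"

definition smooth_atlas :: "('g::topological_space, 'm::euclidean_space) atlas \<Rightarrow> bool" where
  "smooth_atlas A \<longleftrightarrow>
     (\<forall>(U, \<phi>)\<in>A. open U \<and> open (\<phi> ` U) \<and> homeomorphism U (\<phi> ` U) \<phi> (inv_into U \<phi>)) \<and>
     (\<forall>p. \<exists>(U, \<phi>)\<in>A. p \<in> U) \<and>
     (\<forall>(U, \<phi>)\<in>A. \<forall>(V, \<psi>)\<in>A. smooth_on (\<phi> ` (U \<inter> V)) (\<psi> \<circ> inv_into U \<phi>))"

definition prod_atlas ::
  "('g, 'm) atlas \<Rightarrow> ('h, 'n) atlas \<Rightarrow> ('g \<times> 'h, 'm \<times> 'n) atlas" where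
  "prod_atlas A B = {(U \<times> V, map_prod \<phi> \<psi>) | U \<phi> V \<psi>. (U, \<phi>) \<in> A \<and> (V, \<psi>) \<in> B}"

definition smooth_map ::
  "('g::topological_space, 'm::euclidean_space) atlas \<Rightarrow>
   ('h::topological_space, 'n::euclidean_space) atlas \<Rightarrow> ('g \<Rightarrow> 'h) \<Rightarrow> bool" where
  "smooth_map A B f \<longleftrightarrow> continuous_on UNIV f \<and>
     (\<forall>(U, \<phi>)\<in>A. \<forall>(V, \<psi>)\<in>B. smooth_on (\<phi> ` (U \<inter> f -` V)) (\<psi> \<circ> f \<circ> inv_into U \<phi>))"

definition lie_group ::
  "('g \<Rightarrow> 'g \<Rightarrow> 'g) \<Rightarrow> 'g \<Rightarrow> ('g \<Rightarrow> 'g) \<Rightarrow>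
   ('g::{t2_space, second_countable_topology}, 'm::euclidean_space) atlas \<Rightarrow> bool" where
  "lie_group mul unit ginv A \<longleftrightarrow>
     group mul unit ginv \<and> smooth_atlas A \<and>
     smooth_map (prod_atlas A A) A (\<lambda>(x, y). mul x y) \<and> smooth_map A A ginv"

type_synonym 'g sfun = "'g \<Rightarrow> real"

definition smooth_fns :: "('g, 'm::euclidean_space) atlas \<Rightarrow> 'g sfun set" where
  "smooth_fns A = {f. \<forall>(U, \<phi>)\<in>A. smooth_on (\<phi> ` U) (f \<circ> inv_into U \<phi>)}"


section \<open>Vector fields and differential forms\<close>

text \<open>
  Sums and products of functions (also of operators on functions) are pointwise, as in
  \<^theory>\<open>HOL-Library.Function_Algebras\<close>.

  A tangent vector acts on smooth functions as a directional derivative; it is set to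
  \<open>0\<close> on all other functions, so that equality of tangent vectors is equality in HOL.
  A vector field is a smooth family of tangent vectors, viewed as an operator on functions:
  \<open>X f p = X\<^sub>p(f)\<close>.
\<close>

type_synonym 'g vfield = "'g sfun \<Rightarrow> 'g sfun"

definition tangent_space ::
  "('g, 'm::euclidean_space) atlas \<Rightarrow> 'g \<Rightarrow> ('g sfun \<Rightarrow> real) set" where
  "tangent_space A p =
     {t. \<exists>(U, \<phi>)\<in>A. p \<in> U \<and> (\<exists>w. t = (\<lambda>f. if f \<in> smooth_fns A
            then frechet_derivative (f \<circ> inv_into U \<phi>) (at (\<phi> p)) w else 0))}"

definition vector_fields :: "('g, 'm::euclidean_space) atlas \<Rightarrow> 'g vfield set" where
  "vector_fields A =
     {X. (\<forall>p. (\<lambda>f. X f p) \<in> tangent_space A p) \<and> (\<forall>f\<in>smooth_fns A. X f \<in> smooth_fns A)}"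

definition vbracket :: "'g vfield \<Rightarrow> 'g vfield \<Rightarrow> 'g vfield" where
  "vbracket X Y = (\<lambda>f. X (Y f) - Y (X f))"

text \<open>
  Forms are alternating \<open>C\<^sup>\<infinity>\<close>-multilinear maps on vector fields, set to \<open>0\<close> if
  an argument is not a vector field. A 2-form \<open>F\<close> is curried, so \<open>F X\<close> is \<open>i\<^sub>XF\<close>, and
  \<open>H Y X\<close> is \<open>i\<^sub>Xi\<^sub>YH\<close> for a 3-form \<open>H\<close>.
\<close>

type_synonym 'g oneform = "'g vfield \<Rightarrow> 'g sfun"
type_synonym 'g twoform = "'g vfield \<Rightarrow> 'g oneform"
type_synonym 'g threeform = "'g vfield \<Rightarrow> 'g twoform"

definition one_forms :: "('g, 'm::euclidean_space) atlas \<Rightarrow> 'g oneform set" where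
  "one_forms A =
     {\<xi>. (\<forall>X\<in>vector_fields A. \<xi> X \<in> smooth_fns A) \<and>
         (\<forall>X\<in>vector_fields A. \<forall>Y\<in>vector_fields A. \<xi> (X + Y) = \<xi> X + \<xi> Y) \<and>
         (\<forall>f\<in>smooth_fns A. \<forall>X\<in>vector_fields A. \<xi> (\<lambda>k. f * X k) = f * \<xi> X) \<and>
         (\<forall>X. X \<notin> vector_fields A \<longrightarrow> \<xi> X = 0)}"

definition two_forms :: "('g, 'm::euclidean_space) atlas \<Rightarrow> 'g twoform set" where
  "two_forms A =
     {F. (\<forall>X\<in>vector_fields A. F X \<in> one_forms A) \<and>
         (\<forall>X. X \<notin> vector_fields A \<longrightarrow> F X = 0) \<and>
         (\<forall>X\<in>vector_fields A. \<forall>Y\<in>vector_fields A. F X Y = - F Y X)}"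

definition three_forms :: "('g, 'm::euclidean_space) atlas \<Rightarrow> 'g threeform set" where
  "three_forms A =
     {H. (\<forall>X\<in>vector_fields A. H X \<in> two_forms A) \<and>
         (\<forall>X. X \<notin> vector_fields A \<longrightarrow> H X = 0) \<and>
         (\<forall>X\<in>vector_fields A. \<forall>Y\<in>vector_fields A. H X Y = - H Y X)}"

definition closed_two_form :: "('g, 'm::euclidean_space) atlas \<Rightarrow> 'g twoform \<Rightarrow> bool" where
  "closed_two_form A F \<longleftrightarrow>
     (\<forall>X\<in>vector_fields A. \<forall>Y\<in>vector_fields A. \<forall>Z\<in>vector_fields A.
        X (F Y Z) - Y (F X Z) + Z (F X Y)
        - F (vbracket X Y) Z + F (vbracket X Z) Y - F (vbracket Y Z) X = 0)"

definition d_fun :: "('g, 'm::euclidean_space) atlas \<Rightarrow> 'g sfun \<Rightarrow> 'g oneform" where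
  "d_fun A f = (\<lambda>Z. if Z \<in> vector_fields A then Z f else 0)"

definition d_oneform :: "('g, 'm::euclidean_space) atlas \<Rightarrow> 'g oneform \<Rightarrow> 'g twoform" where
  "d_oneform A \<xi> = (\<lambda>Y Z. if Y \<in> vector_fields A \<and> Z \<in> vector_fields A
     then Y (\<xi> Z) - Z (\<xi> Y) - \<xi> (vbracket Y Z) else 0)"

definition lie_deriv_oneform ::
  "('g, 'm::euclidean_space) atlas \<Rightarrow> 'g vfield \<Rightarrow> 'g oneform \<Rightarrow> 'g oneform" where
  "lie_deriv_oneform A X \<eta> = (\<lambda>Z. if Z \<in> vector_fields A
     then X (\<eta> Z) - \<eta> (vbracket X Z) else 0)"

definition pseudo_riemannian_metric ::
  "('g, 'm::euclidean_space) atlas \<Rightarrow> ('g vfield \<Rightarrow> 'g oneform) \<Rightarrow> bool" where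
  "pseudo_riemannian_metric A g \<longleftrightarrow>
     (\<forall>X\<in>vector_fields A. g X \<in> one_forms A) \<and>
     (\<forall>X. X \<notin> vector_fields A \<longrightarrow> g X = 0) \<and>
     (\<forall>X\<in>vector_fields A. \<forall>Y\<in>vector_fields A. g X Y = g Y X) \<and>
     (\<forall>p. \<forall>X\<in>vector_fields A. (\<forall>Y\<in>vector_fields A. g X Y p = 0) \<longrightarrow> (\<forall>f. X f p = 0))"


section \<open>Left-invariance\<close>

text \<open>The push-forward of a vector field under the left translation by \<open>q\<close>.\<close>

definition push :: "('g \<Rightarrow> 'g \<Rightarrow> 'g) \<Rightarrow> ('g \<Rightarrow> 'g) \<Rightarrow> 'g \<Rightarrow> 'g vfield \<Rightarrow> 'g vfield" where
  "push mul ginv q X = (\<lambda>f. X (f \<circ> mul q) \<circ> mul (ginv q))"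

definition lie_algebra ::
  "('g \<Rightarrow> 'g \<Rightarrow> 'g) \<Rightarrow> ('g \<Rightarrow> 'g) \<Rightarrow> ('g, 'm::euclidean_space) atlas \<Rightarrow> 'g vfield set" where
  "lie_algebra mul ginv A = {X \<in> vector_fields A. \<forall>q. push mul ginv q X = X}"

definition linv1 ::
  "('g \<Rightarrow> 'g \<Rightarrow> 'g) \<Rightarrow> ('g \<Rightarrow> 'g) \<Rightarrow> ('g, 'm::euclidean_space) atlas \<Rightarrow> 'g oneform \<Rightarrow> bool" where
  "linv1 mul ginv A \<xi> \<longleftrightarrow>
     (\<forall>q. \<forall>X\<in>vector_fields A. \<xi> (push mul ginv q X) \<circ> mul q = \<xi> X)"

definition linv2 ::
  "('g \<Rightarrow> 'g \<Rightarrow> 'g) \<Rightarrow> ('g \<Rightarrow> 'g) \<Rightarrow> ('g, 'm::euclidean_space) atlas \<Rightarrow>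
   ('g vfield \<Rightarrow> 'g oneform) \<Rightarrow> bool" where
  "linv2 mul ginv A B \<longleftrightarrow>
     (\<forall>q. \<forall>X\<in>vector_fields A. \<forall>Y\<in>vector_fields A.
        B (push mul ginv q X) (push mul ginv q Y) \<circ> mul q = B X Y)"

definition linv3 ::
  "('g \<Rightarrow> 'g \<Rightarrow> 'g) \<Rightarrow> ('g \<Rightarrow> 'g) \<Rightarrow> ('g, 'm::euclidean_space) atlas \<Rightarrow> 'g threeform \<Rightarrow> bool" where
  "linv3 mul ginv A H \<longleftrightarrow>
     (\<forall>q. \<forall>X\<in>vector_fields A. \<forall>Y\<in>vector_fields A. \<forall>Z\<in>vector_fields A.
        H (push mul ginv q X) (push mul ginv q Y) (push mul ginv q Z) \<circ> mul q = H X Y Z)"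

text \<open>Real linear combinations of \<open>v 1, v 2, v 3\<close>.\<close>

definition lincomb3 :: "(nat \<Rightarrow> real) \<Rightarrow> (nat \<Rightarrow> 'g vfield) \<Rightarrow> 'g vfield" where
  "lincomb3 c v = (\<lambda>f p. \<Sum>a\<in>{1..3}. c a * v a f p)"

definition lie_algebra_basis3 ::
  "('g \<Rightarrow> 'g \<Rightarrow> 'g) \<Rightarrow> ('g \<Rightarrow> 'g) \<Rightarrow> ('g, 'm::euclidean_space) atlas \<Rightarrow>
   (nat \<Rightarrow> 'g vfield) \<Rightarrow> bool" where
  "lie_algebra_basis3 mul ginv A v \<longleftrightarrow>
     (\<forall>a\<in>{1..3}. v a \<in> lie_algebra mul ginv A) \<and>
     (\<forall>X\<in>lie_algebra mul ginv A.
        \<exists>!c. (\<forall>a. a \<notin> {1..3} \<longrightarrow> c a = 0) \<and> X = lincomb3 c v)"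


section \<open>Courant algebroids of type \<open>B\<^sub>n\<close>\<close>

text \<open>
  A section \<open>(X, \<xi>, l)\<close> of \<open>E = TG \<oplus> T\<^sup>*G \<oplus> \<real>\<close> stands for \<open>X + \<xi> + l\<close>. Subbundles of \<open>E\<close>
  are represented by their modules of sections.
\<close>

type_synonym 'g Esec = "'g vfield \<times> 'g oneform \<times> 'g sfun"

definition sections :: "('g, 'm::euclidean_space) atlas \<Rightarrow> 'g Esec set" where
  "sections A = vector_fields A \<times> one_forms A \<times> smooth_fns A"

fun smul :: "'g sfun \<Rightarrow> 'g Esec \<Rightarrow> 'g Esec" where
  "smul f (X, \<xi>, l) = ((\<lambda>k. f * X k), (\<lambda>Z. f * \<xi> Z), f * l)"

definition anchor :: "'g Esec \<Rightarrow> 'g vfield" where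
  "anchor u = fst u"

fun pairing :: "'g Esec \<Rightarrow> 'g Esec \<Rightarrow> 'g sfun" where
  "pairing (X, \<xi>, l) (Y, \<eta>, m) = (\<lambda>p. (\<xi> Y p + \<eta> X p) / 2 + l p * m p)"

fun dorfman ::
  "('g, 'm::euclidean_space) atlas \<Rightarrow> 'g threeform \<Rightarrow> 'g twoform \<Rightarrow>
   'g Esec \<Rightarrow> 'g Esec \<Rightarrow> 'g Esec" where
  "dorfman A H F (X, \<xi>, l) (Y, \<eta>, m) =
     (vbracket X Y,
      (\<lambda>Z p. lie_deriv_oneform A X \<eta> Z p - d_oneform A \<xi> Y Z p + 2 * m p * d_fun A l Z p
             + H Y X Z p - 2 * (m p * F X Z p - l p * F Y Z p)),
      X m - Y l + F X Y)"

definition left_invariant_sections ::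
  "('g \<Rightarrow> 'g \<Rightarrow> 'g) \<Rightarrow> ('g \<Rightarrow> 'g) \<Rightarrow> ('g, 'm::euclidean_space) atlas \<Rightarrow> 'g Esec set" where
  "left_invariant_sections mul ginv A =
     {(X, \<xi>, l) \<in> sections A. X \<in> lie_algebra mul ginv A \<and> linv1 mul ginv A \<xi> \<and>
        (\<forall>q. l \<circ> mul q = l)}"

definition E_minus ::
  "('g, 'm::euclidean_space) atlas \<Rightarrow> ('g vfield \<Rightarrow> 'g oneform) \<Rightarrow> 'g Esec set" where
  "E_minus A g = {(X, - g X, 0) | X. X \<in> vector_fields A}"

definition orth_compl :: "('g, 'm::euclidean_space) atlas \<Rightarrow> 'g Esec set \<Rightarrow> 'g Esec set" where
  "orth_compl A S = {u \<in> sections A. \<forall>w\<in>S. pairing u w = 0}"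

text \<open>The frame \<open>e 0, \<dots>, e 6\<close> of \<open>E\<close> determined by a metric and a basis of the Lie algebra.\<close>

definition frame_e :: "('g vfield \<Rightarrow> 'g oneform) \<Rightarrow> (nat \<Rightarrow> 'g vfield) \<Rightarrow> nat \<Rightarrow> 'g Esec" where
  "frame_e g v B =
     (if B = 0 then (0, 0, 1)
      else if B \<le> 3 then (v B, g (v B), 0)
      else (v (B - 3), - g (v (B - 3)), 0))"


section \<open>Generalized connections and the generalized Einstein condition\<close>

definition global_frame ::
  "('g, 'm::euclidean_space) atlas \<Rightarrow> 'g Esec set \<Rightarrow> nat \<Rightarrow> (nat \<Rightarrow> 'g Esec) \<Rightarrow> bool" where
  "global_frame A S n b \<longleftrightarrow>
     (\<forall>i<n. b i \<in> S) \<and>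
     (\<forall>u\<in>S. \<exists>!c. (\<forall>i<n. c i \<in> smooth_fns A) \<and> (\<forall>i\<ge>n. c i = 0) \<and>
        u = (\<Sum>i<n. smul (c i) (b i)))"

text \<open>
  The trace of a \<open>C\<^sup>\<infinity>\<close>-linear endomorphism \<open>\<phi>\<close> of the sections \<open>S\<close> of a bundle with a
  global frame. It does not depend on the frame; over a Lie group the bundles used below
  all have global frames.
\<close>

definition sec_trace ::
  "('g, 'm::euclidean_space) atlas \<Rightarrow> 'g Esec set \<Rightarrow> ('g Esec \<Rightarrow> 'g Esec) \<Rightarrow> 'g sfun" where
  "sec_trace A S \<phi> =
     (THE t. \<exists>n b c. global_frame A S n b \<and>
        (\<forall>j<n. (\<forall>i<n. c i j \<in> smooth_fns A) \<and> \<phi> (b j) = (\<Sum>i<n. smul (c i j) (b i))) \<and>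
        t = (\<Sum>i<n. c i i))"

definition generalized_connection ::
  "('g, 'm::euclidean_space) atlas \<Rightarrow> ('g Esec \<Rightarrow> 'g Esec \<Rightarrow> 'g Esec) \<Rightarrow> bool" where
  "generalized_connection A D \<longleftrightarrow>
     (\<forall>u\<in>sections A. \<forall>v\<in>sections A. D u v \<in> sections A) \<and>
     (\<forall>u\<in>sections A. \<forall>u'\<in>sections A. \<forall>v\<in>sections A. D (u + u') v = D u v + D u' v) \<and>
     (\<forall>f\<in>smooth_fns A. \<forall>u\<in>sections A. \<forall>v\<in>sections A. D (smul f u) v = smul f (D u v)) \<and>
     (\<forall>u\<in>sections A. \<forall>v\<in>sections A. \<forall>v'\<in>sections A. D u (v + v') = D u v + D u v') \<and>
     (\<forall>f\<in>smooth_fns A. \<forall>u\<in>sections A. \<forall>v\<in>sections A.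
        D u (smul f v) = smul (anchor u f) v + smul f (D u v)) \<and>
     (\<forall>u\<in>sections A. \<forall>v\<in>sections A. \<forall>w\<in>sections A.
        anchor u (pairing v w) = pairing (D u v) w + pairing v (D u w))"

definition gen_torsion ::
  "('g, 'm::euclidean_space) atlas \<Rightarrow> 'g threeform \<Rightarrow> 'g twoform \<Rightarrow>
   ('g Esec \<Rightarrow> 'g Esec \<Rightarrow> 'g Esec) \<Rightarrow> 'g Esec \<Rightarrow> 'g Esec \<Rightarrow> 'g Esec \<Rightarrow> 'g sfun" where
  "gen_torsion A H F D u v w =
     pairing (D u v - D v u - dorfman A H F u v) w + pairing v (D w u)"

definition levi_civita ::
  "('g, 'm::euclidean_space) atlas \<Rightarrow> 'g threeform \<Rightarrow> 'g twoform \<Rightarrow> 'g Esec set \<Rightarrow>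
   ('g Esec \<Rightarrow> 'g Esec \<Rightarrow> 'g Esec) \<Rightarrow> bool" where
  "levi_civita A H F Em D \<longleftrightarrow>
     generalized_connection A D \<and>
     (\<forall>u\<in>sections A. \<forall>v\<in>sections A. \<forall>w\<in>sections A. gen_torsion A H F D u v w = 0) \<and>
     (\<forall>u\<in>sections A. \<forall>v\<in>Em. D u v \<in> Em)"

definition divergence_operator ::
  "('g, 'm::euclidean_space) atlas \<Rightarrow> ('g Esec \<Rightarrow> 'g sfun) \<Rightarrow> bool" where
  "divergence_operator A \<delta> \<longleftrightarrow>
     (\<forall>u\<in>sections A. \<delta> u \<in> smooth_fns A) \<and>
     (\<forall>u\<in>sections A. \<forall>v\<in>sections A. \<delta> (u + v) = \<delta> u + \<delta> v) \<and>
     (\<forall>f\<in>smooth_fns A. \<forall>u\<in>sections A. \<delta> (smul f u) = anchor u f + f * \<delta> u)"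

definition left_invariant_divergence ::
  "('g \<Rightarrow> 'g \<Rightarrow> 'g) \<Rightarrow> ('g \<Rightarrow> 'g) \<Rightarrow> ('g, 'm::euclidean_space) atlas \<Rightarrow>
   ('g Esec \<Rightarrow> 'g sfun) \<Rightarrow> bool" where
  "left_invariant_divergence mul ginv A \<delta> \<longleftrightarrow>
     divergence_operator A \<delta> \<and>
     (\<forall>u\<in>left_invariant_sections mul ginv A. \<exists>c. \<delta> u = (\<lambda>_. c))"

definition connection_divergence ::
  "('g, 'm::euclidean_space) atlas \<Rightarrow> ('g Esec \<Rightarrow> 'g Esec \<Rightarrow> 'g Esec) \<Rightarrow> 'g Esec \<Rightarrow> 'g sfun" where
  "connection_divergence A D u = sec_trace A (sections A) (\<lambda>w. D w u)"

definition curvature ::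
  "('g, 'm::euclidean_space) atlas \<Rightarrow> 'g threeform \<Rightarrow> 'g twoform \<Rightarrow>
   ('g Esec \<Rightarrow> 'g Esec \<Rightarrow> 'g Esec) \<Rightarrow> 'g Esec \<Rightarrow> 'g Esec \<Rightarrow> 'g Esec \<Rightarrow> 'g Esec" where
  "curvature A H F D u v w = D u (D v w) - D v (D u w) - D (dorfman A H F u v) w"

text \<open>
  With \<open>S = E\<^sub>+\<close> this is \<open>Ric\<^sup>+\<close> (on \<open>u \<in> E\<^sub>-\<close>, \<open>v \<in> E\<^sub>+\<close>), with \<open>S = E\<^sub>-\<close> it is
  \<open>Ric\<^sup>-\<close> (on \<open>u \<in> E\<^sub>+\<close>, \<open>v \<in> E\<^sub>-\<close>).
\<close>

definition ricci ::
  "('g, 'm::euclidean_space) atlas \<Rightarrow> 'g threeform \<Rightarrow> 'g twoform \<Rightarrow>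
   ('g Esec \<Rightarrow> 'g Esec \<Rightarrow> 'g Esec) \<Rightarrow> 'g Esec set \<Rightarrow> 'g Esec \<Rightarrow> 'g Esec \<Rightarrow> 'g sfun" where
  "ricci A H F D S u v = sec_trace A S (\<lambda>w. curvature A H F D w u v)"

text \<open>
  The Ricci tensors are the same for all Levi-Civita generalized connections \<open>D\<close> with
  divergence \<open>\<delta>\<close>, so it does not matter which one is taken.
\<close>

definition generalized_einstein ::
  "('g, 'm::euclidean_space) atlas \<Rightarrow> 'g threeform \<Rightarrow> 'g twoform \<Rightarrow> 'g Esec set \<Rightarrow>
   ('g Esec \<Rightarrow> 'g sfun) \<Rightarrow> bool" where
  "generalized_einstein A H F Em \<delta> \<longleftrightarrow>
     (\<exists>D. levi_civita A H F Em D \<and>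
          (\<forall>u\<in>sections A. connection_divergence A D u = \<delta> u) \<and>
          (\<forall>u\<in>Em. \<forall>v\<in>orth_compl A Em. ricci A H F D (orth_compl A Em) u v = 0) \<and>
          (\<forall>u\<in>orth_compl A Em. \<forall>v\<in>Em. ricci A H F D Em u v = 0))"


section \<open>The matrix \<open>L\<^sub>5(\<alpha>)\<close> and the Lie algebra \<open>e(1,1)\<close>\<close>

text \<open>Matrix entries, with row and column indices in \<open>{1..3}\<close>.\<close>

definition L5 :: "real \<Rightarrow> nat \<Rightarrow> nat \<Rightarrow> real" where
  "L5 \<alpha> i j =
     [[\<alpha>, 1 / sqrt 2, 0],
      [1 / sqrt 2, \<alpha>, 1 / sqrt 2],
      [0, - 1 / sqrt 2, \<alpha>]] ! (i - 1) ! (j - 1)"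

definition eta11 :: "real^2^2" where
  "eta11 = (\<chi> i j. if i = j then (if i = 1 then 1 else - 1) else 0)"

text \<open>The pair \<open>(M, b)\<close> stands for the affine map \<open>x \<mapsto> M x + b\<close>; isometries are affine.\<close>

definition isom11 :: "((real^2^2) \<times> (real^2)) set" where
  "isom11 = {(M, b). transpose M ** eta11 ** M = eta11}"

text \<open>
  The tangent space of \<open>isom11\<close> at the identity map, with the Lie bracket inherited from the
  affine group (the commutator of the matrices with blocks \<open>M, b, 0, 0\<close>).
\<close>

definition e11 :: "((real^2^2) \<times> (real^2)) set" where
  "e11 = {x. \<exists>\<gamma>. \<gamma> 0 = (mat 1, 0) \<and> (\<forall>t. \<gamma> t \<in> isom11) \<and>
             (\<gamma> has_vector_derivative x) (at (0::real))}"

fun e11_bracket :: "(real^2^2) \<times> (real^2) \<Rightarrow> (real^2^2) \<times> (real^2) \<Rightarrow> (real^2^2) \<times> (real^2)" where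
  "e11_bracket (M, b) (N, c) = (M ** N - N ** M, M *v c - N *v b)"

definition isomorphic_to_e11 ::
  "('g \<Rightarrow> 'g \<Rightarrow> 'g) \<Rightarrow> ('g \<Rightarrow> 'g) \<Rightarrow> ('g, 'm::euclidean_space) atlas \<Rightarrow> bool" where
  "isomorphic_to_e11 mul ginv A \<longleftrightarrow>
     (\<exists>\<Phi>. bij_betw \<Phi> (lie_algebra mul ginv A) e11 \<and>
        (\<forall>X\<in>lie_algebra mul ginv A. \<forall>Y\<in>lie_algebra mul ginv A. \<Phi> (X + Y) = \<Phi> X + \<Phi> Y) \<and>
        (\<forall>r. \<forall>X\<in>lie_algebra mul ginv A. \<Phi> (\<lambda>f p. r * X f p) = r *\<^sub>R \<Phi> X) \<and>
        (\<forall>X\<in>lie_algebra mul ginv A. \<forall>Y\<in>lie_algebra mul ginv A.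
           \<Phi> (vbracket X Y) = e11_bracket (\<Phi> X) (\<Phi> Y)))"

end

theory Submission
  imports Defs
begin

text \<open>
  Left-invariance turns the generalized Einstein condition into a system of polynomial equations. The
  sections \<open>e 0, \<dots>, e 6\<close> form a frame that is orthonormal for the scalar product, up to signs
  \<open>\<eta> A\<close>, and the functions \<open>c A B C = \<langle>[e A, e B], e C\<rangle>\<close> are constants, determined by the
  brackets of the \<open>v a\<close> and the components of \<open>H\<close> and \<open>F\<close> (\<open>E_bracket\<close>). Let \<open>D\<close> be a Levi-Civita
  generalized connection. If \<open>e a\<close> and \<open>e i\<close> belong to different summands of \<open>E\<^sub>+ \<oplus> E\<^sub>-\<close>, the vanishing
  of the torsion expresses \<open>D\<close> of \<open>e i\<close> along \<open>e a\<close> by structure constants. The torsion leaves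
  the remaining part of \<open>D\<close> undetermined, but in the trace that defines the Ricci tensor this part is
  visible through the divergence only (\<open>ricci_frame\<close>):
  \<open>Ric(e a, e i) = (\<Sum>k. \<eta> k c a i k \<delta> k) - (\<Sum>j b. \<eta> j \<eta> b c j a b c b i j)\<close>,
  where \<open>k\<close> and \<open>j\<close> run through the summand of \<open>e i\<close> and \<open>b\<close> through that of \<open>e a\<close>. Conversely, a
  Levi-Civita connection with prescribed divergence can be written down in the frame
  (\<open>levi_civita_exists\<close>). Hence the Einstein condition amounts to 24 equations between constants
  (\<open>einstein_iff\<close>).

  For the matrix \<open>L\<^sub>5(\<alpha>)\<close> these equations are listed in \<open>ricci_equations\<close> and solved in \<open>einstein_system\<close>.
  They imply \<open>(F\<^sub>1\<^sub>2 + F\<^sub>2\<^sub>3)\<^sup>2 = 0\<close> and \<open>F\<^sub>1\<^sub>3 = 0\<close>, so that \<open>F\<^sub>1\<^sub>2\<close> is non-zero because \<open>F\<close> is; this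
  makes \<open>h\<close>, \<open>\<delta>\<^sub>2\<close> and \<open>\<delta>\<^sub>5\<close> multiples of \<open>\<alpha>\<close> and finally forces \<open>\<alpha> = 0\<close>. For \<open>\<alpha> = 0\<close> the bracket is that of a
  line acting on an abelian plane with two opposite real eigenvalues, which is \<open>e(1,1)\<close>
  (\<open>isomorphic_to_e11I\<close>).

  What remains is to show that the \<open>e B\<close> are a frame, and that the bracket of two vector fields is a
  vector field. A left-invariant vector field that vanishes at one point vanishes identically; so the \<open>v a\<close>
  are linearly independent at every point and, the dimension being three, span every tangent space.
  Cramer's rule with globally defined functions (\<open>frame_cramer\<close>) and the non-degeneracy of the metric
  then show that every vector field is a combination of the \<open>v a\<close> with smooth coefficients
  (\<open>field_expand\<close>).
\<close>

section \<open>Continuously differentiable maps\<close>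

lemma Ck_on_cong:
  assumes "open S" "\<And>x. x \<in> S \<Longrightarrow> f x = g x" "Ck_on k S f"
  shows "Ck_on k S g"
proof (cases k)
  case 0
  then show ?thesis using assms by (simp cong: continuous_on_cong)
next
  case (Suc j)
  with assms(3) obtain f' where f': "\<And>x. x \<in> S \<Longrightarrow> (f has_derivative f' x) (at x)"
    "\<And>w. Ck_on j S (\<lambda>x. f' x w)" by auto
  have "(g has_derivative f' x) (at x)" if "x \<in> S" for x
    using has_derivative_transform_within_open[OF f'(1)[OF that] assms(1) that] assms(2) by auto
  with f'(2) Suc show ?thesis by auto
qed

lemma Ck_on_Suc_imp_Ck_on: "Ck_on (Suc k) S f \<Longrightarrow> Ck_on k S f"
proof (induction k arbitrary: f)
  case 0
  then show ?case
    by (auto intro!: continuous_at_imp_continuous_on intro: has_derivative_continuous)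
next
  case (Suc k)
  obtain f' where f': "\<forall>x\<in>S. (f has_derivative f' x) (at x)" "\<forall>w. Ck_on (Suc k) S (\<lambda>x. f' x w)"
    using Suc.prems unfolding Ck_on.simps(2)[of "Suc k"] by blast
  have "\<forall>w. Ck_on k S (\<lambda>x. f' x w)" using f'(2) Suc.IH by blast
  with f'(1) show ?case unfolding Ck_on.simps(2) by blast
qed

text \<open>On an open set derivatives are unique, so derivatives given locally fit together; the Frechet
  derivative serves as a common choice.\<close>

lemma Ck_on_local:
  assumes "\<And>x. x \<in> S \<Longrightarrow> \<exists>T. open T \<and> x \<in> T \<and> Ck_on k T f"
  shows "Ck_on k S f"
  using assms
proof (induction k arbitrary: f)
  case 0
  then show ?case
    by simp (meson continuous_at_imp_continuous_on continuous_on_eq_continuous_at)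
next
  case (Suc k)
  let ?f' = "\<lambda>x. frechet_derivative f (at x)"
  have *: "\<exists>T. open T \<and> x \<in> T \<and> (\<forall>y\<in>T. (f has_derivative ?f' y) (at y)) \<and> (\<forall>w. Ck_on k T (\<lambda>y. ?f' y w))"
    if x: "x \<in> S" for x
  proof -
    obtain T f' where T: "open T" "x \<in> T" and f': "\<And>y. y \<in> T \<Longrightarrow> (f has_derivative f' y) (at y)"
      and Ck: "\<And>w. Ck_on k T (\<lambda>y. f' y w)"
      using Suc.prems[OF x] by auto
    have eq: "f' y = ?f' y" if "y \<in> T" for y using frechet_derivative_at[OF f'[OF that]] .
    have "Ck_on k T (\<lambda>y. ?f' y w)" for w
      by (rule Ck_on_cong[OF T(1) _ Ck[of w]]) (simp add: eq)
    with T f' eq show ?thesis by metis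
  qed
  have "Ck_on k S (\<lambda>y. ?f' y w)" for w
    by (rule Suc.IH) (use * in meson)
  moreover have "\<forall>x\<in>S. (f has_derivative ?f' x) (at x)" using * by meson
  ultimately show ?case unfolding Ck_on.simps by (intro exI[of _ ?f']) simp
qed

lemma Ck_on_const: "Ck_on k S (\<lambda>_. c)"
proof (induction k arbitrary: c)
  case (Suc k)
  then show ?case by (auto intro!: exI[of _ "\<lambda>_ _. 0"])
qed simp

lemma Ck_on_ident: "Ck_on k S (\<lambda>x. x)"
proof (cases k)
  case (Suc j)
  then show ?thesis by (auto intro!: exI[of _ "\<lambda>_ w. w"] Ck_on_const)
qed simp

lemma Ck_on_add: "Ck_on k S f \<Longrightarrow> Ck_on k S g \<Longrightarrow> Ck_on k S (\<lambda>x. f x + g x)"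
proof (induction k arbitrary: f g)
  case 0
  then show ?case by (auto intro: continuous_on_add)
next
  case (Suc k)
  then obtain f' g' where "\<forall>x\<in>S. (f has_derivative f' x) (at x)" "\<forall>w. Ck_on k S (\<lambda>x. f' x w)"
     "\<forall>x\<in>S. (g has_derivative g' x) (at x)" "\<forall>w. Ck_on k S (\<lambda>x. g' x w)" by auto
  with Suc.IH show ?case
    by (auto intro!: exI[of _ "\<lambda>x w. f' x w + g' x w"] has_derivative_add)
qed

lemma Ck_on_sum: "finite I \<Longrightarrow> (\<And>i. i \<in> I \<Longrightarrow> Ck_on k S (f i)) \<Longrightarrow> Ck_on k S (\<lambda>x. \<Sum>i\<in>I. f i x)"
  by (induction I rule: finite_induct) (auto intro: Ck_on_const Ck_on_add)

lemma Ck_on_bounded_linear: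
  assumes h: "bounded_linear h"
  shows "Ck_on k S f \<Longrightarrow> Ck_on k S (\<lambda>x. h (f x))"
proof (induction k arbitrary: f)
  case 0
  then show ?case using bounded_linear.continuous_on[OF h] by auto
next
  case (Suc k)
  then obtain f' where "\<forall>x\<in>S. (f has_derivative f' x) (at x)" "\<forall>w. Ck_on k S (\<lambda>x. f' x w)" by auto
  with Suc.IH show ?case
    by (auto intro!: exI[of _ "\<lambda>x w. h (f' x w)"] bounded_linear.has_derivative[OF h])
qed

lemma Ck_on_scaleR:
  fixes f :: "'a::euclidean_space \<Rightarrow> real" and g :: "'a \<Rightarrow> 'b::real_normed_vector"
  shows "Ck_on k S f \<Longrightarrow> Ck_on k S g \<Longrightarrow> Ck_on k S (\<lambda>x. f x *\<^sub>R g x)"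
proof (induction k arbitrary: f g)
  case 0
  then show ?case by (auto intro: continuous_on_scaleR)
next
  case (Suc k)
  then obtain f' g' where *: "\<forall>x\<in>S. (f has_derivative f' x) (at x)" "\<forall>w. Ck_on k S (\<lambda>x. f' x w)"
     "\<forall>x\<in>S. (g has_derivative g' x) (at x)" "\<forall>w. Ck_on k S (\<lambda>x. g' x w)" by auto
  have "Ck_on k S f" "Ck_on k S g"
    by (rule Suc.prems[THEN Ck_on_Suc_imp_Ck_on])+
  note Ck = this
  show ?case unfolding Ck_on.simps
  proof (intro exI[of _ "\<lambda>x w. f x *\<^sub>R g' x w + f' x w *\<^sub>R g x"] conjI ballI allI)
    show "((\<lambda>x. f x *\<^sub>R g x) has_derivative (\<lambda>w. f x *\<^sub>R g' x w + f' x w *\<^sub>R g x)) (at x)"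
      if "x \<in> S" for x
      by (rule has_derivative_scaleR) (use * that in blast)+
    show "Ck_on k S (\<lambda>x. f x *\<^sub>R g' x w + f' x w *\<^sub>R g x)" for w
      by (intro Ck_on_add Suc.IH Ck) (use * in blast)+
  qed
qed

text \<open>In the derivative \<open>g' (f x) (f' x w)\<close> both the map and its argument vary with \<open>x\<close>. Expanding the
  argument in a basis turns it into a sum of products to whose factors the induction hypothesis
  applies.\<close>

lemma Ck_on_compose:
  fixes f :: "'a::euclidean_space \<Rightarrow> 'b::euclidean_space" and g :: "'b \<Rightarrow> 'c::real_normed_vector"
  shows "Ck_on k T g \<Longrightarrow> Ck_on k S f \<Longrightarrow> f ` S \<subseteq> T \<Longrightarrow> Ck_on k S (\<lambda>x. g (f x))"
proof (induction k arbitrary: g)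
  case 0
  then show ?case using continuous_on_compose2[of T g S f] by simp
next
  case (Suc k)
  obtain f' where f': "\<And>x. x \<in> S \<Longrightarrow> (f has_derivative f' x) (at x)" "\<And>w. Ck_on k S (\<lambda>x. f' x w)"
    using Suc.prems(2) by auto
  obtain g' where g': "\<And>y. y \<in> T \<Longrightarrow> (g has_derivative g' y) (at y)" "\<And>w. Ck_on k T (\<lambda>y. g' y w)"
    using Suc.prems(1) by auto
  have Ckf: "Ck_on k S f" using Suc.prems(2) by (rule Ck_on_Suc_imp_Ck_on)
  show ?case unfolding Ck_on.simps
  proof (intro exI[of _ "\<lambda>x w. \<Sum>i\<in>Basis. (f' x w \<bullet> i) *\<^sub>R g' (f x) i"] conjI ballI allI)
    fix x assume x: "x \<in> S"
    then have fx: "f x \<in> T" using Suc.prems(3) by blast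
    interpret g': bounded_linear "g' (f x)" using g'(1)[OF fx] by (rule has_derivative_bounded_linear)
    have "g' (f x) z = (\<Sum>i\<in>Basis. (z \<bullet> i) *\<^sub>R g' (f x) i)" for z
    proof -
      have "g' (f x) z = g' (f x) (\<Sum>i\<in>Basis. (z \<bullet> i) *\<^sub>R i)" by (simp only: euclidean_representation)
      also have "\<dots> = (\<Sum>i\<in>Basis. (z \<bullet> i) *\<^sub>R g' (f x) i)" by (simp only: g'.sum g'.scaleR)
      finally show ?thesis .
    qed
    then have "(\<lambda>w. g' (f x) (f' x w)) = (\<lambda>w. \<Sum>i\<in>Basis. (f' x w \<bullet> i) *\<^sub>R g' (f x) i)"
      by (rule ext)
    from has_derivative_compose[OF f'(1)[OF x] g'(1)[OF fx], unfolded this]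
    show "((\<lambda>x. g (f x)) has_derivative (\<lambda>w. \<Sum>i\<in>Basis. (f' x w \<bullet> i) *\<^sub>R g' (f x) i)) (at x)" .
  next
    fix w
    show "Ck_on k S (\<lambda>x. \<Sum>i\<in>Basis. (f' x w \<bullet> i) *\<^sub>R g' (f x) i)"
    proof (intro Ck_on_sum finite_Basis Ck_on_scaleR)
      fix i :: 'b
      show "Ck_on k S (\<lambda>x. f' x w \<bullet> i)"
        by (rule Ck_on_bounded_linear[OF bounded_linear_inner_left f'(2)])
      show "Ck_on k S (\<lambda>x. g' (f x) i)"
        by (rule Suc.IH[OF g'(2) Ckf Suc.prems(3)])
    qed
  qed
qed

lemma smooth_on_differentiable:
  assumes "smooth_on S f" "x \<in> S" shows "f differentiable (at x)"
proof -
  from assms(1) have "Ck_on (Suc 0) S f" unfolding smooth_on_def by blast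
  with assms(2) show ?thesis unfolding differentiable_def by auto
qed

section \<open>Charts\<close>

lemma chart_open:
  assumes "smooth_atlas A" "(U, \<phi>) \<in> A"
  shows "open U" "open (\<phi> ` U)" "homeomorphism U (\<phi> ` U) \<phi> (inv_into U \<phi>)" "inj_on \<phi> U"
proof -
  show *: "open U" "open (\<phi> ` U)" "homeomorphism U (\<phi> ` U) \<phi> (inv_into U \<phi>)"
    using assms unfolding smooth_atlas_def by auto
  show "inj_on \<phi> U" using *(3) by (metis homeomorphism_def inj_on_inverseI)
qed

lemma chart_image_open:
  assumes "smooth_atlas A" "(U, \<phi>) \<in> A" "open W"
  shows "open (\<phi> ` (U \<inter> W))"
proof -
  note * = chart_open[OF assms(1,2)]
  have "openin (top_of_set (\<phi> ` U)) (\<phi> ` (U \<inter> W))"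
    by (rule homeomorphism_imp_open_map[OF *(3)]) (use assms(3) in auto)
  then show ?thesis using *(2) by (rule openin_open_trans)
qed

text \<open>The chain rule for a change of charts. It makes the tangent space at a point the range of a
  single linear map on the model space, although its definition takes a union over all charts.\<close>

lemma smooth_fns_transition:
  assumes A: "smooth_atlas A" and U: "(U, \<phi>) \<in> A" "p \<in> U" and V: "(V, \<psi>) \<in> A" "p \<in> V"
    and f: "f \<in> smooth_fns A"
  shows "frechet_derivative (f \<circ> inv_into U \<phi>) (at (\<phi> p)) w =
    frechet_derivative (f \<circ> inv_into V \<psi>) (at (\<psi> p))
      (frechet_derivative (\<psi> \<circ> inv_into U \<phi>) (at (\<phi> p)) w)"
proof -
  let ?S = "\<phi> ` (U \<inter> V)" and ?t = "\<psi> \<circ> inv_into U \<phi>"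
  note cU = chart_open[OF A U(1)] and cV = chart_open[OF A V(1)]
  have S: "open ?S" by (rule chart_image_open[OF A U(1) cV(1)])
  have pS: "\<phi> p \<in> ?S" using U V by auto
  have t: "smooth_on ?S ?t" using A U V unfolding smooth_atlas_def by fast
  have tp: "?t (\<phi> p) = \<psi> p" using U cU by simp
  have dt: "(?t has_derivative frechet_derivative ?t (at (\<phi> p))) (at (\<phi> p))"
    using smooth_on_differentiable[OF t pS] frechet_derivative_works by blast
  have "smooth_on (\<psi> ` V) (f \<circ> inv_into V \<psi>)" using f V unfolding smooth_fns_def by auto
  from smooth_on_differentiable[OF this, of "\<psi> p"]
  have df: "(f \<circ> inv_into V \<psi> has_derivative frechet_derivative (f \<circ> inv_into V \<psi>) (at (\<psi> p))) (at (?t (\<phi> p)))"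
    using V frechet_derivative_works tp by auto
  have "((f \<circ> inv_into V \<psi>) \<circ> ?t has_derivative frechet_derivative (f \<circ> inv_into V \<psi>) (at (\<psi> p)) \<circ> frechet_derivative ?t (at (\<phi> p))) (at (\<phi> p))"
    by (rule diff_chain_at[OF dt df])
  then have "(f \<circ> inv_into U \<phi> has_derivative frechet_derivative (f \<circ> inv_into V \<psi>) (at (\<psi> p)) \<circ> frechet_derivative ?t (at (\<phi> p))) (at (\<phi> p))"
    by (rule has_derivative_transform_within_open[OF _ S pS]) (use cU cV in auto)
  from frechet_derivative_at[OF this] show ?thesis by (metis comp_apply)
qed

definition chart_vector ::
  "('g, 'm::euclidean_space) atlas \<Rightarrow> 'g set \<Rightarrow> ('g \<Rightarrow> 'm) \<Rightarrow> 'g \<Rightarrow> 'm \<Rightarrow> 'g sfun \<Rightarrow> real" where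
  "chart_vector A U \<phi> p w = (\<lambda>f. if f \<in> smooth_fns A
     then frechet_derivative (f \<circ> inv_into U \<phi>) (at (\<phi> p)) w else 0)"

lemma tangent_space_chart:
  assumes "smooth_atlas A" "(U, \<phi>) \<in> A" "p \<in> U"
  shows "tangent_space A p = range (chart_vector A U \<phi> p)"
proof
  show "range (chart_vector A U \<phi> p) \<subseteq> tangent_space A p"
    using assms unfolding tangent_space_def chart_vector_def by fast
  show "tangent_space A p \<subseteq> range (chart_vector A U \<phi> p)"
  proof
    fix t assume "t \<in> tangent_space A p"
    then obtain V \<psi> w where V: "(V, \<psi>) \<in> A" "p \<in> V" and t: "t = chart_vector A V \<psi> p w"
      unfolding tangent_space_def chart_vector_def by blast
    have "t = chart_vector A U \<phi> p (frechet_derivative (\<phi> \<circ> inv_into V \<psi>) (at (\<psi> p)) w)"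
      unfolding t chart_vector_def using smooth_fns_transition[OF assms(1) V assms(2,3)]
      by (intro ext) simp
    then show "t \<in> range (chart_vector A U \<phi> p)" by blast
  qed
qed

lemma chart_exists:
  assumes "smooth_atlas A" obtains U \<phi> where "(U, \<phi>) \<in> A" "p \<in> U"
  using assms unfolding smooth_atlas_def by fast

lemma smooth_fns_has_derivative:
  assumes "smooth_atlas A" "(U, \<phi>) \<in> A" "p \<in> U" "f \<in> smooth_fns A"
  shows "(f \<circ> inv_into U \<phi> has_derivative frechet_derivative (f \<circ> inv_into U \<phi>) (at (\<phi> p))) (at (\<phi> p))"
proof -
  have "smooth_on (\<phi> ` U) (f \<circ> inv_into U \<phi>)" using assms unfolding smooth_fns_def by auto
  then show ?thesis using smooth_on_differentiable assms(3) frechet_derivative_works by blast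
qed

lemma chart_vector_linear:
  assumes "smooth_atlas A" "(U, \<phi>) \<in> A" "p \<in> U"
  shows "chart_vector A U \<phi> p (x + y) f = chart_vector A U \<phi> p x f + chart_vector A U \<phi> p y f"
    and "chart_vector A U \<phi> p (r *\<^sub>R x) f = r * chart_vector A U \<phi> p x f"
proof -
  have "linear (frechet_derivative (f \<circ> inv_into U \<phi>) (at (\<phi> p)))" if "f \<in> smooth_fns A"
    using smooth_fns_has_derivative[OF assms that] has_derivative_linear by blast
  then show "chart_vector A U \<phi> p (x + y) f = chart_vector A U \<phi> p x f + chart_vector A U \<phi> p y f"
    and "chart_vector A U \<phi> p (r *\<^sub>R x) f = r * chart_vector A U \<phi> p x f"
    unfolding chart_vector_def by (simp_all add: linear_add linear_cmul)
qed

section \<open>Smooth functions and vector fields\<close>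

lemma smooth_fns_const: "(\<lambda>_. c) \<in> smooth_fns A"
  unfolding smooth_fns_def smooth_on_def by (auto simp: comp_def intro: Ck_on_const)

lemma smooth_fns_0: "0 \<in> smooth_fns A" and smooth_fns_1: "1 \<in> smooth_fns A"
  using smooth_fns_const[of 0] smooth_fns_const[of 1] by (simp_all add: zero_fun_def one_fun_def)

lemma smooth_fns_add: "f \<in> smooth_fns A \<Longrightarrow> g \<in> smooth_fns A \<Longrightarrow> f + g \<in> smooth_fns A"
  unfolding smooth_fns_def smooth_on_def by (auto simp: comp_def intro!: Ck_on_add)

lemma smooth_fns_mult:
  assumes "f \<in> smooth_fns A" "k \<in> smooth_fns A" shows "f * k \<in> smooth_fns A"
  unfolding smooth_fns_def smooth_on_def
proof (clarify)
  fix U \<phi> n assume "(U, \<phi>) \<in> A"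
  with assms have "Ck_on n (\<phi> ` U) (f \<circ> inv_into U \<phi>)" "Ck_on n (\<phi> ` U) (k \<circ> inv_into U \<phi>)"
    unfolding smooth_fns_def smooth_on_def by auto
  from Ck_on_scaleR[OF this] show "Ck_on n (\<phi> ` U) (f * k \<circ> inv_into U \<phi>)"
    by (simp add: comp_def)
qed

lemma smooth_fns_uminus: "f \<in> smooth_fns A \<Longrightarrow> - f \<in> smooth_fns A"
  using smooth_fns_mult[OF smooth_fns_const[of "-1"], of f] by (simp add: times_fun_def fun_Compl_def)

lemma smooth_fns_diff: "f \<in> smooth_fns A \<Longrightarrow> g \<in> smooth_fns A \<Longrightarrow> f - g \<in> smooth_fns A"
  using smooth_fns_add[OF _ smooth_fns_uminus, of f A g] by simp

lemma smooth_fns_sum: "(\<And>i. i \<in> I \<Longrightarrow> f i \<in> smooth_fns A) \<Longrightarrow> sum f I \<in> smooth_fns A"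
  by (induction I rule: infinite_finite_induct) (auto intro: smooth_fns_0 smooth_fns_add)

lemma vector_fields_smooth: "X \<in> vector_fields A \<Longrightarrow> f \<in> smooth_fns A \<Longrightarrow> X f \<in> smooth_fns A"
  unfolding vector_fields_def by blast

lemma vector_fields_chart:
  assumes "smooth_atlas A" "X \<in> vector_fields A" "(U, \<phi>) \<in> A" "p \<in> U"
  obtains w where "\<And>f. X f p = chart_vector A U \<phi> p w f"
proof -
  have "(\<lambda>f. X f p) \<in> range (chart_vector A U \<phi> p)"
    using assms tangent_space_chart[OF assms(1,3,4)] unfolding vector_fields_def by auto
  then show ?thesis using that by (metis (mono_tags, lifting) imageE)
qed

lemma vector_fields_non_smooth:
  assumes "smooth_atlas A" "X \<in> vector_fields A" "f \<notin> smooth_fns A" shows "X f = 0"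
proof
  fix p
  obtain U \<phi> where U: "(U, \<phi>) \<in> A" "p \<in> U" using chart_exists[OF assms(1)] .
  obtain w where "\<And>f. X f p = chart_vector A U \<phi> p w f"
    using vector_fields_chart[OF assms(1,2) U] by blast
  then show "X f p = 0 p" using assms(3) by (simp add: chart_vector_def)
qed

lemma vector_fields_derivation:
  assumes A: "smooth_atlas A" and X: "X \<in> vector_fields A"
    and f: "f \<in> smooth_fns A" and k: "k \<in> smooth_fns A"
  shows "X (f + k) = X f + X k" "X (f * k) = X f * k + f * X k"
proof -
  have "X (f + k) p = X f p + X k p \<and> X (f * k) p = X f p * k p + f p * X k p" for p
  proof -
    obtain U \<phi> where U: "(U, \<phi>) \<in> A" "p \<in> U" using chart_exists[OF A] .
    obtain w where w: "\<And>f. X f p = chart_vector A U \<phi> p w f" using vector_fields_chart[OF A X U] by blast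
    note d = smooth_fns_has_derivative[OF A U f] smooth_fns_has_derivative[OF A U k]
    have p: "inv_into U \<phi> (\<phi> p) = p" using U chart_open[OF A U(1)] by simp
    have eq: "(f + k) \<circ> inv_into U \<phi> = (\<lambda>x. (f \<circ> inv_into U \<phi>) x + (k \<circ> inv_into U \<phi>) x)"
      "(f * k) \<circ> inv_into U \<phi> = (\<lambda>x. (f \<circ> inv_into U \<phi>) x * (k \<circ> inv_into U \<phi>) x)"
      by (auto simp: plus_fun_def times_fun_def)
    show ?thesis
      unfolding w chart_vector_def eq
      using frechet_derivative_at[OF has_derivative_add[OF d]]
        frechet_derivative_at[OF has_derivative_mult[OF d]] f k smooth_fns_add[OF f k] smooth_fns_mult[OF f k]
      by (auto simp: p eq dest!: fun_cong[where x = w])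
  qed
  then show "X (f + k) = X f + X k" "X (f * k) = X f * k + f * X k" by auto
qed

lemma vector_fields_const:
  assumes "smooth_atlas A" "X \<in> vector_fields A" shows "X (\<lambda>_. c) = 0"
proof
  fix p
  obtain U \<phi> where U: "(U, \<phi>) \<in> A" "p \<in> U" using chart_exists[OF assms(1)] .
  obtain w where "\<And>f. X f p = chart_vector A U \<phi> p w f"
    using vector_fields_chart[OF assms(1,2) U] by blast
  moreover have "(\<lambda>_. c) \<circ> inv_into U \<phi> = (\<lambda>_. c)" by auto
  ultimately show "X (\<lambda>_. c) p = 0 p" by (simp add: chart_vector_def smooth_fns_const)
qed

lemma vector_fields_0:
  assumes "smooth_atlas A" shows "0 \<in> vector_fields A"
proof -
  have "(\<lambda>f. 0) \<in> tangent_space A p" for p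
  proof -
    obtain U \<phi> where U: "(U, \<phi>) \<in> A" "p \<in> U" using chart_exists[OF assms(1)] .
    have "(\<lambda>f. 0) = chart_vector A U \<phi> p (0 *\<^sub>R 0)"
      by (rule ext) (simp only: chart_vector_linear[OF assms U] mult_zero_left)
    then show ?thesis unfolding tangent_space_chart[OF assms U] by blast
  qed
  then show ?thesis unfolding vector_fields_def by (simp add: zero_fun_def[symmetric] smooth_fns_0)
qed

text \<open>Two tangent vectors at a point may be given in different charts; in a common chart the components
  add up.\<close>

lemma vector_fields_add:
  assumes A: "smooth_atlas A" and "X \<in> vector_fields A" "Y \<in> vector_fields A"
  shows "X + Y \<in> vector_fields A"
proof -
  have "(\<lambda>f. (X + Y) f p) \<in> tangent_space A p" for p
  proof -
    obtain U \<phi> where U: "(U, \<phi>) \<in> A" "p \<in> U" using chart_exists[OF A] .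
    obtain x y where "\<And>f. X f p = chart_vector A U \<phi> p x f" "\<And>f. Y f p = chart_vector A U \<phi> p y f"
      using vector_fields_chart[OF A _ U] assms by metis
    then have "(\<lambda>f. (X + Y) f p) = chart_vector A U \<phi> p (x + y)"
      by (simp add: fun_eq_iff chart_vector_linear[OF A U])
    then show ?thesis unfolding tangent_space_chart[OF A U] by blast
  qed
  then show ?thesis using assms by (simp add: vector_fields_def smooth_fns_add)
qed

lemma vector_fields_smul:
  assumes A: "smooth_atlas A" and X: "X \<in> vector_fields A" and h: "h \<in> smooth_fns A"
  shows "(\<lambda>f. h * X f) \<in> vector_fields A"
proof -
  have "(\<lambda>f. (h * X f) p) \<in> tangent_space A p" for p
  proof -
    obtain U \<phi> where U: "(U, \<phi>) \<in> A" "p \<in> U" using chart_exists[OF A] .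
    obtain x where "\<And>f. X f p = chart_vector A U \<phi> p x f"
      using vector_fields_chart[OF A _ U] assms by metis
    then have "(\<lambda>f. (h * X f) p) = chart_vector A U \<phi> p (h p *\<^sub>R x)"
      by (simp add: fun_eq_iff chart_vector_linear[OF A U])
    then show ?thesis unfolding tangent_space_chart[OF A U] by blast
  qed
  then show ?thesis using X h by (simp add: vector_fields_def smooth_fns_mult)
qed

section \<open>Left-invariant frames\<close>

text \<open>Near a point \<open>x\<close> the translation by \<open>q\<close> is the multiplication restricted to the slice of a product
  chart through \<open>(q, x)\<close>.\<close>

lemma smooth_fns_left_translation:
  fixes A :: "('g::{t2_space, second_countable_topology}, 'm::euclidean_space) atlas"
  assumes G: "lie_group mul unit ginv A" and f: "f \<in> smooth_fns A"
  shows "f \<circ> mul q \<in> smooth_fns A"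
  unfolding smooth_fns_def smooth_on_def
proof (clarify)
  fix V \<psi> k assume V: "(V, \<psi>) \<in> A"
  let ?m = "\<lambda>(x, y). mul x y"
  have A: "smooth_atlas A" and m: "smooth_map (prod_atlas A A) A ?m"
    using G unfolding lie_group_def by auto
  note cV = chart_open[OF A V]
  show "Ck_on k (\<psi> ` V) (f \<circ> mul q \<circ> inv_into V \<psi>)"
  proof (rule Ck_on_local)
    fix y assume "y \<in> \<psi> ` V"
    then obtain x where x: "x \<in> V" "y = \<psi> x" by auto
    obtain U \<phi> where U: "(U, \<phi>) \<in> A" "q \<in> U" using chart_exists[OF A] .
    obtain W \<theta> where W: "(W, \<theta>) \<in> A" "mul q x \<in> W" using chart_exists[OF A] .
    note cU = chart_open[OF A U(1)] and cW = chart_open[OF A W(1)]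
    let ?T = "\<psi> ` (V \<inter> (mul q -` W))" and ?P = "map_prod \<phi> \<psi>"
    let ?h = "\<theta> \<circ> ?m \<circ> inv_into (U \<times> V) ?P"
    have "continuous_on UNIV ?m" using m unfolding smooth_map_def by blast
    then have "continuous_on UNIV (\<lambda>z. ?m (q, z))"
      by (rule continuous_on_compose2) (auto intro!: continuous_intros)
    then have "open (mul q -` W)"
      using cW(1) open_vimage[of W "mul q"] by simp
    then have T: "open ?T" by (rule chart_image_open[OF A V])
    have P: "inv_into (U \<times> V) ?P (\<phi> q, \<psi> z) = (q, z)" if "z \<in> V" for z
    proof -
      have "inj_on ?P (U \<times> V)" using cU(4) cV(4) by (rule map_prod_inj_on)
      from inv_into_f_f[OF this, of "(q, z)"] that U show ?thesis by simp
    qed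
    have "(U \<times> V, ?P) \<in> prod_atlas A A" using U V unfolding prod_atlas_def by blast
    then have h: "Ck_on k (?P ` ((U \<times> V) \<inter> ?m -` W)) ?h"
      using m W unfolding smooth_map_def smooth_on_def by fast
    have i: "Ck_on k ?T (\<lambda>z. (\<phi> q, 0) + (0, z))"
      by (intro Ck_on_add Ck_on_const Ck_on_bounded_linear[OF _ Ck_on_ident])
        (intro bounded_linear_Pair bounded_linear_zero bounded_linear_ident)
    have hi: "Ck_on k ?T (\<lambda>z. ?h ((\<phi> q, 0) + (0, z)))"
      by (rule Ck_on_compose[OF h i]) (use U in force)
    have fk: "Ck_on k (\<theta> ` W) (f \<circ> inv_into W \<theta>)"
      using f W unfolding smooth_fns_def smooth_on_def by auto
    have "Ck_on k ?T (\<lambda>z. (f \<circ> inv_into W \<theta>) (?h ((\<phi> q, 0) + (0, z))))"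
      by (rule Ck_on_compose[OF fk hi]) (auto simp: P)
    then have "Ck_on k ?T (f \<circ> mul q \<circ> inv_into V \<psi>)"
      by (rule Ck_on_cong[OF T, rotated]) (use cV cW in \<open>auto simp: P\<close>)
    then show "\<exists>T. open T \<and> y \<in> T \<and> Ck_on k T (f \<circ> mul q \<circ> inv_into V \<psi>)"
      using T x W by blast
  qed
qed

text \<open>The value of a left-invariant field at \<open>r\<close> is the image of its value at \<open>p\<close> under the translation
  taking \<open>p\<close> to \<open>r\<close>.\<close>

lemma left_invariant_field_zero:
  fixes A :: "('g::{t2_space, second_countable_topology}, 'm::euclidean_space) atlas"
  assumes G: "lie_group mul unit ginv A" and X: "X \<in> lie_algebra mul ginv A"
    and p: "\<And>f. f \<in> smooth_fns A \<Longrightarrow> X f p = 0"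
  shows "X = 0"
proof (rule ext)
  fix f
  interpret group mul unit ginv using G unfolding lie_group_def by blast
  have A: "smooth_atlas A" using G unfolding lie_group_def by auto
  have XV: "X \<in> vector_fields A" using X unfolding lie_algebra_def by auto
  show "X f = 0 f"
  proof (cases "f \<in> smooth_fns A")
    case True
    have "X f r = 0" for r
    proof -
      let ?q = "mul r (ginv p)"
      have "X f = push mul ginv ?q X f" using X unfolding lie_algebra_def by auto
      then have "X f r = X (f \<circ> mul ?q) (mul (ginv ?q) r)" unfolding push_def by (metis comp_apply)
      moreover have "mul (ginv ?q) r = p" by (simp add: inverse_distrib_swap assoc)
      ultimately show ?thesis using p[OF smooth_fns_left_translation[OF G True]] by simp
    qed
    then show ?thesis by auto
  qed (use vector_fields_non_smooth[OF A XV] in simp)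
qed

lemma sum_1_3: "(\<Sum>a\<in>{1..3::nat}. f a) = f 1 + f 2 + f (3::nat)"
proof -
  have "{1..3::nat} = {1, 2, 3}" by auto
  then show ?thesis by (simp add: add.assoc)
qed

lemma in_1_3: "a \<in> {1..3::nat} \<longleftrightarrow> a = 1 \<or> a = 2 \<or> a = 3"
  by auto

definition det3 :: "(nat \<Rightarrow> 'a) \<Rightarrow> (nat \<Rightarrow> 'a) \<Rightarrow> (nat \<Rightarrow> 'a) \<Rightarrow> 'a::comm_ring" where
  "det3 x y z = x 1 * (y 2 * z 3 - y 3 * z 2) - x 2 * (y 1 * z 3 - y 3 * z 1) + x 3 * (y 1 * z 2 - y 2 * z 1)"

lemma det3_combination:
  fixes m1 m2 m3 :: "nat \<Rightarrow> 'a::comm_ring"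
  shows "det3 (\<lambda>b. x1 * m1 b + x2 * m2 b + x3 * m3 b) m2 m3 = x1 * det3 m1 m2 m3"
    and "det3 m1 (\<lambda>b. x1 * m1 b + x2 * m2 b + x3 * m3 b) m3 = x2 * det3 m1 m2 m3"
    and "det3 m1 m2 (\<lambda>b. x1 * m1 b + x2 * m2 b + x3 * m3 b) = x3 * det3 m1 m2 m3"
  by (simp_all add: det3_def algebra_simps)

locale lie_group_frame =
  fixes mul :: "'g::{t2_space, second_countable_topology} \<Rightarrow> 'g \<Rightarrow> 'g"
    and unit :: 'g and ginv :: "'g \<Rightarrow> 'g" and A :: "('g, real^3) atlas"
    and v :: "nat \<Rightarrow> 'g vfield"
  assumes G: "lie_group mul unit ginv A"
    and v_basis: "lie_algebra_basis3 mul ginv A v"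
begin

lemma A: "smooth_atlas A"
  using G unfolding lie_group_def by auto

lemma v_lie_algebra: "a \<in> {1..3} \<Longrightarrow> v a \<in> lie_algebra mul ginv A"
  using v_basis unfolding lie_algebra_basis3_def by blast

lemma v_field: "a \<in> {1..3} \<Longrightarrow> v a \<in> vector_fields A"
  using v_lie_algebra unfolding lie_algebra_def by blast

lemma lincomb3_eq: "lincomb3 c v = (\<lambda>f. (\<lambda>_. c 1) * v 1 f) + (\<lambda>f. (\<lambda>_. c 2) * v 2 f) + (\<lambda>f. (\<lambda>_. c 3) * v 3 f)"
  unfolding lincomb3_def sum_1_3 by (auto simp: fun_eq_iff)

lemma lincomb3_lie_algebra: "lincomb3 c v \<in> lie_algebra mul ginv A"
proof -
  have "lincomb3 c v \<in> vector_fields A"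
    unfolding lincomb3_eq
    by (intro vector_fields_add vector_fields_smul smooth_fns_const A v_field) auto
  moreover have "push mul ginv q (lincomb3 c v) = lincomb3 c v" for q
  proof -
    have "push mul ginv q (v a) = v a" if "a \<in> {1..3}" for a
      using v_lie_algebra[OF that] unfolding lie_algebra_def by blast
    then have "push mul ginv q (v a) f p = v a f p" if "a \<in> {1..3}" for a f p
      using that by simp
    then have "v a (f \<circ> mul q) (mul (ginv q) p) = v a f p" if "a \<in> {1..3}" for a f p
      using that unfolding push_def comp_apply by blast
    then show ?thesis unfolding push_def lincomb3_def by (auto simp: fun_eq_iff intro!: sum.cong)
  qed
  ultimately show ?thesis unfolding lie_algebra_def by blast
qed

lemma lincomb3_inject:
  assumes "lincomb3 c v = lincomb3 c' v" "a \<in> {1..3}" shows "c a = c' a"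
proof -
  define z where "z c a = (if a \<in> {1..3} then c a else (0::real))" for c and a :: nat
  have z: "lincomb3 (z c) v = lincomb3 c v" for c
    unfolding lincomb3_def z_def by (intro ext sum.cong) auto
  have "\<exists>!x. (\<forall>a. a \<notin> {1..3} \<longrightarrow> x a = 0) \<and> lincomb3 c v = lincomb3 x v"
    using v_basis lincomb3_lie_algebra[of c] unfolding lie_algebra_basis3_def by blast
  moreover have "\<forall>a. a \<notin> {1..3} \<longrightarrow> z x a = 0" for x by (simp add: z_def)
  ultimately have "z c = z c'" using z[of c] z[of c'] assms(1) by metis
  then have "z c a = z c' a" by simp
  then show ?thesis using assms(2) by (simp add: z_def)
qed

text \<open>A relation with constant coefficients at the point \<open>p\<close> is a left-invariant field that vanishes at
  \<open>p\<close>, hence everywhere.\<close>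

lemma v_independent:
  assumes "\<And>f. f \<in> smooth_fns A \<Longrightarrow> (\<Sum>a\<in>{1..3}. c a * v a f p) = 0" "a \<in> {1..3}"
  shows "c a = 0"
proof -
  have "lincomb3 c v = 0"
    by (rule left_invariant_field_zero[OF G lincomb3_lie_algebra, of c p])
      (use assms(1) in \<open>simp add: lincomb3_def\<close>)
  also have "0 = lincomb3 (\<lambda>_. 0) v" by (simp add: lincomb3_def fun_eq_iff)
  finally show ?thesis using lincomb3_inject assms(2) by blast
qed

text \<open>The vectors \<open>(v 1 f p, v 2 f p, v 3 f p)\<close> form a linear subspace of the three-dimensional space. A
  normal vector of a proper subspace would be a linear relation between the \<open>v a\<close> at \<open>p\<close>.\<close>

lemma v_dual: "\<exists>f\<in>smooth_fns A. \<forall>a\<in>{1..3}. v a f p = y a"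
proof -
  let ?ev = "\<lambda>f. vector [v 1 f p, v 2 f p, v 3 f p] :: real^3"
  let ?S = "?ev ` smooth_fns A"
  have lin: "v a (\<lambda>_. 0) p = 0" "f \<in> smooth_fns A \<Longrightarrow> k \<in> smooth_fns A \<Longrightarrow> v a (f + k) p = v a f p + v a k p"
    "f \<in> smooth_fns A \<Longrightarrow> v a ((\<lambda>_. r) * f) p = r * v a f p" if "a \<in> {1..3}" for a f k r
    subgoal using vector_fields_const[OF A v_field[OF that], of 0] by simp
    subgoal using vector_fields_derivation(1)[OF A v_field[OF that], of f k] by simp
    subgoal using vector_fields_derivation(2)[OF A v_field[OF that] smooth_fns_const, of f r]
      vector_fields_const[OF A v_field[OF that], of r] by simp
    done
  have a123: "1 \<in> {1..3::nat}" "2 \<in> {1..3::nat}" "3 \<in> {1..3::nat}" by auto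
  have "subspace ?S" unfolding subspace_def
  proof (intro conjI ballI allI)
    have "?ev (\<lambda>_. 0) = 0"
      unfolding lin(1)[OF a123(1)] lin(1)[OF a123(2)] lin(1)[OF a123(3)]
      by (simp add: vec_eq_iff forall_3)
    then show "0 \<in> ?S" by (intro image_eqI[OF _ smooth_fns_const]) simp
  next
    fix x y assume "x \<in> ?S" "y \<in> ?S"
    then obtain f k where f: "f \<in> smooth_fns A" "x = ?ev f" and k: "k \<in> smooth_fns A" "y = ?ev k" by blast
    have "x + y = ?ev (f + k)"
      unfolding lin(2)[OF a123(1) f(1) k(1)] lin(2)[OF a123(2) f(1) k(1)] lin(2)[OF a123(3) f(1) k(1)] f(2) k(2)
      by (simp add: vec_eq_iff forall_3)
    then show "x + y \<in> ?S" using smooth_fns_add[OF f(1) k(1)] by blast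
  next
    fix r x assume "x \<in> ?S"
    then obtain f where f: "f \<in> smooth_fns A" "x = ?ev f" by blast
    have "r *\<^sub>R x = ?ev ((\<lambda>_. r) * f)"
      unfolding lin(3)[OF a123(1) f(1)] lin(3)[OF a123(2) f(1)] lin(3)[OF a123(3) f(1)] f(2)
      by (simp add: vec_eq_iff forall_3)
    then show "r *\<^sub>R x \<in> ?S" using smooth_fns_mult[OF smooth_fns_const f(1)] by blast
  qed
  have "?S = UNIV"
  proof (rule ccontr)
    assume "?S \<noteq> UNIV"
    then have "span ?S \<noteq> UNIV" unfolding span_eq_iff[THEN iffD2, OF \<open>subspace ?S\<close>] .
    from span_not_univ_subset_hyperplane[OF this]
    obtain n where n: "n \<noteq> 0" "span ?S \<subseteq> {x. n \<bullet> x = 0}" by blast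
    let ?c = "\<lambda>a::nat. if a = 1 then n $ 1 else if a = 2 then n $ 2 else n $ 3"
    have "(\<Sum>a\<in>{1..3}. ?c a * v a f p) = 0" if "f \<in> smooth_fns A" for f
    proof -
      have "n \<bullet> ?ev f = 0" using n(2) span_base[of "?ev f" ?S] that by auto
      then show ?thesis unfolding sum_1_3 by (simp add: inner_vec_def sum_3)
    qed
    from v_independent[OF this] have "?c a = 0" if "a \<in> {1..3}" for a using that by blast
    from this[of 1] this[of 2] this[of 3] have "n = 0" by (simp add: vec_eq_iff forall_3)
    with n(1) show False by blast
  qed
  then have "vector [y 1, y 2, y 3] \<in> ?S" by simp
  then obtain f where f: "f \<in> smooth_fns A" "vector [y 1, y 2, y 3] = ?ev f" by blast
  then have "v 1 f p = y 1" "v 2 f p = y 2" "v 3 f p = y 3"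
    by (simp_all add: vec_eq_iff forall_3)
  with f(1) show ?thesis by (intro bexI[of _ f]) (auto simp only: in_1_3)
qed

text \<open>In a chart the \<open>v a\<close> at \<open>p\<close> have three independent component vectors in a three-dimensional space.\<close>

lemma tangent_space_spanned:
  assumes "t \<in> tangent_space A p"
  shows "\<exists>c. \<forall>f. t f = (\<Sum>a\<in>{1..3}. c a * v a f p)"
proof -
  obtain U \<phi> where U: "(U, \<phi>) \<in> A" "p \<in> U" using chart_exists[OF A] .
  have "\<exists>w. \<forall>f. v a f p = chart_vector A U \<phi> p w f" if "a \<in> {1..3}" for a
    by (rule vector_fields_chart[OF A v_field[OF that] U]) blast
  then have "\<forall>a\<in>{1..3}. \<exists>w. \<forall>f. v a f p = chart_vector A U \<phi> p w f" by blast
  from bchoice[OF this] obtain w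
    where w: "\<And>a f. a \<in> {1..3} \<Longrightarrow> v a f p = chart_vector A U \<phi> p (w a) f" by blast
  let ?L = "\<lambda>c::real^3. c $ 1 *\<^sub>R w 1 + c $ 2 *\<^sub>R w 2 + c $ 3 *\<^sub>R w 3"
  have eval: "chart_vector A U \<phi> p (?L c) f = c $ 1 * v 1 f p + c $ 2 * v 2 f p + c $ 3 * v 3 f p" for c f
    by (simp add: w chart_vector_linear[OF A U])
  have lin: "linear ?L"
    by (rule linearI) (simp_all add: algebra_simps)
  have "c = 0" if "?L c = 0" for c
  proof -
    let ?c = "\<lambda>a::nat. if a = 1 then c $ 1 else if a = 2 then c $ 2 else c $ 3"
    have "(\<Sum>a\<in>{1..3}. ?c a * v a f p) = 0" for f
      using eval[of c f] chart_vector_linear(2)[OF A U, of 0 0 f] that unfolding sum_1_3 by simp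
    from v_independent[OF this] have "?c a = 0" if "a \<in> {1..3}" for a using that by blast
    from this[of 1] this[of 2] this[of 3] show "c = 0" by (simp add: vec_eq_iff forall_3)
  qed
  then have "inj ?L" using linear_injective_0[OF lin] by blast
  then have "surj ?L" by (rule linear_injective_imp_surjective[OF lin]) (rule refl)
  obtain x where x: "t = chart_vector A U \<phi> p x"
    using assms tangent_space_chart[OF A U] by auto
  obtain c where "x = ?L c" using surjD[OF \<open>surj ?L\<close>, of x] by blast
  then have "t f = c $ 1 * v 1 f p + c $ 2 * v 2 f p + c $ 3 * v 3 f p" for f
    using eval x by simp
  then show ?thesis
    by (intro exI[of _ "\<lambda>a::nat. if a = 1 then c $ 1 else if a = 2 then c $ 2 else c $ 3"])
      (simp only: sum_1_3, simp)
qed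

text \<open>Cramer's rule. The functions \<open>f b\<close> are dual to the frame at \<open>p\<close> only, but they are defined on the
  whole group; so the determinants are smooth functions and the relation holds at every point.\<close>

lemma frame_cramer:
  assumes Z: "Z \<in> vector_fields A"
  obtains \<Delta> c where "\<Delta> \<in> smooth_fns A" "\<Delta> p = 1" "\<And>a. c a \<in> smooth_fns A"
    "\<And>k. \<Delta> * Z k = c (1::nat) * v 1 k + c 2 * v 2 k + c 3 * v 3 k"
proof -
  have "\<forall>b. \<exists>f. f \<in> smooth_fns A \<and> (\<forall>a\<in>{1..3}. v a f p = (if a = b then 1 else 0))"
  proof
    fix b
    show "\<exists>f. f \<in> smooth_fns A \<and> (\<forall>a\<in>{1..3}. v a f p = (if a = b then 1 else 0))"
      by (rule bexE[OF v_dual[of p "\<lambda>a. if a = b then 1 else 0"]]) blast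
  qed
  from choice[OF this] obtain f where f: "\<And>b. f b \<in> smooth_fns A"
    and dual: "\<And>a b. a \<in> {1..3} \<Longrightarrow> v a (f b) p = (if a = b then 1 else 0)"
    by blast
  define M where "M X b = X (f b)" for X :: "'g vfield" and b :: nat
  define c where "c a = (if a = 1 then det3 (M Z) (M (v 2)) (M (v 3))
    else if a = 2 then det3 (M (v 1)) (M Z) (M (v 3)) else det3 (M (v 1)) (M (v 2)) (M Z))" for a :: nat
  have smooth: "det3 (M X) (M Y) (M W) \<in> smooth_fns A"
    if "X \<in> vector_fields A" "Y \<in> vector_fields A" "W \<in> vector_fields A" for X Y W
  proof -
    have "M X b \<in> smooth_fns A" "M Y b \<in> smooth_fns A" "M W b \<in> smooth_fns A" for b
      unfolding M_def by (rule vector_fields_smooth; fact)+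
    then show ?thesis unfolding det3_def by (intro smooth_fns_add smooth_fns_diff smooth_fns_mult)
  qed
  have v123: "v 1 \<in> vector_fields A" "v 2 \<in> vector_fields A" "v 3 \<in> vector_fields A"
    by (auto intro: v_field)
  have at_point: "det3 (M X) (M Y) (M W) r = det3 (\<lambda>b. X (f b) r) (\<lambda>b. Y (f b) r) (\<lambda>b. W (f b) r)" for X Y W r
    by (simp add: det3_def M_def)
  have eq: "det3 (M (v 1)) (M (v 2)) (M (v 3)) * Z k = c 1 * v 1 k + c 2 * v 2 k + c 3 * v 3 k" for k
  proof (rule ext)
    fix r
    have "(\<lambda>f. Z f r) \<in> tangent_space A r" using Z unfolding vector_fields_def by blast
    from tangent_space_spanned[OF this] obtain x
      where x: "\<And>f. Z f r = x (1::nat) * v 1 f r + x 2 * v 2 f r + x 3 * v 3 f r" unfolding sum_1_3 by blast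
    let ?m = "\<lambda>a b. v a (f b) r"
    have Zr: "(\<lambda>b. Z (f b) r) = (\<lambda>b. x 1 * ?m 1 b + x 2 * ?m 2 b + x 3 * ?m 3 b)"
      by (intro ext x)
    have c: "c 1 r = x 1 * det3 (?m 1) (?m 2) (?m 3)" "c 2 r = x 2 * det3 (?m 1) (?m 2) (?m 3)"
      "c 3 r = x 3 * det3 (?m 1) (?m 2) (?m 3)"
      by (simp_all add: c_def at_point Zr det3_combination del: One_nat_def)
    show "(det3 (M (v 1)) (M (v 2)) (M (v 3)) * Z k) r = (c 1 * v 1 k + c 2 * v 2 k + c 3 * v 3 k) r"
      by (simp only: plus_fun_apply times_fun_apply at_point c x[of k]) (simp only: algebra_simps)
  qed
  show ?thesis
  proof (rule that[OF _ _ _ eq])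
    show "det3 (M (v 1)) (M (v 2)) (M (v 3)) \<in> smooth_fns A" by (intro smooth v123)
    show "det3 (M (v 1)) (M (v 2)) (M (v 3)) p = 1" 
      unfolding at_point det3_def by (simp add: M_def dual del: One_nat_def)
    show "c a \<in> smooth_fns A" for a
      unfolding c_def by (simp only: split: if_split) (intro conjI impI smooth v123 Z)
  qed
qed

text \<open>Non-degeneracy refers to arbitrary vector fields \<open>Z\<close>. A multiple \<open>\<Delta> Z\<close> with \<open>\<Delta> p = 1\<close> is a
  combination of frame fields with smooth coefficients, so \<open>g Y Z\<close> vanishes at \<open>p\<close>.\<close>

lemma field_zero_if_orthogonal_to_frame:
  assumes g: "pseudo_riemannian_metric A g" and Y: "Y \<in> vector_fields A"
    and gY: "\<And>a. a \<in> {1..3} \<Longrightarrow> g Y (v a) = 0"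
  shows "Y = 0"
proof -
  have gY1: "g Y \<in> one_forms A" using g Y unfolding pseudo_riemannian_metric_def by blast
  have add: "g Y (Z + W) = g Y Z + g Y W" if "Z \<in> vector_fields A" "W \<in> vector_fields A" for Z W
    using gY1 that unfolding one_forms_def by blast
  have smul: "g Y (\<lambda>k. c * Z k) = c * g Y Z" if "c \<in> smooth_fns A" "Z \<in> vector_fields A" for c Z
    using gY1 that unfolding one_forms_def by blast
  have a123: "1 \<in> {1..3::nat}" "2 \<in> {1..3::nat}" "3 \<in> {1..3::nat}" by auto
  have "g Y Z p = 0" if Z: "Z \<in> vector_fields A" for Z p
  proof -
    obtain \<Delta> c where \<Delta>: "\<Delta> \<in> smooth_fns A" "\<Delta> p = 1" and c: "\<And>a. c a \<in> smooth_fns A"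
      and eq: "\<And>k. \<Delta> * Z k = c (1::nat) * v 1 k + c 2 * v 2 k + c 3 * v 3 k"
      by (rule frame_cramer[OF Z, where p = p]) blast
    have V: "(\<lambda>k. c a * v a k) \<in> vector_fields A" if "a \<in> {1..3}" for a
      by (rule vector_fields_smul[OF A v_field[OF that] c])
    have "\<Delta> * g Y Z = g Y (\<lambda>k. \<Delta> * Z k)" by (rule smul[OF \<Delta>(1) Z, symmetric])
    also have "(\<lambda>k. \<Delta> * Z k) = (\<lambda>k. c 1 * v 1 k) + (\<lambda>k. c 2 * v 2 k) + (\<lambda>k. c 3 * v 3 k)"
      by (rule ext) (simp only: eq plus_fun_apply)
    also have "g Y ((\<lambda>k. c 1 * v 1 k) + (\<lambda>k. c 2 * v 2 k) + (\<lambda>k. c 3 * v 3 k)) =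
        g Y (\<lambda>k. c 1 * v 1 k) + g Y (\<lambda>k. c 2 * v 2 k) + g Y (\<lambda>k. c 3 * v 3 k)"
      unfolding add[OF vector_fields_add[OF A V[OF a123(1)] V[OF a123(2)]] V[OF a123(3)]]
        add[OF V[OF a123(1)] V[OF a123(2)]] by (rule refl)
    also have "\<dots> = c 1 * g Y (v 1) + c 2 * g Y (v 2) + c 3 * g Y (v 3)"
      unfolding smul[OF c v_field[OF a123(1)]] smul[OF c v_field[OF a123(2)]] smul[OF c v_field[OF a123(3)]]
      by (rule refl)
    also have "\<dots> = 0" unfolding gY[OF a123(1)] gY[OF a123(2)] gY[OF a123(3)] by simp
    finally have "(\<Delta> * g Y Z) p = 0 p" by (rule fun_cong)
    then show ?thesis using \<Delta>(2) by simp
  qed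
  then have gY0: "\<forall>Z\<in>vector_fields A. g Y Z p = 0" for p by (rule ballI)
  have "\<forall>p. \<forall>X\<in>vector_fields A. (\<forall>Y\<in>vector_fields A. g X Y p = 0) \<longrightarrow> (\<forall>f. X f p = 0)"
    using g unfolding pseudo_riemannian_metric_def by (elim conjE)
  from mp[OF bspec[OF spec[OF this] Y] gY0] have Y0: "\<forall>f. Y f p = 0" for p .
  show ?thesis
  proof (intro ext)
    fix f p show "Y f p = 0 f p" using Y0[of p] by simp
  qed
qed

end

section \<open>Differential forms and the Lie bracket of vector fields\<close>

lemma one_formsD:
  assumes "\<xi> \<in> one_forms A"
  shows "X \<in> vector_fields A \<Longrightarrow> \<xi> X \<in> smooth_fns A"
    and "X \<in> vector_fields A \<Longrightarrow> Y \<in> vector_fields A \<Longrightarrow> \<xi> (X + Y) = \<xi> X + \<xi> Y"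
    and "f \<in> smooth_fns A \<Longrightarrow> X \<in> vector_fields A \<Longrightarrow> \<xi> (\<lambda>k. f * X k) = f * \<xi> X"
    and "X \<notin> vector_fields A \<Longrightarrow> \<xi> X = 0"
  using assms unfolding one_forms_def mem_Collect_eq by (elim conjE; blast)+

lemma one_formsI:
  assumes "\<And>X. X \<in> vector_fields A \<Longrightarrow> \<xi> X \<in> smooth_fns A"
    and "\<And>X Y. X \<in> vector_fields A \<Longrightarrow> Y \<in> vector_fields A \<Longrightarrow> \<xi> (X + Y) = \<xi> X + \<xi> Y"
    and "\<And>f X. f \<in> smooth_fns A \<Longrightarrow> X \<in> vector_fields A \<Longrightarrow> \<xi> (\<lambda>k. f * X k) = f * \<xi> X"
    and "\<And>X. X \<notin> vector_fields A \<Longrightarrow> \<xi> X = 0"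
  shows "\<xi> \<in> one_forms A"
  unfolding one_forms_def mem_Collect_eq using assms by (intro conjI ballI allI impI)

lemma one_forms_0: "0 \<in> one_forms A"
  by (rule one_formsI) (auto intro: smooth_fns_0)

lemma one_forms_add:
  assumes x: "\<xi> \<in> one_forms A" and e: "\<eta> \<in> one_forms A" shows "\<xi> + \<eta> \<in> one_forms A"
  by (rule one_formsI)
    (simp_all add: one_formsD[OF x] one_formsD[OF e] smooth_fns_add distrib_left)

lemma one_forms_smul:
  assumes x: "\<xi> \<in> one_forms A" and f: "f \<in> smooth_fns A" shows "(\<lambda>Z. f * \<xi> Z) \<in> one_forms A"
  by (rule one_formsI)
    (simp_all add: one_formsD[OF x] f smooth_fns_mult distrib_left mult.left_commute)

lemma one_forms_uminus:
  assumes x: "\<xi> \<in> one_forms A" shows "- \<xi> \<in> one_forms A"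
  by (rule one_formsI)
    (simp_all add: one_formsD[OF x] smooth_fns_uminus)

lemma two_formsD:
  assumes "F \<in> two_forms A"
  shows "X \<in> vector_fields A \<Longrightarrow> F X \<in> one_forms A"
    and "X \<notin> vector_fields A \<Longrightarrow> F X = 0"
    and "X \<in> vector_fields A \<Longrightarrow> Y \<in> vector_fields A \<Longrightarrow> F X Y = - F Y X"
  using assms unfolding two_forms_def mem_Collect_eq by (elim conjE; blast)+

lemma three_formsD:
  assumes "H \<in> three_forms A"
  shows "X \<in> vector_fields A \<Longrightarrow> H X \<in> two_forms A"
    and "X \<notin> vector_fields A \<Longrightarrow> H X = 0"
    and "X \<in> vector_fields A \<Longrightarrow> Y \<in> vector_fields A \<Longrightarrow> H X Y = - H Y X"
  using assms unfolding three_forms_def mem_Collect_eq by (elim conjE; blast)+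

text \<open>Linearity over functions in the last argument is part of the definition of a form;
  skew-symmetry transfers it to the other arguments.\<close>

lemma two_forms_left:
  assumes A: "smooth_atlas A" and F: "F \<in> two_forms A"
  shows "X \<in> vector_fields A \<Longrightarrow> Y \<in> vector_fields A \<Longrightarrow> F (X + Y) = F X + F Y"
    and "f \<in> smooth_fns A \<Longrightarrow> X \<in> vector_fields A \<Longrightarrow> F (\<lambda>k. f * X k) = (\<lambda>Z. f * F X Z)"
proof -
  show "F (X + Y) = F X + F Y" if X: "X \<in> vector_fields A" and Y: "Y \<in> vector_fields A"
  proof (rule ext)
    fix Z
    have XY: "X + Y \<in> vector_fields A" by (rule vector_fields_add[OF A X Y])
    show "F (X + Y) Z = (F X + F Y) Z"
    proof (cases "Z \<in> vector_fields A")
      case True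
      have "F (X + Y) Z = - F Z (X + Y)" by (rule two_formsD(3)[OF F XY True])
      also have "\<dots> = - F Z X - F Z Y"
        by (simp add: one_formsD(2)[OF two_formsD(1)[OF F True] X Y])
      also have "\<dots> = F X Z + F Y Z"
        by (simp add: two_formsD(3)[OF F X True] two_formsD(3)[OF F Y True])
      finally show ?thesis by simp
    qed (simp add: one_formsD(4)[OF two_formsD(1)[OF F XY]] one_formsD(4)[OF two_formsD(1)[OF F X]]
        one_formsD(4)[OF two_formsD(1)[OF F Y]])
  qed
  show "F (\<lambda>k. f * X k) = (\<lambda>Z. f * F X Z)" if f: "f \<in> smooth_fns A" and X: "X \<in> vector_fields A"
  proof (rule ext)
    fix Z
    have fX: "(\<lambda>k. f * X k) \<in> vector_fields A" by (rule vector_fields_smul[OF A X f])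
    show "F (\<lambda>k. f * X k) Z = f * F X Z"
    proof (cases "Z \<in> vector_fields A")
      case True
      have "F (\<lambda>k. f * X k) Z = - F Z (\<lambda>k. f * X k)" by (rule two_formsD(3)[OF F fX True])
      also have "\<dots> = - (f * F Z X)"
        by (simp add: one_formsD(3)[OF two_formsD(1)[OF F True] f X])
      also have "\<dots> = f * F X Z"
        by (simp add: two_formsD(3)[OF F X True])
      finally show ?thesis .
    qed (simp add: one_formsD(4)[OF two_formsD(1)[OF F fX]] one_formsD(4)[OF two_formsD(1)[OF F X]])
  qed
qed

lemma three_forms_left:
  assumes A: "smooth_atlas A" and H: "H \<in> three_forms A" and W: "W \<in> vector_fields A"
  shows "X \<in> vector_fields A \<Longrightarrow> Y \<in> vector_fields A \<Longrightarrow> H (X + Y) W = H X W + H Y W"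
    and "f \<in> smooth_fns A \<Longrightarrow> X \<in> vector_fields A \<Longrightarrow> H (\<lambda>k. f * X k) W = (\<lambda>Z. f * H X W Z)"
proof -
  show "H (X + Y) W = H X W + H Y W" if X: "X \<in> vector_fields A" and Y: "Y \<in> vector_fields A"
    using two_forms_left(1)[OF A three_formsD(1)[OF H W] X Y]
    unfolding three_formsD(3)[OF H vector_fields_add[OF A X Y] W] three_formsD(3)[OF H X W]
      three_formsD(3)[OF H Y W] by simp
  show "H (\<lambda>k. f * X k) W = (\<lambda>Z. f * H X W Z)" if f: "f \<in> smooth_fns A" and X: "X \<in> vector_fields A"
    unfolding three_formsD(3)[OF H vector_fields_smul[OF A X f] W] three_formsD(3)[OF H X W]
      two_forms_left(2)[OF A three_formsD(1)[OF H W] f X] by (simp add: fun_eq_iff)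
qed

lemma vbracket_add_right:
  assumes A: "smooth_atlas A" and X: "X \<in> vector_fields A" and Y: "Y \<in> vector_fields A" and Z: "Z \<in> vector_fields A"
  shows "vbracket X (Y + Z) = vbracket X Y + vbracket X Z"
proof (rule ext)
  fix f
  show "vbracket X (Y + Z) f = (vbracket X Y + vbracket X Z) f"
  proof (cases "f \<in> smooth_fns A")
    case True
    show ?thesis unfolding vbracket_def
      by (simp add: vector_fields_derivation(1)[OF A X vector_fields_smooth[OF Y True] vector_fields_smooth[OF Z True]])
  next
    case False
    have "X 0 = 0" using vector_fields_const[OF A X, of 0] by (simp add: zero_fun_def)
    then show ?thesis unfolding vbracket_def
      by (simp add: vector_fields_non_smooth[OF A X False] vector_fields_non_smooth[OF A Y False]
          vector_fields_non_smooth[OF A Z False])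
  qed
qed

lemma vbracket_smul_right:
  assumes A: "smooth_atlas A" and X: "X \<in> vector_fields A" and Y: "Y \<in> vector_fields A" and h: "h \<in> smooth_fns A"
  shows "vbracket X (\<lambda>k. h * Y k) = (\<lambda>k. h * vbracket X Y k) + (\<lambda>k. X h * Y k)"
proof (rule ext)
  fix f
  show "vbracket X (\<lambda>k. h * Y k) f = ((\<lambda>k. h * vbracket X Y k) + (\<lambda>k. X h * Y k)) f"
  proof (cases "f \<in> smooth_fns A")
    case True
    show ?thesis unfolding vbracket_def
      by (simp add: vector_fields_derivation(2)[OF A X h vector_fields_smooth[OF Y True]] algebra_simps)
  next
    case False
    have "X 0 = 0" using vector_fields_const[OF A X, of 0] by (simp add: zero_fun_def)
    then show ?thesis unfolding vbracket_def
      by (simp add: vector_fields_non_smooth[OF A X False] vector_fields_non_smooth[OF A Y False])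
  qed
qed

lemma vbracket_swap: "vbracket X Y = - vbracket Y X"
  by (simp add: vbracket_def fun_eq_iff)

lemma vbracket_add_left:
  assumes A: "smooth_atlas A" and X: "X \<in> vector_fields A" and Y: "Y \<in> vector_fields A" and Z: "Z \<in> vector_fields A"
  shows "vbracket (Y + Z) X = vbracket Y X + vbracket Z X"
  using vbracket_add_right[OF assms] unfolding vbracket_swap[of _ X] by simp

lemma vbracket_smul_left:
  assumes A: "smooth_atlas A" and X: "X \<in> vector_fields A" and Y: "Y \<in> vector_fields A" and h: "h \<in> smooth_fns A"
  shows "vbracket (\<lambda>k. h * Y k) X = (\<lambda>k. h * vbracket Y X k) + (\<lambda>k. - X h * Y k)"
  unfolding vbracket_swap[of _ X] vbracket_smul_right[OF assms] by (simp add: fun_eq_iff)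

section \<open>The Dorfman bracket\<close>

interpretation Esec: module "smul :: 'g sfun \<Rightarrow> 'g Esec \<Rightarrow> 'g Esec"
proof
  fix a b :: "'g sfun" and x y :: "'g Esec"
  obtain X \<xi> l where x: "x = (X, \<xi>, l)" by (rule prod_cases3)
  obtain Y \<eta> m where y: "y = (Y, \<eta>, m)" by (rule prod_cases3)
  show "smul a (x + y) = smul a x + smul a y" unfolding x y by (simp add: plus_prod_def distrib_left fun_eq_iff)
  show "smul (a + b) x = smul a x + smul b x" unfolding x by (simp add: plus_prod_def distrib_right fun_eq_iff)
  show "smul a (smul b x) = smul (a * b) x" unfolding x by (simp add: mult.assoc)
  show "smul 1 x = x" unfolding x by simp
qed

lemma pairing_sym: "pairing u w = pairing w u"
  by (cases u; cases w) (simp add: add.commute mult.commute)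

text \<open>Closure of the vector fields under the bracket enters as an assumption here; over a Lie group it
  is a consequence of the existence of a left-invariant frame.\<close>

locale courant_algebroid =
  fixes A :: "('g::topological_space, 'm::euclidean_space) atlas" and H :: "'g threeform" and F :: "'g twoform"
  assumes A: "smooth_atlas A"
    and vbracket_closed: "X \<in> vector_fields A \<Longrightarrow> Y \<in> vector_fields A \<Longrightarrow> vbracket X Y \<in> vector_fields A"
    and H: "H \<in> three_forms A" and F: "F \<in> two_forms A"
begin

abbreviation "C \<equiv> smooth_fns A"
abbreviation "V \<equiv> vector_fields A"

lemma sections_iff: "(X, \<xi>, l) \<in> sections A \<longleftrightarrow> X \<in> V \<and> \<xi> \<in> one_forms A \<and> l \<in> C"
  unfolding sections_def by simp

lemma sections_add: "u \<in> sections A \<Longrightarrow> w \<in> sections A \<Longrightarrow> u + w \<in> sections A"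
  by (cases u; cases w) (simp add: sections_iff plus_prod_def vector_fields_add[OF A] one_forms_add smooth_fns_add)

lemma sections_smul: "u \<in> sections A \<Longrightarrow> f \<in> C \<Longrightarrow> smul f u \<in> sections A"
  by (cases u) (simp add: sections_iff vector_fields_smul[OF A] one_forms_smul smooth_fns_mult)

lemma sections_0: "0 \<in> sections A"
  by (simp add: sections_iff zero_prod_def vector_fields_0[OF A] one_forms_0 smooth_fns_0)

lemma sections_sum: "(\<And>i. i \<in> I \<Longrightarrow> u i \<in> sections A) \<Longrightarrow> sum u I \<in> sections A"
  by (induction I rule: infinite_finite_induct) (auto intro: sections_0 sections_add)

lemma sections_uminus: "u \<in> sections A \<Longrightarrow> - u \<in> sections A"
  using sections_smul[OF _ smooth_fns_uminus[OF smooth_fns_1], of u] Esec.scale_minus_left[of 1 u]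
  by simp

lemma sections_diff: "u \<in> sections A \<Longrightarrow> w \<in> sections A \<Longrightarrow> u - w \<in> sections A"
  using sections_add[OF _ sections_uminus, of u w] by simp

lemma anchor_field: "u \<in> sections A \<Longrightarrow> anchor u \<in> V"
  by (cases u) (simp add: sections_iff anchor_def)

lemma anchor_smooth: "u \<in> sections A \<Longrightarrow> f \<in> C \<Longrightarrow> anchor u f \<in> C"
  by (rule vector_fields_smooth[OF anchor_field])

lemma anchor_add: "anchor (u + w) = anchor u + anchor w"
  by (simp add: anchor_def)

lemma anchor_smul: "anchor (smul f u) k = f * anchor u k"
  by (cases u) (simp add: anchor_def)

lemma anchor_0: "anchor 0 k = 0"
  by (simp add: anchor_def)

lemma anchor_sum: "anchor (sum u I) k = (\<Sum>i\<in>I. anchor (u i) k)"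
  by (induction I rule: infinite_finite_induct) (simp_all add: anchor_0 anchor_add)

lemma pairing_smooth:
  assumes "u \<in> sections A" "w \<in> sections A" shows "pairing u w \<in> C"
proof -
  obtain X \<xi> l where u: "u = (X, \<xi>, l)" by (rule prod_cases3)
  obtain Y \<eta> m where w: "w = (Y, \<eta>, m)" by (rule prod_cases3)
  have X: "X \<in> V" and x: "\<xi> \<in> one_forms A" and l: "l \<in> C"
    and Y: "Y \<in> V" and e: "\<eta> \<in> one_forms A" and m: "m \<in> C"
    using assms unfolding u w sections_iff by auto
  have "(\<lambda>_. 1 / 2) * (\<xi> Y + \<eta> X) + l * m \<in> C"
    by (intro smooth_fns_add smooth_fns_mult smooth_fns_const one_formsD(1)[OF x Y] one_formsD(1)[OF e X] l m)
  then show ?thesis unfolding u w by (simp add: plus_fun_def times_fun_def)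
qed

lemma pairing_add_left:
  assumes "u \<in> sections A" "u' \<in> sections A" "w \<in> sections A"
  shows "pairing (u + u') w = pairing u w + pairing u' w"
proof -
  obtain X \<xi> l where u: "u = (X, \<xi>, l)" by (rule prod_cases3)
  obtain X' \<xi>' l' where u': "u' = (X', \<xi>', l')" by (rule prod_cases3)
  obtain Y \<eta> m where w: "w = (Y, \<eta>, m)" by (rule prod_cases3)
  have X: "X \<in> V" "X' \<in> V" and e: "\<eta> \<in> one_forms A" using assms unfolding u u' w sections_iff by auto
  show ?thesis unfolding u u' w plus_prod_def fst_conv snd_conv pairing.simps one_formsD(2)[OF e X]
    by (rule ext) (simp add: field_simps)
qed

lemma pairing_smul_left:
  assumes "u \<in> sections A" "w \<in> sections A" "f \<in> C"
  shows "pairing (smul f u) w = f * pairing u w"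
proof -
  obtain X \<xi> l where u: "u = (X, \<xi>, l)" by (rule prod_cases3)
  obtain Y \<eta> m where w: "w = (Y, \<eta>, m)" by (rule prod_cases3)
  have X: "X \<in> V" and e: "\<eta> \<in> one_forms A" using assms unfolding u w sections_iff by auto
  show ?thesis unfolding u w
    by (rule ext) (simp add: one_formsD(3)[OF e assms(3) X] field_simps)
qed

lemma pairing_add_right:
  assumes "u \<in> sections A" "u' \<in> sections A" "w \<in> sections A"
  shows "pairing w (u + u') = pairing w u + pairing w u'"
  using pairing_add_left[OF assms] by (simp add: pairing_sym[of w])

lemma pairing_smul_right:
  assumes "u \<in> sections A" "w \<in> sections A" "f \<in> C"
  shows "pairing w (smul f u) = f * pairing w u"
  using pairing_smul_left[OF assms] by (simp add: pairing_sym[of w])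

lemma pairing_0_left: "w \<in> sections A \<Longrightarrow> pairing 0 w = 0"
  using pairing_add_left[OF sections_0 sections_0, of w] by simp

lemma pairing_uminus_left:
  assumes "u \<in> sections A" "w \<in> sections A" shows "pairing (- u) w = - pairing u w"
  using pairing_add_left[OF assms(1) sections_uminus[OF assms(1)] assms(2)] pairing_0_left[OF assms(2)]
  by (simp add: eq_neg_iff_add_eq_0 add.commute)

lemma pairing_diff_left:
  assumes "u \<in> sections A" "u' \<in> sections A" "w \<in> sections A"
  shows "pairing (u - u') w = pairing u w - pairing u' w"
  using pairing_add_left[OF assms(1) sections_uminus[OF assms(2)] assms(3)]
    pairing_uminus_left[OF assms(2,3)] by simp

lemma pairing_sum_left:
  assumes "\<And>i. i \<in> I \<Longrightarrow> u i \<in> sections A" "w \<in> sections A"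
  shows "pairing (sum u I) w = (\<Sum>i\<in>I. pairing (u i) w)"
  using assms(1)
proof (induction I rule: infinite_finite_induct)
  case (insert x I)
  then show ?case
    by (simp add: pairing_add_left[OF _ sections_sum assms(2)])
qed (simp_all add: pairing_0_left[OF assms(2)])

lemma vbracket_simps:
  assumes X: "X \<in> V"
  shows "Y \<in> V \<Longrightarrow> Z \<in> V \<Longrightarrow> vbracket X (Y + Z) = vbracket X Y + vbracket X Z"
    "Y \<in> V \<Longrightarrow> h \<in> C \<Longrightarrow> vbracket X (\<lambda>k. h * Y k) = (\<lambda>k. h * vbracket X Y k) + (\<lambda>k. X h * Y k)"
    "Y \<in> V \<Longrightarrow> Z \<in> V \<Longrightarrow> vbracket (Y + Z) X = vbracket Y X + vbracket Z X"
    "Y \<in> V \<Longrightarrow> h \<in> C \<Longrightarrow> vbracket (\<lambda>k. h * Y k) X = (\<lambda>k. h * vbracket Y X k) + (\<lambda>k. - X h * Y k)"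
  by (intro vbracket_add_right[OF A X] vbracket_smul_right[OF A X]
      vbracket_add_left[OF A X] vbracket_smul_left[OF A X]; assumption)+

lemma form_of_bracket:
  assumes X: "X \<in> V" and \<eta>: "\<eta> \<in> one_forms A"
  shows "Y \<in> V \<Longrightarrow> Z \<in> V \<Longrightarrow> \<eta> (vbracket X (Y + Z)) = \<eta> (vbracket X Y) + \<eta> (vbracket X Z)"
    "Y \<in> V \<Longrightarrow> h \<in> C \<Longrightarrow> \<eta> (vbracket X (\<lambda>k. h * Y k)) = h * \<eta> (vbracket X Y) + X h * \<eta> Y"
    "Y \<in> V \<Longrightarrow> Z \<in> V \<Longrightarrow> \<eta> (vbracket (Y + Z) X) = \<eta> (vbracket Y X) + \<eta> (vbracket Z X)"
    "Y \<in> V \<Longrightarrow> h \<in> C \<Longrightarrow> \<eta> (vbracket (\<lambda>k. h * Y k) X) = h * \<eta> (vbracket Y X) - X h * \<eta> Y"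
proof -
  fix Y Z assume Y: "Y \<in> V"
  {
    assume Z: "Z \<in> V"
    show "\<eta> (vbracket X (Y + Z)) = \<eta> (vbracket X Y) + \<eta> (vbracket X Z)"
      unfolding vbracket_simps(1)[OF X Y Z]
      by (rule one_formsD(2)[OF \<eta> vbracket_closed[OF X Y] vbracket_closed[OF X Z]])
    show "\<eta> (vbracket (Y + Z) X) = \<eta> (vbracket Y X) + \<eta> (vbracket Z X)"
      unfolding vbracket_simps(3)[OF X Y Z]
      by (rule one_formsD(2)[OF \<eta> vbracket_closed[OF Y X] vbracket_closed[OF Z X]])
  }
  fix h assume h: "h \<in> C"
  have Xh: "X h \<in> C" by (rule vector_fields_smooth[OF X h])
  show "\<eta> (vbracket X (\<lambda>k. h * Y k)) = h * \<eta> (vbracket X Y) + X h * \<eta> Y"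
    unfolding vbracket_simps(2)[OF X Y h]
      one_formsD(2)[OF \<eta> vector_fields_smul[OF A vbracket_closed[OF X Y] h] vector_fields_smul[OF A Y Xh]]
      one_formsD(3)[OF \<eta> h vbracket_closed[OF X Y]] one_formsD(3)[OF \<eta> Xh Y] by (rule refl)
  show "\<eta> (vbracket (\<lambda>k. h * Y k) X) = h * \<eta> (vbracket Y X) - X h * \<eta> Y"
    unfolding vbracket_simps(4)[OF X Y h]
      one_formsD(2)[OF \<eta> vector_fields_smul[OF A vbracket_closed[OF Y X] h] vector_fields_smul[OF A Y smooth_fns_uminus[OF Xh]]]
      one_formsD(3)[OF \<eta> h vbracket_closed[OF Y X]] one_formsD(3)[OF \<eta> smooth_fns_uminus[OF Xh] Y] by simp
qed

text \<open>The one-form component of the Dorfman bracket on a vector field, free of the case distinctions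
  that make it vanish on other operators, so that its rules are identities between functions.\<close>

definition dorfman_form :: "'g vfield \<Rightarrow> 'g oneform \<Rightarrow> 'g sfun \<Rightarrow> 'g vfield \<Rightarrow> 'g oneform \<Rightarrow> 'g sfun \<Rightarrow> 'g vfield \<Rightarrow> 'g sfun" where
  "dorfman_form X \<xi> l Y \<eta> m Z = X (\<eta> Z) - \<eta> (vbracket X Z) - (Y (\<xi> Z) - Z (\<xi> Y) - \<xi> (vbracket Y Z))
     + 2 * m * Z l + H Y X Z - 2 * (m * F X Z - l * F Y Z)"

lemma two_apply: "(2 :: 'x \<Rightarrow> real) p = 2"
  unfolding one_add_one[symmetric] plus_fun_apply one_fun_apply by (rule refl)

lemma dorfman_eq:
  assumes "(X, \<xi>, l) \<in> sections A" "(Y, \<eta>, m) \<in> sections A"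
  shows "dorfman A H F (X, \<xi>, l) (Y, \<eta>, m) =
    (vbracket X Y, (\<lambda>Z. if Z \<in> V then dorfman_form X \<xi> l Y \<eta> m Z else 0), X m - Y l + F X Y)"
proof -
  have XY: "X \<in> V" "Y \<in> V" using assms unfolding sections_iff by auto
  have "lie_deriv_oneform A X \<eta> Z p - d_oneform A \<xi> Y Z p + 2 * m p * d_fun A l Z p
             + H Y X Z p - 2 * (m p * F X Z p - l p * F Y Z p) =
        (if Z \<in> V then dorfman_form X \<xi> l Y \<eta> m Z else 0) p" for Z p
  proof (cases "Z \<in> V")
    case True
    then show ?thesis using XY
      unfolding dorfman_form_def lie_deriv_oneform_def d_oneform_def d_fun_def by (simp add: two_apply)
  next
    case False
    then show ?thesis using one_formsD(4)[OF two_formsD(1)[OF three_formsD(1)[OF H XY(2)] XY(1)] False]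
        one_formsD(4)[OF two_formsD(1)[OF F XY(1)] False] one_formsD(4)[OF two_formsD(1)[OF F XY(2)] False]
      unfolding lie_deriv_oneform_def d_oneform_def d_fun_def by simp
  qed
  then show ?thesis by (simp add: fun_eq_iff)
qed

lemma dorfman_sections:
  assumes "u \<in> sections A" "w \<in> sections A" shows "dorfman A H F u w \<in> sections A"
proof -
  obtain X \<xi> l where u: "u = (X, \<xi>, l)" by (rule prod_cases3)
  obtain Y \<eta> m where w: "w = (Y, \<eta>, m)" by (rule prod_cases3)
  have X: "X \<in> V" and x: "\<xi> \<in> one_forms A" and l: "l \<in> C"
    and Y: "Y \<in> V" and e: "\<eta> \<in> one_forms A" and m: "m \<in> C"
    using assms unfolding u w sections_iff by auto
  note FX = two_formsD(1)[OF F X] and FY = two_formsD(1)[OF F Y]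
    and HYX = two_formsD(1)[OF three_formsD(1)[OF H Y] X]
  have two: "2 \<in> C" using smooth_fns_add[OF smooth_fns_1 smooth_fns_1, of A] by (simp only: one_add_one)
  have x_Y: "\<xi> Y \<in> C" by (rule one_formsD(1)[OF x Y])
  have "(\<lambda>Z. if Z \<in> V then dorfman_form X \<xi> l Y \<eta> m Z else 0) \<in> one_forms A"
  proof (rule one_formsI)
    fix Z assume Z: "Z \<in> V"
    note sm = one_formsD(1)[OF e Z] one_formsD(1)[OF x Z] one_formsD(1)[OF FX Z] one_formsD(1)[OF FY Z]
      one_formsD(1)[OF HYX Z] one_formsD(1)[OF e vbracket_closed[OF X Z]] one_formsD(1)[OF x vbracket_closed[OF Y Z]]
    have "dorfman_form X \<xi> l Y \<eta> m Z \<in> C"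
      unfolding dorfman_form_def
      by (intro smooth_fns_add smooth_fns_diff smooth_fns_mult two l m sm
          vector_fields_smooth[OF X sm(1)] vector_fields_smooth[OF Y sm(2)] vector_fields_smooth[OF Z x_Y]
          vector_fields_smooth[OF Z l])
    then show "(if Z \<in> V then dorfman_form X \<xi> l Y \<eta> m Z else 0) \<in> C" using Z by simp
    {
      fix W assume W: "W \<in> V"
      have "dorfman_form X \<xi> l Y \<eta> m (Z + W) = dorfman_form X \<xi> l Y \<eta> m Z + dorfman_form X \<xi> l Y \<eta> m W"
        unfolding dorfman_form_def form_of_bracket(1)[OF X e Z W] form_of_bracket(1)[OF Y x Z W]
          one_formsD(2)[OF e Z W] one_formsD(2)[OF x Z W] one_formsD(2)[OF FX Z W] one_formsD(2)[OF FY Z W]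
          one_formsD(2)[OF HYX Z W]
          vector_fields_derivation(1)[OF A X one_formsD(1)[OF e Z] one_formsD(1)[OF e W]]
          vector_fields_derivation(1)[OF A Y one_formsD(1)[OF x Z] one_formsD(1)[OF x W]]
          plus_fun_apply[of Z W]
        by (simp only: algebra_simps)
      then show "(if Z + W \<in> V then dorfman_form X \<xi> l Y \<eta> m (Z + W) else 0) =
        (if Z \<in> V then dorfman_form X \<xi> l Y \<eta> m Z else 0) + (if W \<in> V then dorfman_form X \<xi> l Y \<eta> m W else 0)"
        using Z W vector_fields_add[OF A Z W] by simp
    }
    fix f assume f: "f \<in> C"
    have "dorfman_form X \<xi> l Y \<eta> m (\<lambda>k. f * Z k) = f * dorfman_form X \<xi> l Y \<eta> m Z"
        unfolding dorfman_form_def form_of_bracket(2)[OF X e Z f] form_of_bracket(2)[OF Y x Z f]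
          one_formsD(3)[OF e f Z] one_formsD(3)[OF x f Z] one_formsD(3)[OF FX f Z] one_formsD(3)[OF FY f Z]
          one_formsD(3)[OF HYX f Z]
          vector_fields_derivation(2)[OF A X f one_formsD(1)[OF e Z]]
          vector_fields_derivation(2)[OF A Y f one_formsD(1)[OF x Z]]
        by (simp only: algebra_simps)
    then show "(if (\<lambda>k. f * Z k) \<in> V then dorfman_form X \<xi> l Y \<eta> m (\<lambda>k. f * Z k) else 0) =
        f * (if Z \<in> V then dorfman_form X \<xi> l Y \<eta> m Z else 0)"
      using Z vector_fields_smul[OF A Z f] by simp
  qed simp
  moreover have "X m - Y l + F X Y \<in> C"
    by (intro smooth_fns_add smooth_fns_diff vector_fields_smooth[OF X m] vector_fields_smooth[OF Y l] one_formsD(1)[OF FX Y])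
  ultimately show ?thesis
    unfolding u w dorfman_eq[OF assms[unfolded u w]] sections_iff by (intro conjI vbracket_closed[OF X Y])
qed

lemma dorfman_add_right:
  assumes "u \<in> sections A" "w \<in> sections A" "w' \<in> sections A"
  shows "dorfman A H F u (w + w') = dorfman A H F u w + dorfman A H F u w'"
proof -
  obtain X \<xi> l where u: "u = (X, \<xi>, l)" by (rule prod_cases3)
  obtain Y \<eta> m where w: "w = (Y, \<eta>, m)" by (rule prod_cases3)
  obtain Y' \<eta>' m' where w': "w' = (Y', \<eta>', m')" by (rule prod_cases3)
  have X: "X \<in> V" and x: "\<xi> \<in> one_forms A" and l: "l \<in> C"
    and Y: "Y \<in> V" and e: "\<eta> \<in> one_forms A" and m: "m \<in> C"
    and Y': "Y' \<in> V" and e': "\<eta>' \<in> one_forms A" and m': "m' \<in> C"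
    using assms unfolding u w w' sections_iff by auto
  have form: "dorfman_form X \<xi> l (Y + Y') (\<eta> + \<eta>') (m + m') Z = dorfman_form X \<xi> l Y \<eta> m Z + dorfman_form X \<xi> l Y' \<eta>' m' Z"
    if Z: "Z \<in> V" for Z
    unfolding dorfman_form_def plus_fun_apply[of \<eta> \<eta>'] plus_fun_apply[of Y Y'] form_of_bracket(3)[OF Z x Y Y']
      one_formsD(2)[OF x Y Y'] two_forms_left(1)[OF A F Y Y'] three_forms_left(1)[OF A H X Y Y'] plus_fun_apply[of "F Y"]
      plus_fun_apply[of "H Y X"]
      vector_fields_derivation(1)[OF A X one_formsD(1)[OF e Z] one_formsD(1)[OF e' Z]]
      vector_fields_derivation(1)[OF A Z one_formsD(1)[OF x Y] one_formsD(1)[OF x Y']]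
    by (simp only: algebra_simps)
  have 1: "(\<lambda>Z. if Z \<in> V then dorfman_form X \<xi> l (Y + Y') (\<eta> + \<eta>') (m + m') Z else 0)
    = (\<lambda>Z. if Z \<in> V then dorfman_form X \<xi> l Y \<eta> m Z else 0) + (\<lambda>Z. if Z \<in> V then dorfman_form X \<xi> l Y' \<eta>' m' Z else 0)"
    by (rule ext) (simp add: form)
  have 2: "X (m + m') - (Y + Y') l + F X (Y + Y') = (X m - Y l + F X Y) + (X m' - Y' l + F X Y')"
    unfolding plus_fun_apply[of Y Y'] one_formsD(2)[OF two_formsD(1)[OF F X] Y Y'] vector_fields_derivation(1)[OF A X m m']
    by (simp only: algebra_simps)
  have s: "(Y + Y', \<eta> + \<eta>', m + m') \<in> sections A"
    using sections_add[OF assms(2,3)] unfolding w w' by (simp add: plus_prod_def)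
  have "w + w' = (Y + Y', \<eta> + \<eta>', m + m')" unfolding w w' by (simp add: plus_prod_def)
  then show ?thesis
    using dorfman_eq[OF assms(1)[unfolded u] s] dorfman_eq[OF assms(1)[unfolded u] assms(2)[unfolded w]]
      dorfman_eq[OF assms(1)[unfolded u] assms(3)[unfolded w']]
    unfolding u w w' 1 2 vbracket_simps(1)[OF X Y Y'] by (simp only: plus_prod_def fst_conv snd_conv)
qed

lemma dorfman_add_left:
  assumes "u \<in> sections A" "w \<in> sections A" "w' \<in> sections A"
  shows "dorfman A H F (w + w') u = dorfman A H F w u + dorfman A H F w' u"
proof -
  obtain X \<xi> l where u: "u = (X, \<xi>, l)" by (rule prod_cases3)
  obtain Y \<eta> m where w: "w = (Y, \<eta>, m)" by (rule prod_cases3)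
  obtain Y' \<eta>' m' where w': "w' = (Y', \<eta>', m')" by (rule prod_cases3)
  have X: "X \<in> V" and x: "\<xi> \<in> one_forms A" and l: "l \<in> C"
    and Y: "Y \<in> V" and e: "\<eta> \<in> one_forms A" and m: "m \<in> C"
    and Y': "Y' \<in> V" and e': "\<eta>' \<in> one_forms A" and m': "m' \<in> C"
    using assms unfolding u w w' sections_iff by auto
  have form: "dorfman_form (Y + Y') (\<eta> + \<eta>') (m + m') X \<xi> l Z = dorfman_form Y \<eta> m X \<xi> l Z + dorfman_form Y' \<eta>' m' X \<xi> l Z"
    if Z: "Z \<in> V" for Z
    unfolding dorfman_form_def plus_fun_apply[of \<eta> \<eta>'] plus_fun_apply[of Y Y'] form_of_bracket(3)[OF Z x Y Y']
      two_forms_left(1)[OF A F Y Y'] one_formsD(2)[OF two_formsD(1)[OF three_formsD(1)[OF H X] ] Y Y'] plus_fun_apply[of "F Y"]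
      two_forms_left(1)[OF A three_formsD(1)[OF H X] Y Y'] plus_fun_apply[of "H X Y"]
      vector_fields_derivation(1)[OF A X one_formsD(1)[OF e Z] one_formsD(1)[OF e' Z]]
      vector_fields_derivation(1)[OF A Z one_formsD(1)[OF e X] one_formsD(1)[OF e' X]]
      vector_fields_derivation(1)[OF A Z m m']
    by (simp only: algebra_simps)
  have 1: "(\<lambda>Z. if Z \<in> V then dorfman_form (Y + Y') (\<eta> + \<eta>') (m + m') X \<xi> l Z else 0)
    = (\<lambda>Z. if Z \<in> V then dorfman_form Y \<eta> m X \<xi> l Z else 0) + (\<lambda>Z. if Z \<in> V then dorfman_form Y' \<eta>' m' X \<xi> l Z else 0)"
    by (rule ext) (simp add: form)
  have 2: "(Y + Y') l - X (m + m') + F (Y + Y') X = (Y l - X m + F Y X) + (Y' l - X m' + F Y' X)"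
    unfolding plus_fun_apply[of Y Y'] two_forms_left(1)[OF A F Y Y'] plus_fun_apply[of "F Y"] vector_fields_derivation(1)[OF A X m m']
    by (simp only: algebra_simps)
  have s: "(Y + Y', \<eta> + \<eta>', m + m') \<in> sections A"
    using sections_add[OF assms(2,3)] unfolding w w' by (simp add: plus_prod_def)
  have "w + w' = (Y + Y', \<eta> + \<eta>', m + m')" unfolding w w' by (simp add: plus_prod_def)
  then show ?thesis
    using dorfman_eq[OF s assms(1)[unfolded u]] dorfman_eq[OF assms(2)[unfolded w] assms(1)[unfolded u]]
      dorfman_eq[OF assms(3)[unfolded w'] assms(1)[unfolded u]]
    unfolding u w w' 1 2 vbracket_simps(3)[OF X Y Y'] by (simp only: plus_prod_def fst_conv snd_conv)
qed

lemma dorfman_smul_right: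
  assumes "u \<in> sections A" "w \<in> sections A" and f: "f \<in> C"
  shows "dorfman A H F u (smul f w) = smul (anchor u f) w + smul f (dorfman A H F u w)"
proof -
  obtain X \<xi> l where u: "u = (X, \<xi>, l)" by (rule prod_cases3)
  obtain Y \<eta> m where w: "w = (Y, \<eta>, m)" by (rule prod_cases3)
  have X: "X \<in> V" and x: "\<xi> \<in> one_forms A" and l: "l \<in> C"
    and Y: "Y \<in> V" and e: "\<eta> \<in> one_forms A" and m: "m \<in> C"
    using assms unfolding u w sections_iff by auto
  let ?fY = "\<lambda>k. f * Y k" and ?fe = "\<lambda>Z. f * \<eta> Z"
  have form: "dorfman_form X \<xi> l ?fY ?fe (f * m) Z = X f * \<eta> Z + f * dorfman_form X \<xi> l Y \<eta> m Z"
    if Z: "Z \<in> V" for Z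
    unfolding dorfman_form_def form_of_bracket(4)[OF Z x Y f]
      one_formsD(3)[OF x f Y] two_forms_left(2)[OF A F f Y] three_forms_left(2)[OF A H X f Y]
      vector_fields_derivation(2)[OF A X f one_formsD(1)[OF e Z]]
      vector_fields_derivation(2)[OF A Z f one_formsD(1)[OF x Y]]
    by (simp only: algebra_simps)
  have 1: "(\<lambda>Z. if Z \<in> V then dorfman_form X \<xi> l ?fY ?fe (f * m) Z else 0)
    = (\<lambda>Z. X f * \<eta> Z) + (\<lambda>Z. f * (if Z \<in> V then dorfman_form X \<xi> l Y \<eta> m Z else 0))"
    by (rule ext) (simp add: form one_formsD(4)[OF e])
  have 2: "X (f * m) - f * Y l + F X ?fY = X f * m + f * (X m - Y l + F X Y)"
    unfolding one_formsD(3)[OF two_formsD(1)[OF F X] f Y] vector_fields_derivation(2)[OF A X f m]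
    by (simp only: algebra_simps)
  have 3: "vbracket X ?fY = (\<lambda>k. X f * Y k) + (\<lambda>k. f * vbracket X Y k)"
    unfolding vbracket_simps(2)[OF X Y f] by (rule add.commute)
  have s: "(?fY, ?fe, f * m) \<in> sections A"
    using sections_smul[OF assms(2) f] unfolding w by simp
  show ?thesis
    using dorfman_eq[OF assms(1)[unfolded u] s] dorfman_eq[OF assms(1)[unfolded u] assms(2)[unfolded w]]
    unfolding u w 1 2 3 by (simp only: plus_prod_def fst_conv snd_conv anchor_def smul.simps)
qed

text \<open>The symmetric part of the Dorfman bracket is the differential of the scalar product. This is the
  origin of the last term.\<close>

lemma dorfman_smul_left:
  assumes "u \<in> sections A" "w \<in> sections A" and f: "f \<in> C"
  shows "dorfman A H F (smul f w) u =
    smul f (dorfman A H F w u) + smul (- anchor u f) w + smul (2 * pairing w u) (0, d_fun A f, 0)"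
proof -
  obtain X \<xi> l where u: "u = (X, \<xi>, l)" by (rule prod_cases3)
  obtain Y \<eta> m where w: "w = (Y, \<eta>, m)" by (rule prod_cases3)
  have X: "X \<in> V" and x: "\<xi> \<in> one_forms A" and l: "l \<in> C"
    and Y: "Y \<in> V" and e: "\<eta> \<in> one_forms A" and m: "m \<in> C"
    using assms unfolding u w sections_iff by auto
  let ?fY = "\<lambda>k. f * Y k" and ?fe = "\<lambda>Z. f * \<eta> Z"
  have pair: "2 * pairing w u = \<eta> X + \<xi> Y + 2 * (m * l)"
    unfolding u w by (rule ext) (simp add: two_apply)
  have form: "dorfman_form ?fY ?fe (f * m) X \<xi> l Z =
      f * dorfman_form Y \<eta> m X \<xi> l Z + (- X f * \<eta> Z) + (\<eta> X + \<xi> Y + 2 * (m * l)) * Z f"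
    if Z: "Z \<in> V" for Z
    unfolding dorfman_form_def form_of_bracket(4)[OF Z x Y f]
      two_forms_left(2)[OF A F f Y] two_forms_left(2)[OF A three_formsD(1)[OF H X] f Y]
      vector_fields_derivation(2)[OF A X f one_formsD(1)[OF e Z]]
      vector_fields_derivation(2)[OF A Z f one_formsD(1)[OF e X]]
      vector_fields_derivation(2)[OF A Z f m]
    by (simp only: algebra_simps) simp
  have 1: "(\<lambda>Z. if Z \<in> V then dorfman_form ?fY ?fe (f * m) X \<xi> l Z else 0)
    = (\<lambda>Z. f * (if Z \<in> V then dorfman_form Y \<eta> m X \<xi> l Z else 0)) + (\<lambda>Z. - X f * \<eta> Z) +
      (\<lambda>Z. (\<eta> X + \<xi> Y + 2 * (m * l)) * d_fun A f Z)"
    by (rule ext) (simp add: form one_formsD(4)[OF e] d_fun_def)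
  have 2: "f * Y l - X (f * m) + F ?fY X = f * (Y l - X m + F Y X) + (- X f * m) + (\<eta> X + \<xi> Y + 2 * (m * l)) * 0"
    unfolding two_forms_left(2)[OF A F f Y] vector_fields_derivation(2)[OF A X f m]
    by (simp only: algebra_simps) simp
  have 3: "vbracket ?fY X = (\<lambda>k. f * vbracket Y X k) + (\<lambda>k. - X f * Y k) + (\<lambda>k. (\<eta> X + \<xi> Y + 2 * (m * l)) * 0 k)"
    unfolding vbracket_simps(4)[OF X Y f] by (simp add: zero_fun_def[symmetric])
  have s: "(?fY, ?fe, f * m) \<in> sections A"
    using sections_smul[OF assms(2) f] unfolding w by simp
  show ?thesis unfolding pair
    using dorfman_eq[OF s assms(1)[unfolded u]] dorfman_eq[OF assms(2)[unfolded w] assms(1)[unfolded u]]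
    unfolding u w 1 2 3 by (simp only: plus_prod_def fst_conv snd_conv anchor_def smul.simps)
qed

lemma d_fun_section:
  assumes f: "f \<in> C" shows "(0, d_fun A f, 0) \<in> sections A"
proof -
  have "d_fun A f \<in> one_forms A"
  proof (rule one_formsI)
    fix X assume X: "X \<in> V"
    show "d_fun A f X \<in> C" using vector_fields_smooth[OF X f] X by (simp add: d_fun_def)
    show "d_fun A f (X + Y) = d_fun A f X + d_fun A f Y" if "Y \<in> V" for Y
      using vector_fields_add[OF A X that] X that by (simp add: d_fun_def)
    show "d_fun A f (\<lambda>k. h * X k) = h * d_fun A f X" if "h \<in> C" for h
      using vector_fields_smul[OF A X that] X by (simp add: d_fun_def)
  qed (simp add: d_fun_def)
  then show ?thesis
    unfolding sections_iff by (intro conjI vector_fields_0[OF A] smooth_fns_0)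
qed

lemma pairing_d_fun:
  assumes "f \<in> C" "w \<in> sections A" shows "2 * pairing (0, d_fun A f, 0) w = anchor w f"
proof -
  obtain Y \<eta> m where w: "w = (Y, \<eta>, m)" by (rule prod_cases3)
  have Y: "Y \<in> V" and e: "\<eta> \<in> one_forms A" using assms unfolding w sections_iff by auto
  have "\<eta> 0 = 0" using one_formsD(2)[OF e vector_fields_0[OF A] vector_fields_0[OF A]] by simp
  then show ?thesis unfolding w by (intro ext) (simp add: d_fun_def Y anchor_def two_apply)
qed

lemma pairing_dorfman_smul_left:
  assumes u: "u \<in> sections A" and w: "w \<in> sections A" and f: "f \<in> C" and z: "z \<in> sections A"
  shows "pairing (dorfman A H F (smul f w) u) z =
    f * pairing (dorfman A H F w u) z - anchor u f * pairing w z + pairing w u * anchor z f"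
proof -
  note d = d_fun_section[OF f] and D = dorfman_sections[OF w u] and a = smooth_fns_uminus[OF anchor_smooth[OF u f]]
  have p: "2 * pairing w u \<in> C"
    using smooth_fns_add[OF pairing_smooth[OF w u] pairing_smooth[OF w u]] by (simp only: mult_2)
  have "pairing (dorfman A H F (smul f w) u) z =
    f * pairing (dorfman A H F w u) z + (- anchor u f) * pairing w z + (2 * pairing w u) * pairing (0, d_fun A f, 0) z"
    unfolding dorfman_smul_left[OF u w f]
      pairing_add_left[OF sections_add[OF sections_smul[OF D f] sections_smul[OF w a]] sections_smul[OF d p] z]
      pairing_add_left[OF sections_smul[OF D f] sections_smul[OF w a] z]
      pairing_smul_left[OF D z f] pairing_smul_left[OF w z a] pairing_smul_left[OF d z p] by (rule refl)
  also have "(2 * pairing w u) * pairing (0, d_fun A f, 0) z = pairing w u * (2 * pairing (0, d_fun A f, 0) z)"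
    by (simp only: ac_simps)
  finally show ?thesis unfolding pairing_d_fun[OF f z] by (simp only: mult_minus_left add_uminus_conv_diff)
qed

end

section \<open>Orthonormal frames with constant structure functions\<close>

lemma const_fun_simps:
  "(\<lambda>_. 0) = (0 :: 'g sfun)" "(\<lambda>_. 1) = (1 :: 'g sfun)"
  "(\<lambda>_. a) * (\<lambda>_. b) = (\<lambda>_. a * b :: real)" "(\<lambda>_. a) + (\<lambda>_. b) = (\<lambda>_. a + b :: real)"
  by (auto simp: fun_eq_iff)

lemma sum_fun_apply: "(\<Sum>i\<in>I. f i) p = (\<Sum>i\<in>I. f i p)"
  by (induction I rule: infinite_finite_induct) auto

text \<open>An orthonormal frame, with squares \<open>\<eta> B = \<plusminus> 1\<close>, whose structure functions \<open>c\<close> are constant. Sets of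
  indices stand for the orthogonal summands of \<open>E\<close> spanned by the corresponding frame elements.\<close>

locale courant_frame = courant_algebroid A H F
  for A :: "('g::topological_space, 'm::euclidean_space) atlas" and H F +
  fixes N :: nat and e :: "nat \<Rightarrow> 'g Esec" and \<eta> :: "nat \<Rightarrow> real" and c :: "nat \<Rightarrow> nat \<Rightarrow> nat \<Rightarrow> real"
  assumes e_section: "B < N \<Longrightarrow> e B \<in> sections A"
    and e_pairing: "B < N \<Longrightarrow> B' < N \<Longrightarrow> pairing (e B) (e B') = (\<lambda>_. if B = B' then \<eta> B else 0)"
    and \<eta>_square: "B < N \<Longrightarrow> \<eta> B * \<eta> B = 1"
    and e_expand: "u \<in> sections A \<Longrightarrow> u = (\<Sum>B<N. smul ((\<lambda>_. \<eta> B) * pairing u (e B)) (e B))"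
    and e_bracket: "B < N \<Longrightarrow> B' < N \<Longrightarrow> B'' < N \<Longrightarrow>
      pairing (dorfman A H F (e B) (e B')) (e B'') = (\<lambda>_. c B B' B'')"
    and c_swap12: "B < N \<Longrightarrow> B' < N \<Longrightarrow> B'' < N \<Longrightarrow> c B' B B'' = - c B B' B''"
    and c_swap23: "B < N \<Longrightarrow> B' < N \<Longrightarrow> B'' < N \<Longrightarrow> c B B'' B' = - c B B' B''"
begin

text \<open>The span of the frame elements with index in \<open>J\<close> is described by orthogonality to the others, in
  accordance with the description of \<open>E\<^sub>+\<close> as an orthogonal complement.\<close>

definition frame_span :: "nat set \<Rightarrow> 'g Esec set" where
  "frame_span J = {u \<in> sections A. \<forall>B<N. B \<notin> J \<longrightarrow> pairing u (e B) = 0}"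

text \<open>The coefficient of \<open>e B\<close> in \<open>u\<close>; note that \<open>\<eta> B\<close> is its own inverse.\<close>

definition coord :: "'g Esec \<Rightarrow> nat \<Rightarrow> 'g sfun" where
  "coord u B = (\<lambda>_. \<eta> B) * pairing u (e B)"

lemma frame_span_section: "u \<in> frame_span J \<Longrightarrow> u \<in> sections A"
  by (simp add: frame_span_def)

lemma frame_span_all: "frame_span {..<N} = sections A"
  by (auto simp: frame_span_def)

lemma frame_span_pairing: "u \<in> frame_span J \<Longrightarrow> B < N \<Longrightarrow> B \<notin> J \<Longrightarrow> pairing u (e B) = 0"
  by (simp add: frame_span_def)

lemma frame_spanI: "u \<in> sections A \<Longrightarrow> (\<And>B. B < N \<Longrightarrow> B \<notin> J \<Longrightarrow> pairing u (e B) = 0) \<Longrightarrow> u \<in> frame_span J"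
  by (simp add: frame_span_def)

lemma e_frame_span: "B < N \<Longrightarrow> B \<in> J \<Longrightarrow> e B \<in> frame_span J"
  by (rule frame_spanI) (auto simp: e_section e_pairing const_fun_simps)

lemma frame_span_add: "u \<in> frame_span J \<Longrightarrow> w \<in> frame_span J \<Longrightarrow> u + w \<in> frame_span J"
  by (rule frame_spanI) (simp_all add: frame_span_section sections_add pairing_add_left e_section frame_span_pairing)

lemma frame_span_smul: "u \<in> frame_span J \<Longrightarrow> f \<in> C \<Longrightarrow> smul f u \<in> frame_span J"
  by (rule frame_spanI) (simp_all add: frame_span_section sections_smul pairing_smul_left e_section frame_span_pairing)

lemma frame_span_0: "0 \<in> frame_span J"
  by (rule frame_spanI) (simp_all add: sections_0 pairing_0_left e_section)

lemma frame_span_sum: "(\<And>i. i \<in> I \<Longrightarrow> u i \<in> frame_span J) \<Longrightarrow> sum u I \<in> frame_span J"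
  by (induction I rule: infinite_finite_induct) (auto intro: frame_span_0 frame_span_add)

lemma frame_span_diff: "u \<in> frame_span J \<Longrightarrow> w \<in> frame_span J \<Longrightarrow> u - w \<in> frame_span J"
  by (rule frame_spanI) (simp_all add: frame_span_section sections_diff pairing_diff_left e_section frame_span_pairing)

lemma coord_smooth: "u \<in> sections A \<Longrightarrow> B < N \<Longrightarrow> coord u B \<in> C"
  unfolding coord_def by (intro smooth_fns_mult smooth_fns_const pairing_smooth e_section)

lemma coord_expand: "u \<in> sections A \<Longrightarrow> u = (\<Sum>B<N. smul (coord u B) (e B))"
  unfolding coord_def by (rule e_expand)

lemma coord_zero: "pairing u (e B) = 0 \<Longrightarrow> coord u B = 0"
  by (simp add: coord_def fun_eq_iff)

lemma smul_zero: "smul 0 u = 0"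
  by (rule Esec.scale_zero_left)

lemma frame_span_expand:
  assumes "u \<in> frame_span J" "J \<subseteq> {..<N}"
  shows "u = (\<Sum>B\<in>J. smul (coord u B) (e B))"
proof -
  have "(\<Sum>B<N. smul (coord u B) (e B)) = (\<Sum>B\<in>J. smul (coord u B) (e B))"
    using assms(2) by (intro sum.mono_neutral_right) (auto simp: coord_zero frame_span_pairing[OF assms(1)] smul_zero)
  then show ?thesis using coord_expand[OF frame_span_section[OF assms(1)]] by (rule trans[rotated])
qed

lemma pairing_combination:
  assumes J: "J \<subseteq> {..<N}" and B: "B < N" and f: "\<And>i. i \<in> J \<Longrightarrow> f i \<in> C"
  shows "pairing (\<Sum>i\<in>J. smul (f i) (e i)) (e B) = (if B \<in> J then (\<lambda>_. \<eta> B) * f B else 0)"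
proof -
  have fin: "finite J" using J by (rule finite_subset) simp
  have "pairing (\<Sum>i\<in>J. smul (f i) (e i)) (e B) = (\<Sum>i\<in>J. pairing (smul (f i) (e i)) (e B))"
    by (rule pairing_sum_left) (use J f B in \<open>auto intro!: sections_smul e_section\<close>)
  also have "\<dots> = (\<Sum>i\<in>J. if i = B then (\<lambda>_. \<eta> B) * f B else 0)"
  proof (rule sum.cong[OF refl])
    fix i assume i: "i \<in> J"
    then have iN: "i < N" using J by auto
    show "pairing (smul (f i) (e i)) (e B) = (if i = B then (\<lambda>_. \<eta> B) * f B else 0)"
      unfolding pairing_smul_left[OF e_section[OF iN] e_section[OF B] f[OF i]] e_pairing[OF iN B]
      by (auto simp: const_fun_simps mult.commute)
  qed
  also have "\<dots> = (if B \<in> J then (\<lambda>_. \<eta> B) * f B else 0)" using fin by simp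
  finally show ?thesis .
qed

lemma coord_combination:
  assumes J: "J \<subseteq> {..<N}" and B: "B < N" and f: "\<And>i. i \<in> J \<Longrightarrow> f i \<in> C"
  shows "coord (\<Sum>i\<in>J. smul (f i) (e i)) B = (if B \<in> J then f B else 0)"
proof -
  have "pairing (\<Sum>i\<in>J. smul (f i) (e i)) (e B) = (if B \<in> J then (\<lambda>_. \<eta> B) * f B else 0)"
    by (rule pairing_combination[OF J B]) (rule f)
  then have "coord (\<Sum>i\<in>J. smul (f i) (e i)) B = (\<lambda>_. \<eta> B) * (if B \<in> J then (\<lambda>_. \<eta> B) * f B else 0)"
    unfolding coord_def by (rule arg_cong)
  also have "\<dots> = (if B \<in> J then f B else 0)"
    by (auto simp: fun_eq_iff mult.assoc[symmetric] \<eta>_square[OF B])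
  finally show ?thesis .
qed

lemma section_eqI:
  assumes "u \<in> sections A" "w \<in> sections A" "\<And>B. B < N \<Longrightarrow> pairing u (e B) = pairing w (e B)"
  shows "u = w"
proof -
  have "(\<Sum>B<N. smul (coord u B) (e B)) = (\<Sum>B<N. smul (coord w B) (e B))"
    by (rule sum.cong) (use assms(3) in \<open>simp_all add: coord_def\<close>)
  then show ?thesis using coord_expand[OF assms(1)] coord_expand[OF assms(2)] by (simp only:)
qed

lemma pairing_expand:
  assumes u: "u \<in> sections A" and w: "w \<in> sections A"
  shows "pairing u w = (\<Sum>B<N. (\<lambda>_. \<eta> B) * pairing u (e B) * pairing w (e B))"
proof -
  have "pairing u w = pairing (\<Sum>B<N. smul (coord u B) (e B)) w"
    using coord_expand[OF u] by (rule arg_cong)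
  also have "\<dots> = (\<Sum>B<N. pairing (smul (coord u B) (e B)) w)"
    by (rule pairing_sum_left) (auto intro!: sections_smul e_section coord_smooth u w)
  also have "\<dots> = (\<Sum>B<N. coord u B * pairing w (e B))"
    by (rule sum.cong) (auto simp: pairing_smul_left[OF e_section w coord_smooth[OF u]] pairing_sym[of w])
  finally show ?thesis unfolding coord_def .
qed

text \<open>Identities between tensors are reduced to the frame by means of this expansion.\<close>

lemma tensor_expand:
  fixes \<Psi> :: "'g Esec \<Rightarrow> 'g sfun"
  assumes J: "J \<subseteq> {..<N}"
    and add: "\<And>u w. u \<in> frame_span J \<Longrightarrow> w \<in> frame_span J \<Longrightarrow> \<Psi> (u + w) = \<Psi> u + \<Psi> w"
    and smul: "\<And>f u. f \<in> C \<Longrightarrow> u \<in> frame_span J \<Longrightarrow> \<Psi> (smul f u) = f * \<Psi> u"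
    and u: "u \<in> frame_span J"
  shows "\<Psi> u = (\<Sum>B\<in>J. coord u B * \<Psi> (e B))"
proof -
  have "\<Psi> 0 = 0" using add[OF frame_span_0 frame_span_0] by simp
  have fin: "finite J" using J by (rule finite_subset) simp
  have "\<Psi> (\<Sum>B\<in>I. smul (coord u B) (e B)) = (\<Sum>B\<in>I. coord u B * \<Psi> (e B))" if "finite I" "I \<subseteq> J" for I
    using that
  proof (induction I rule: finite_induct)
    case (insert B I)
    have B: "B < N" "B \<in> J" using insert.prems J by auto
    have s: "smul (coord u i) (e i) \<in> frame_span J" if "i \<in> J" for i
      using that J by (auto intro!: frame_span_smul e_frame_span coord_smooth frame_span_section[OF u])
    have "\<Psi> (\<Sum>B\<in>insert B I. smul (coord u B) (e B)) = \<Psi> (smul (coord u B) (e B)) + \<Psi> (\<Sum>B\<in>I. smul (coord u B) (e B))"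
      unfolding sum.insert[OF insert.hyps] by (rule add[OF s[OF B(2)] frame_span_sum[OF s]]) (use insert.prems in auto)
    also have "\<dots> = coord u B * \<Psi> (e B) + (\<Sum>B\<in>I. coord u B * \<Psi> (e B))"
    proof -
      have "\<Psi> (\<Sum>B\<in>I. smul (coord u B) (e B)) = (\<Sum>B\<in>I. coord u B * \<Psi> (e B))"
        by (rule insert.IH) (use insert.prems in auto)
      then show ?thesis unfolding smul[OF coord_smooth[OF frame_span_section[OF u] B(1)] e_frame_span[OF B]]
        by (rule arg_cong)
    qed
    finally show ?case unfolding sum.insert[OF insert.hyps] .
  qed (simp add: \<open>\<Psi> 0 = 0\<close>)
  from this[OF fin subset_refl] have "\<Psi> (\<Sum>B\<in>J. smul (coord u B) (e B)) = (\<Sum>B\<in>J. coord u B * \<Psi> (e B))" .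
  then show ?thesis unfolding frame_span_expand[OF u J, symmetric] .
qed

lemma tensor_zero:
  fixes \<Psi> :: "'g Esec \<Rightarrow> 'g sfun"
  assumes J: "J \<subseteq> {..<N}"
    and add: "\<And>u w. u \<in> frame_span J \<Longrightarrow> w \<in> frame_span J \<Longrightarrow> \<Psi> (u + w) = \<Psi> u + \<Psi> w"
    and smul: "\<And>f u. f \<in> C \<Longrightarrow> u \<in> frame_span J \<Longrightarrow> \<Psi> (smul f u) = f * \<Psi> u"
    and zero: "\<And>B. B \<in> J \<Longrightarrow> \<Psi> (e B) = 0"
    and u: "u \<in> frame_span J"
  shows "\<Psi> u = 0"
proof -
  have "\<Psi> u = (\<Sum>B\<in>J. coord u B * \<Psi> (e B))"
    by (rule tensor_expand[where \<Psi> = \<Psi>, OF J add smul u])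
  also have "\<dots> = 0" by (rule sum.neutral) (simp add: zero)
  finally show ?thesis .
qed

section \<open>Traces\<close>

lemma global_frame_frame_span:
  assumes "k + n \<le> N"
  shows "global_frame A (frame_span {k..<k + n}) n (\<lambda>i. e (k + i))"
  unfolding global_frame_def
proof (intro conjI allI impI ballI)
  fix i assume "i < n" then show "e (k + i) \<in> frame_span {k..<k + n}" using assms by (intro e_frame_span) auto
next
  fix u assume u: "u \<in> frame_span {k..<k + n}"
  have J: "{k..<k + n} \<subseteq> {..<N}" using assms by auto
  have shift: "(\<Sum>i<n. smul (x i) (e (k + i))) = (\<Sum>B\<in>{k..<k + n}. smul (x (B - k)) (e B))" for x
    by (rule sum.reindex_bij_witness[of _ "\<lambda>B. B - k" "\<lambda>i. k + i"]) auto
  let ?x = "\<lambda>i. if i < n then coord u (k + i) else 0"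
  have "(\<Sum>i<n. smul (?x i) (e (k + i))) = (\<Sum>B\<in>{k..<k + n}. smul (coord u B) (e B))"
    unfolding shift by (rule sum.cong) auto
  then have eq: "u = (\<Sum>i<n. smul (?x i) (e (k + i)))" using frame_span_expand[OF u J] by (simp only:)
  show "\<exists>!x. (\<forall>i<n. x i \<in> C) \<and> (\<forall>i\<ge>n. x i = 0) \<and> u = (\<Sum>i<n. smul (x i) (e (k + i)))"
  proof (rule ex1I[of _ ?x])
    show "(\<forall>i<n. ?x i \<in> C) \<and> (\<forall>i\<ge>n. ?x i = 0) \<and> u = (\<Sum>i<n. smul (?x i) (e (k + i)))"
    proof (intro conjI eq allI impI)
      fix i assume "i < n" then show "?x i \<in> C" using assms coord_smooth[OF frame_span_section[OF u], of "k + i"] by simp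
    qed simp
  next
    fix x assume x: "(\<forall>i<n. x i \<in> C) \<and> (\<forall>i\<ge>n. x i = 0) \<and> u = (\<Sum>i<n. smul (x i) (e (k + i)))"
    show "x = ?x"
    proof (rule ext)
      fix i show "x i = ?x i"
      proof (cases "i < n")
        case True
        have "coord u (k + i) = coord (\<Sum>B\<in>{k..<k + n}. smul (x (B - k)) (e B)) (k + i)"
          using x unfolding shift by simp
        also have "\<dots> = x i"
          using True assms x by (subst coord_combination[OF J]) auto
        finally show ?thesis using True by simp
      qed (use x in auto)
    qed
  qed
qed

text \<open>The trace is independent of the frame: if the matrices \<open>P\<close> and \<open>Q\<close> of the two changes of frame
  satisfy \<open>Q P = 1\<close> then \<open>tr (P M Q) = tr (M Q P) = tr M\<close>.\<close>

lemma sec_trace_frame_span: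
  fixes \<phi> :: "'g Esec \<Rightarrow> 'g Esec"
  assumes kn: "k + n \<le> N"
    and cl: "\<And>u. u \<in> frame_span {k..<k + n} \<Longrightarrow> \<phi> u \<in> frame_span {k..<k + n}"
    and add: "\<And>u w. u \<in> frame_span {k..<k + n} \<Longrightarrow> w \<in> frame_span {k..<k + n} \<Longrightarrow> \<phi> (u + w) = \<phi> u + \<phi> w"
    and smul: "\<And>f u. f \<in> C \<Longrightarrow> u \<in> frame_span {k..<k + n} \<Longrightarrow> \<phi> (smul f u) = smul f (\<phi> u)"
  shows "sec_trace A (frame_span {k..<k + n}) \<phi> = (\<Sum>B\<in>{k..<k + n}. coord (\<phi> (e B)) B)"
proof -
  let ?J = "{k..<k + n}" and ?S = "frame_span {k..<k + n}"
  have J: "?J \<subseteq> {..<N}" using kn by auto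
  have eS: "e B \<in> ?S" if "B \<in> ?J" for B using that kn by (intro e_frame_span) auto
  have \<phi>0: "\<phi> 0 = 0" using add[OF frame_span_0 frame_span_0] by simp
  have \<phi>_sum: "\<phi> (\<Sum>j\<in>I. smul (f j) (s j)) = (\<Sum>j\<in>I. smul (f j) (\<phi> (s j)))"
    if "finite I" "\<And>j. j \<in> I \<Longrightarrow> f j \<in> C" "\<And>j. j \<in> I \<Longrightarrow> s j \<in> ?S" for I :: "nat set" and f s
    using that
  proof (induction I rule: finite_induct)
    case (insert x I)
    have "\<phi> (\<Sum>j\<in>insert x I. smul (f j) (s j)) = \<phi> (smul (f x) (s x)) + \<phi> (\<Sum>j\<in>I. smul (f j) (s j))"
      unfolding sum.insert[OF insert.hyps] using insert.prems by (intro add frame_span_sum frame_span_smul) auto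
    then show ?case using insert by (simp add: smul)
  qed (simp add: \<phi>0)
  have coord_sum: "coord (\<Sum>j\<in>I. smul (f j) (s j)) B = (\<Sum>j\<in>I. f j * coord (s j) B)"
    if "\<And>j. j \<in> I \<Longrightarrow> f j \<in> C" "\<And>j. j \<in> I \<Longrightarrow> s j \<in> ?S" "B < N" for I :: "nat set" and f s B
  proof -
    have "pairing (\<Sum>j\<in>I. smul (f j) (s j)) (e B) = (\<Sum>j\<in>I. pairing (smul (f j) (s j)) (e B))"
      by (rule pairing_sum_left, rule sections_smul[OF frame_span_section[where J = ?J]])
        (use that in \<open>auto intro: e_section\<close>)
    also have "\<dots> = (\<Sum>j\<in>I. f j * pairing (s j) (e B))"
      by (rule sum.cong[OF refl], rule pairing_smul_left[OF frame_span_section[where J = ?J]]) (use that in \<open>auto intro: e_section\<close>)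
    finally show ?thesis unfolding coord_def by (simp only: sum_distrib_left mult.left_commute)
  qed
  show ?thesis
    unfolding sec_trace_def
  proof (rule the_equality)
    let ?c = "\<lambda>i j. coord (\<phi> (e (k + j))) (k + i)"
    have "\<phi> (e (k + j)) = (\<Sum>i<n. smul (?c i j) (e (k + i)))" if "j < n" for j
    proof -
      have "\<phi> (e (k + j)) = (\<Sum>B\<in>?J. smul (coord (\<phi> (e (k + j))) B) (e B))"
        using that by (intro frame_span_expand[OF _ J] cl eS) auto
      also have "\<dots> = (\<Sum>i<n. smul (?c i j) (e (k + i)))"
        by (rule sum.reindex_bij_witness[of _ "\<lambda>i. k + i" "\<lambda>B. B - k"]) auto
      finally show ?thesis .
    qed
    moreover have "?c i j \<in> C" if "i < n" "j < n" for i j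
      using that kn by (intro coord_smooth frame_span_section[OF cl[OF eS]]) auto
    moreover have "(\<Sum>B\<in>?J. coord (\<phi> (e B)) B) = (\<Sum>i<n. ?c i i)"
      by (rule sum.reindex_bij_witness[of _ "\<lambda>i. k + i" "\<lambda>B. B - k"]) auto
    ultimately show "\<exists>n' b c. global_frame A ?S n' b \<and>
        (\<forall>j<n'. (\<forall>i<n'. c i j \<in> C) \<and> \<phi> (b j) = (\<Sum>i<n'. smul (c i j) (b i))) \<and>
        (\<Sum>B\<in>?J. coord (\<phi> (e B)) B) = (\<Sum>i<n'. c i i)"
      using global_frame_frame_span[OF kn] by (intro exI[of _ n] exI[of _ "\<lambda>i. e (k + i)"] exI[of _ ?c]) blast
  next
    fix t assume "\<exists>n' b c. global_frame A ?S n' b \<and>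
        (\<forall>j<n'. (\<forall>i<n'. c i j \<in> C) \<and> \<phi> (b j) = (\<Sum>i<n'. smul (c i j) (b i))) \<and>
        t = (\<Sum>i<n'. c i i)"
    then obtain n' b M where fr: "global_frame A ?S n' b"
      and M: "\<And>i j. i < n' \<Longrightarrow> j < n' \<Longrightarrow> M i j \<in> C"
      and \<phi>b: "\<And>j. j < n' \<Longrightarrow> \<phi> (b j) = (\<Sum>i<n'. smul (M i j) (b i))"
      and t: "t = (\<Sum>i<n'. M i i)" by blast
    have bS: "b j \<in> ?S" if "j < n'" for j using fr that unfolding global_frame_def by blast
    have ex1: "\<exists>!x. (\<forall>i<n'. x i \<in> C) \<and> (\<forall>i\<ge>n'. x i = 0) \<and> u = (\<Sum>i<n'. smul (x i) (b i))" if "u \<in> ?S" for u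
      using fr that unfolding global_frame_def by blast
    let ?P = "\<lambda>B j. coord (b j) B"
    have P: "?P B j \<in> C" if "B \<in> ?J" "j < n'" for B j
      using that kn by (intro coord_smooth frame_span_section[OF bS]) auto
    have "\<forall>B\<in>?J. \<exists>q. (\<forall>j<n'. q j \<in> C) \<and> e B = (\<Sum>j<n'. smul (q j) (b j))"
      using ex1[OF eS] by blast
    from bchoice[OF this] obtain Q where Q: "\<And>B j. B \<in> ?J \<Longrightarrow> j < n' \<Longrightarrow> Q B j \<in> C"
      and eQ: "\<And>B. B \<in> ?J \<Longrightarrow> e B = (\<Sum>j<n'. smul (Q B j) (b j))" by blast
    have PQ: "(\<Sum>B\<in>?J. ?P B l * Q B j) = (if j = l then 1 else 0)" if l: "l < n'" and j: "j < n'" for l j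
    proof -
      let ?x = "\<lambda>j. if j < n' then (\<Sum>B\<in>?J. ?P B l * Q B j) else 0"
      let ?y = "\<lambda>j. if j = l then 1 else (0 :: 'g sfun)"
      have "b l = (\<Sum>B\<in>?J. smul (?P B l) (e B))" by (rule frame_span_expand[OF bS[OF l] J])
      also have "\<dots> = (\<Sum>B\<in>?J. \<Sum>j<n'. smul (?P B l * Q B j) (b j))"
      proof (rule sum.cong[OF refl])
        fix B assume "B \<in> ?J"
        have "smul (?P B l) (e B) = smul (?P B l) (\<Sum>j<n'. smul (Q B j) (b j))"
          using eQ[OF \<open>B \<in> ?J\<close>] by (rule arg_cong)
        then show "smul (?P B l) (e B) = (\<Sum>j<n'. smul (?P B l * Q B j) (b j))"
          by (simp only: Esec.scale_sum_right Esec.scale_scale)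
      qed
      also have "\<dots> = (\<Sum>j<n'. \<Sum>B\<in>?J. smul (?P B l * Q B j) (b j))" by (rule sum.swap)
      also have "\<dots> = (\<Sum>j<n'. smul (?x j) (b j))"
        by (rule sum.cong) (simp_all add: Esec.scale_sum_left)
      finally have x: "b l = (\<Sum>j<n'. smul (?x j) (b j))" .
      have "(\<Sum>j<n'. smul (?y j) (b j)) = (\<Sum>j<n'. if j = l then b j else 0)"
        by (rule sum.cong) (auto simp: Esec.scale_one smul_zero simp del: smul.simps)
      then have y: "b l = (\<Sum>j<n'. smul (?y j) (b j))" using l by simp
      have sx: "?x i \<in> C" if "i < n'" for i
        unfolding if_P[OF that] by (intro smooth_fns_sum smooth_fns_mult P Q l that)
      have sy: "?y i \<in> C" for i by (simp add: smooth_fns_0 smooth_fns_1)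
      obtain z where z: "\<And>y. (\<forall>i<n'. y i \<in> C) \<and> (\<forall>i\<ge>n'. y i = 0) \<and> b l = (\<Sum>i<n'. smul (y i) (b i)) \<Longrightarrow> y = z"
        by (rule ex1E[OF ex1[OF bS[OF l]]]) blast
      have "?x = z" by (rule z) (intro conjI allI impI sx x; simp)
      moreover have "?y = z" by (rule z) (intro conjI allI impI sy y; use l in simp)
      ultimately have "?x = ?y" by (simp only:)
      from fun_cong[OF this, of j] show ?thesis using j by simp
    qed
    have "coord (\<phi> (e B)) B = (\<Sum>j<n'. \<Sum>i<n'. M i j * (?P B i * Q B j))" if B: "B \<in> ?J" for B
    proof -
      have BN: "B < N" using B J by auto
      have "\<phi> (e B) = \<phi> (\<Sum>j<n'. smul (Q B j) (b j))" using eQ[OF B] by (rule arg_cong)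
      also have "\<dots> = (\<Sum>j<n'. smul (Q B j) (\<phi> (b j)))"
        by (rule \<phi>_sum) (auto intro: Q[OF B] bS)
      finally have "coord (\<phi> (e B)) B = coord (\<Sum>j<n'. smul (Q B j) (\<phi> (b j))) B" by (rule arg_cong)
      also have "\<dots> = (\<Sum>j<n'. Q B j * coord (\<phi> (b j)) B)"
        by (rule coord_sum) (auto intro: Q[OF B] cl bS BN)
      also have "\<dots> = (\<Sum>j<n'. \<Sum>i<n'. M i j * (?P B i * Q B j))"
      proof (rule sum.cong[OF refl])
        fix j assume "j \<in> {..<n'}"
        then have j: "j < n'" by simp
        have "coord (\<phi> (b j)) B = coord (\<Sum>i<n'. smul (M i j) (b i)) B" using \<phi>b[OF j] by (rule arg_cong)
        also have "\<dots> = (\<Sum>i<n'. M i j * ?P B i)"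
          by (rule coord_sum) (auto intro: M[OF _ j] bS BN)
        finally show "Q B j * coord (\<phi> (b j)) B = (\<Sum>i<n'. M i j * (?P B i * Q B j))"
          by (simp only: sum_distrib_left) (simp only: ac_simps)
      qed
      finally show ?thesis .
    qed
    then have "(\<Sum>B\<in>?J. coord (\<phi> (e B)) B) = (\<Sum>B\<in>?J. \<Sum>j<n'. \<Sum>i<n'. M i j * (?P B i * Q B j))"
      by (intro sum.cong refl)
    also have "\<dots> = (\<Sum>j<n'. \<Sum>B\<in>?J. \<Sum>i<n'. M i j * (?P B i * Q B j))" by (rule sum.swap)
    also have "\<dots> = (\<Sum>j<n'. \<Sum>i<n'. \<Sum>B\<in>?J. M i j * (?P B i * Q B j))"
      by (rule sum.cong[OF refl], rule sum.swap)
    also have "\<dots> = (\<Sum>j<n'. \<Sum>i<n'. if i = j then M i j else 0)"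
      by (intro sum.cong refl) (auto simp add: sum_distrib_left[symmetric] PQ)
    also have "\<dots> = t" unfolding t by simp
    finally show "t = (\<Sum>B\<in>?J. coord (\<phi> (e B)) B)" by (rule sym)
  qed
qed

end

section \<open>Generalized connections and curvature\<close>

lemma generalized_connectionD:
  assumes "generalized_connection A D" and u: "u \<in> sections A" and v: "v \<in> sections A"
  shows "D u v \<in> sections A"
    and "u' \<in> sections A \<Longrightarrow> D (u + u') v = D u v + D u' v"
    and "f \<in> smooth_fns A \<Longrightarrow> D (smul f u) v = smul f (D u v)"
    and "v' \<in> sections A \<Longrightarrow> D u (v + v') = D u v + D u v'"
    and "f \<in> smooth_fns A \<Longrightarrow> D u (smul f v) = smul (anchor u f) v + smul f (D u v)"
    and "w \<in> sections A \<Longrightarrow> anchor u (pairing v w) = pairing (D u v) w + pairing v (D u w)"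
proof -
  note * = assms(1)[unfolded generalized_connection_def]
  note c1 = *[THEN conjunct1] and c2 = *[THEN conjunct2, THEN conjunct1]
    and c3 = *[THEN conjunct2, THEN conjunct2, THEN conjunct1]
    and c4 = *[THEN conjunct2, THEN conjunct2, THEN conjunct2, THEN conjunct1]
    and c5 = *[THEN conjunct2, THEN conjunct2, THEN conjunct2, THEN conjunct2, THEN conjunct1]
    and c6 = *[THEN conjunct2, THEN conjunct2, THEN conjunct2, THEN conjunct2, THEN conjunct2]
  show "D u v \<in> sections A" by (rule bspec[OF bspec[OF c1 u] v])
  show "D (u + u') v = D u v + D u' v" if "u' \<in> sections A"
    by (rule bspec[OF bspec[OF bspec[OF c2 u] that] v])
  show "D (smul f u) v = smul f (D u v)" if "f \<in> smooth_fns A"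
    by (rule bspec[OF bspec[OF bspec[OF c3 that] u] v])
  show "D u (v + v') = D u v + D u v'" if "v' \<in> sections A"
    by (rule bspec[OF bspec[OF bspec[OF c4 u] v] that])
  show "D u (smul f v) = smul (anchor u f) v + smul f (D u v)" if "f \<in> smooth_fns A"
    by (rule bspec[OF bspec[OF bspec[OF c5 that] u] v])
  show "anchor u (pairing v w) = pairing (D u v) w + pairing v (D u w)" if "w \<in> sections A"
    by (rule bspec[OF bspec[OF bspec[OF c6 u] v] that])
qed

context courant_algebroid
begin

lemma field_zero_fun:
  assumes X: "X \<in> V" shows "X 0 = 0"
  using vector_fields_const[OF A X, of 0] by (simp add: zero_fun_def)

lemma field_sum:
  assumes X: "X \<in> V" and f: "\<And>i. i \<in> I \<Longrightarrow> f i \<in> C"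
  shows "X (sum f I) = (\<Sum>i\<in>I. X (f i))"
  using f
proof (induction I rule: infinite_finite_induct)
  case (insert x I)
  have "X (sum f (insert x I)) = X (f x + sum f I)" using insert.hyps by simp
  also have "\<dots> = X (f x) + X (sum f I)"
    by (rule vector_fields_derivation(1)[OF A X]) (use insert.prems in \<open>auto intro: smooth_fns_sum\<close>)
  also have "X (sum f I) = (\<Sum>i\<in>I. X (f i))" by (rule insert.IH) (use insert.prems in auto)
  finally show ?case using insert.hyps by simp
qed (simp_all add: field_zero_fun[OF X])

lemma field_const_mult:
  assumes X: "X \<in> V" and f: "f \<in> C"
  shows "X ((\<lambda>_. r) * f) = (\<lambda>_. r) * X f"
  unfolding vector_fields_derivation(2)[OF A X smooth_fns_const f] vector_fields_const[OF A X] by simp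

lemma dorfman_anchor: "anchor (dorfman A H F u w) = vbracket (anchor u) (anchor w)"
  by (cases u; cases w) (simp add: anchor_def)

lemma D_sum_right:
  assumes D: "generalized_connection A D" and u: "u \<in> sections A" and s: "\<And>i. i \<in> I \<Longrightarrow> s i \<in> sections A"
  shows "D u (\<Sum>i\<in>I. smul (\<lambda>_. r i) (s i)) = (\<Sum>i\<in>I. smul (\<lambda>_. r i) (D u (s i)))"
  using s
proof (induction I rule: infinite_finite_induct)
  case (insert x I)
  have s: "smul (\<lambda>_. r i) (s i) \<in> sections A" if "i \<in> insert x I" for i
    by (intro sections_smul smooth_fns_const insert.prems that)
  have "D u (\<Sum>i\<in>insert x I. smul (\<lambda>_. r i) (s i)) = D u (smul (\<lambda>_. r x) (s x)) + D u (\<Sum>i\<in>I. smul (\<lambda>_. r i) (s i))"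
    unfolding sum.insert[OF insert.hyps]
    by (rule generalized_connectionD(4)[OF D u s sections_sum]) (use s in auto)
  also have "D u (smul (\<lambda>_. r x) (s x)) = smul (\<lambda>_. r x) (D u (s x))"
    unfolding generalized_connectionD(5)[OF D u insert.prems[OF insertI1] smooth_fns_const]
      vector_fields_const[OF A anchor_field[OF u]]
    by (simp only: Esec.scale_zero_left add_0_left)
  also have "D u (\<Sum>i\<in>I. smul (\<lambda>_. r i) (s i)) = (\<Sum>i\<in>I. smul (\<lambda>_. r i) (D u (s i)))"
    by (rule insert.IH) (use insert.prems in auto)
  finally show ?case using insert.hyps by simp
next
  case empty
  show ?case using generalized_connectionD(4)[OF D u sections_0 sections_0] by simp
next
  case (infinite I)
  then show ?case using generalized_connectionD(4)[OF D u sections_0 sections_0] by simp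
qed

lemma curvature_add:
  assumes D: "generalized_connection A D"
    and w: "w \<in> sections A" and u: "u \<in> sections A" and v: "v \<in> sections A" and z: "z \<in> sections A"
  shows "curvature A H F D (w + z) u v = curvature A H F D w u v + curvature A H F D z u v"
    and "curvature A H F D w (u + z) v = curvature A H F D w u v + curvature A H F D w z v"
    and "curvature A H F D w u (v + z) = curvature A H F D w u v + curvature A H F D w u z"
proof -
  note cl = generalized_connectionD(1)[OF D] and a1 = generalized_connectionD(2)[OF D] and a2 = generalized_connectionD(4)[OF D]
  show "curvature A H F D (w + z) u v = curvature A H F D w u v + curvature A H F D z u v"
    unfolding curvature_def dorfman_add_left[OF u w z] a1[OF w v z] a1[OF w cl[OF u v] z]
      a2[OF u cl[OF w v] cl[OF z v]] a1[OF dorfman_sections[OF w u] v dorfman_sections[OF z u]] by simp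
  show "curvature A H F D w (u + z) v = curvature A H F D w u v + curvature A H F D w z v"
    unfolding curvature_def dorfman_add_right[OF w u z] a1[OF u v z] a1[OF u cl[OF w v] z]
      a2[OF w cl[OF u v] cl[OF z v]] a1[OF dorfman_sections[OF w u] v dorfman_sections[OF w z]] by simp
  show "curvature A H F D w u (v + z) = curvature A H F D w u v + curvature A H F D w u z"
    unfolding curvature_def a2[OF u v z] a2[OF w v z] a2[OF u cl[OF w v] cl[OF w z]]
      a2[OF w cl[OF u v] cl[OF u z]] a2[OF dorfman_sections[OF w u] v z] by simp
qed

text \<open>The defect of the Dorfman bracket from being tensorial in its first argument has a component that
  is a multiple of \<open>\<langle>w, u\<rangle>\<close>; hence the curvature operator is tensorial on orthogonal pairs.\<close>

lemma curvature_smul: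
  assumes D: "generalized_connection A D"
    and w: "w \<in> sections A" and u: "u \<in> sections A" and v: "v \<in> sections A" and f: "f \<in> C"
    and orth: "pairing w u = 0"
  shows "curvature A H F D (smul f w) u v = smul f (curvature A H F D w u v)"
    and "curvature A H F D w (smul f u) v = smul f (curvature A H F D w u v)"
    and "curvature A H F D w u (smul f v) = smul f (curvature A H F D w u v)"
proof -
  note cl = generalized_connectionD(1)[OF D] and a1 = generalized_connectionD(2)[OF D] and a2 = generalized_connectionD(4)[OF D]
    and s1 = generalized_connectionD(3)[OF D] and s2 = generalized_connectionD(5)[OF D]
  note B = dorfman_sections[OF w u] and uf = anchor_smooth[OF u f] and wf = anchor_smooth[OF w f]
  have neg: "- anchor u f \<in> C" by (rule smooth_fns_uminus[OF uf])
  have "dorfman A H F (smul f w) u = smul f (dorfman A H F w u) + smul (- anchor u f) w"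
    unfolding dorfman_smul_left[OF u w f] orth by (simp only: mult_zero_right Esec.scale_zero_left add_0_right)
  then have d: "D (dorfman A H F (smul f w) u) v = smul f (D (dorfman A H F w u) v) + smul (- anchor u f) (D w v)"
    using a1[OF sections_smul[OF B f] v sections_smul[OF w neg]] s1[OF B v f] s1[OF w v neg] by (simp only:)
  show "curvature A H F D (smul f w) u v = smul f (curvature A H F D w u v)"
    unfolding curvature_def d s1[OF w v f] s1[OF w cl[OF u v] f] s2[OF u cl[OF w v] f]
    by (simp only: Esec.scale_right_diff_distrib Esec.scale_minus_left) simp
  have d: "D (dorfman A H F w (smul f u)) v = smul (anchor w f) (D u v) + smul f (D (dorfman A H F w u) v)"
    unfolding dorfman_smul_right[OF w u f] a1[OF sections_smul[OF u wf] v sections_smul[OF B f]]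
      s1[OF u v wf] s1[OF B v f] by (rule refl)
  show "curvature A H F D w (smul f u) v = smul f (curvature A H F D w u v)"
    unfolding curvature_def d s1[OF u v f] s1[OF u cl[OF w v] f] s2[OF w cl[OF u v] f]
    by (simp only: Esec.scale_right_diff_distrib) simp
  have wuf: "anchor w (anchor u f) \<in> C" "anchor u (anchor w f) \<in> C"
    by (rule anchor_smooth[OF w uf], rule anchor_smooth[OF u wf])
  have 1: "D w (D u (smul f v)) = smul (anchor w (anchor u f)) v + smul (anchor u f) (D w v) +
      (smul (anchor w f) (D u v) + smul f (D w (D u v)))"
    unfolding s2[OF u v f] a2[OF w sections_smul[OF v uf] sections_smul[OF cl[OF u v] f]]
      s2[OF w v uf] s2[OF w cl[OF u v] f] by (rule refl)
  have 2: "D u (D w (smul f v)) = smul (anchor u (anchor w f)) v + smul (anchor w f) (D u v) +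
      (smul (anchor u f) (D w v) + smul f (D u (D w v)))"
    unfolding s2[OF w v f] a2[OF u sections_smul[OF v wf] sections_smul[OF cl[OF w v] f]]
      s2[OF u v wf] s2[OF u cl[OF w v] f] by (rule refl)
  have 3: "D (dorfman A H F w u) (smul f v) =
      smul (anchor w (anchor u f)) v - smul (anchor u (anchor w f)) v + smul f (D (dorfman A H F w u) v)"
    unfolding s2[OF B v f] dorfman_anchor vbracket_def by (simp only: Esec.scale_left_diff_distrib)
  show "curvature A H F D w u (smul f v) = smul f (curvature A H F D w u v)"
    unfolding curvature_def 1 2 3 by (simp only: Esec.scale_right_diff_distrib) simp
qed

end

section \<open>The Ricci tensor of one of the two summands\<close>

text \<open>One of \<open>J\<close> and \<open>J'\<close> stands for \<open>E\<^sub>+\<close> and the other for \<open>E\<^sub>-\<close>. In what follows, the trace is taken over the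
  summand of \<open>J\<close>, so that exchanging the two sets gives both Ricci tensors.\<close>

locale adapted_connection = courant_frame A H F N e \<eta> c
  for A :: "('g::topological_space, 'm::euclidean_space) atlas" and H F N e \<eta> c +
  fixes D :: "'g Esec \<Rightarrow> 'g Esec \<Rightarrow> 'g Esec" and J J' :: "nat set"
  assumes D: "generalized_connection A D"
    and torsion: "u \<in> sections A \<Longrightarrow> v \<in> sections A \<Longrightarrow> w \<in> sections A \<Longrightarrow> gen_torsion A H F D u v w = 0"
    and J_un: "J \<union> J' = {..<N}" and J_int: "J \<inter> J' = {}"
    and preserves: "u \<in> sections A \<Longrightarrow> w \<in> frame_span J \<Longrightarrow> D u w \<in> frame_span J"
begin

lemma J_subset: "J \<subseteq> {..<N}" "J' \<subseteq> {..<N}" and finite_J: "finite J" "finite J'"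
proof -
  show *: "J \<subseteq> {..<N}" "J' \<subseteq> {..<N}" using J_un by auto
  show "finite J" "finite J'" by (rule finite_subset[OF *(1)], simp) (rule finite_subset[OF *(2)], simp)
qed

lemma J_less: "B \<in> J \<Longrightarrow> B < N" "B \<in> J' \<Longrightarrow> B < N"
  using J_subset by auto

lemma sum_split: "(\<Sum>B<N. f B) = (\<Sum>B\<in>J. f B) + (\<Sum>B\<in>J'. f B :: real)"
  unfolding J_un[symmetric] by (rule sum.union_disjoint[OF finite_J J_int])

lemma frame_span_orthogonal:
  assumes w: "w \<in> frame_span J" and z: "z \<in> frame_span J'" shows "pairing w z = 0"
  unfolding pairing_expand[OF frame_span_section[OF w] frame_span_section[OF z]]
proof (rule sum.neutral, rule ballI)
  fix B assume "B \<in> {..<N}"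
  then have "pairing w (e B) = 0 \<or> pairing z (e B) = 0"
    using frame_span_pairing[OF w] frame_span_pairing[OF z] J_int by blast
  then show "(\<lambda>_. \<eta> B) * pairing w (e B) * pairing z (e B) = 0" by auto
qed

text \<open>A metric connection preserves the orthogonal complement of what it preserves.\<close>

lemma preserves':
  assumes u: "u \<in> sections A" and w: "w \<in> frame_span J'" shows "D u w \<in> frame_span J'"
proof (rule frame_spanI)
  show "D u w \<in> sections A" by (rule generalized_connectionD(1)[OF D u frame_span_section[OF w]])
  fix B assume B: "B < N" "B \<notin> J'"
  then have eB: "e B \<in> frame_span J" using J_un by (intro e_frame_span) auto
  have "anchor u (pairing w (e B)) = pairing (D u w) (e B) + pairing w (D u (e B))"
    by (rule generalized_connectionD(6)[OF D u frame_span_section[OF w] e_section[OF B(1)]])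
  moreover have "pairing w (e B) = 0" "pairing w (D u (e B)) = 0"
    using frame_span_orthogonal[OF eB w] frame_span_orthogonal[OF preserves[OF u eB] w] by (simp_all only: pairing_sym[of w])
  ultimately show "pairing (D u w) (e B) = 0" using field_zero_fun[OF anchor_field[OF u]] by simp
qed

definition \<Gamma> :: "nat \<Rightarrow> nat \<Rightarrow> nat \<Rightarrow> 'g sfun" where
  "\<Gamma> B B' B'' = pairing (D (e B) (e B')) (e B'')"

lemma \<Gamma>_smooth: "B < N \<Longrightarrow> B' < N \<Longrightarrow> B'' < N \<Longrightarrow> \<Gamma> B B' B'' \<in> C"
  unfolding \<Gamma>_def by (intro pairing_smooth generalized_connectionD(1)[OF D] e_section)

text \<open>Of the three Christoffel symbols in the torsion of \<open>e a, e i, e k\<close> two vanish, because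
  \<open>D u (e a)\<close> is orthogonal to the summand of \<open>i\<close> and \<open>k\<close>.\<close>

lemma \<Gamma>_mixed:
  assumes a: "a \<in> J'" and i: "i \<in> J" and k: "k \<in> J"
  shows "\<Gamma> a i k = (\<lambda>_. c a i k)"
proof -
  note N = J_less(2)[OF a] J_less(1)[OF i] J_less(1)[OF k]
  note E = e_section[OF N(1)] e_section[OF N(2)] e_section[OF N(3)]
  note cl = generalized_connectionD(1)[OF D]
  have "e a \<in> frame_span J'" by (rule e_frame_span[OF N(1) a])
  then have 1: "pairing (D (e i) (e a)) (e k) = 0" "pairing (D (e k) (e a)) (e i) = 0"
    using k i J_int by (auto intro!: frame_span_pairing[OF preserves'] E N)
  have "gen_torsion A H F D (e a) (e i) (e k) = 0" by (rule torsion[OF E])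
  then have "pairing (D (e a) (e i)) (e k) - pairing (D (e i) (e a)) (e k) - pairing (dorfman A H F (e a) (e i)) (e k)
      + pairing (e i) (D (e k) (e a)) = 0"
    unfolding gen_torsion_def
    by (simp only: pairing_diff_left[OF sections_diff[OF cl[OF E(1,2)] cl[OF E(2,1)]] dorfman_sections[OF E(1,2)] E(3)]
      pairing_diff_left[OF cl[OF E(1,2)] cl[OF E(2,1)] E(3)])
  then show ?thesis unfolding \<Gamma>_def
    using 1 e_bracket[OF N] by (simp add: pairing_sym[of "e i"])
qed

lemma D_mixed:
  assumes a: "a \<in> J'" and i: "i \<in> J"
  shows "D (e a) (e i) = (\<Sum>k\<in>J. smul (\<lambda>_. \<eta> k * c a i k) (e k))"
proof -
  have "D (e a) (e i) \<in> frame_span J"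
    by (intro preserves e_section e_frame_span J_less a i)
  from frame_span_expand[OF this J_subset(1)]
  have "D (e a) (e i) = (\<Sum>k\<in>J. smul (coord (D (e a) (e i)) k) (e k))" .
  also have "\<dots> = (\<Sum>k\<in>J. smul (\<lambda>_. \<eta> k * c a i k) (e k))"
  proof (rule sum.cong[OF refl])
    fix k assume k: "k \<in> J"
    show "smul (coord (D (e a) (e i)) k) (e k) = smul (\<lambda>_. \<eta> k * c a i k) (e k)"
      unfolding coord_def \<Gamma>_mixed[OF a i k, unfolded \<Gamma>_def] const_fun_simps by (rule refl)
  qed
  finally show ?thesis .
qed

lemma curvature_frame_span:
  assumes "w \<in> frame_span J" "u \<in> frame_span J'" "v \<in> frame_span J" shows "curvature A H F D w u v \<in> frame_span J"
  unfolding curvature_def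
  by (intro frame_span_diff preserves dorfman_sections frame_span_section[OF assms(1)] frame_span_section[OF assms(2)] assms(3))

lemma ricci_trace:
  assumes J: "J = {k..<k + n}" "k + n \<le> N" and u: "u \<in> frame_span J'" and v: "v \<in> frame_span J"
  shows "ricci A H F D (frame_span J) u v = (\<Sum>B\<in>J. coord (curvature A H F D (e B) u v) B)"
  unfolding ricci_def J(1)
proof (rule sec_trace_frame_span[OF J(2)])
  fix w assume w: "w \<in> frame_span {k..<k + n}"
  then have wJ: "w \<in> frame_span J" unfolding J(1) .
  show "curvature A H F D w u v \<in> frame_span {k..<k + n}"
    using curvature_frame_span[OF wJ u v] unfolding J(1) .
  show "curvature A H F D (smul f w) u v = smul f (curvature A H F D w u v)" if "f \<in> C" for f
    by (rule curvature_smul(1)[OF D frame_span_section[OF w] frame_span_section[OF u] frame_span_section[OF v] that frame_span_orthogonal[OF wJ u]])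
  show "curvature A H F D (w + z) u v = curvature A H F D w u v + curvature A H F D z u v" if "z \<in> frame_span {k..<k + n}" for z
    by (rule curvature_add(1)[OF D frame_span_section[OF w] frame_span_section[OF u] frame_span_section[OF v] frame_span_section[OF that]])
qed

lemma ricci_zeroI:
  assumes J: "J = {k..<k + n}" "k + n \<le> N"
    and zero: "\<And>a i. a \<in> J' \<Longrightarrow> i \<in> J \<Longrightarrow> ricci A H F D (frame_span J) (e a) (e i) = 0"
    and u: "u \<in> frame_span J'" and v: "v \<in> frame_span J"
  shows "ricci A H F D (frame_span J) u v = 0"
proof -
  have eJ: "e B \<in> frame_span J" if "B \<in> J" for B by (rule e_frame_span[OF J_less(1)[OF that] that])
  have eJ': "e B \<in> frame_span J'" if "B \<in> J'" for B by (rule e_frame_span[OF J_less(2)[OF that] that])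
  let ?\<Psi> = "\<lambda>u v. \<Sum>B\<in>J. coord (curvature A H F D (e B) u v) B"
  have coord_add: "coord (x + y) B = coord x B + coord y B" if "x \<in> frame_span J" "y \<in> frame_span J" "B \<in> J" for x y B
    unfolding coord_def pairing_add_left[OF frame_span_section[OF that(1)] frame_span_section[OF that(2)] e_section[OF J_less(1)[OF that(3)]]]
    by (rule distrib_left)
  have coord_smul: "coord (smul f x) B = f * coord x B" if "x \<in> frame_span J" "f \<in> C" "B \<in> J" for x f B
    unfolding coord_def pairing_smul_left[OF frame_span_section[OF that(1)] e_section[OF J_less(1)[OF that(3)]] that(2)]
    by (rule mult.left_commute)
  have add_u: "?\<Psi> (x + y) z = ?\<Psi> x z + ?\<Psi> y z" if x: "x \<in> frame_span J'" and y: "y \<in> frame_span J'" and z: "z \<in> frame_span J" for x y z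
    unfolding sum.distrib[symmetric]
  proof (rule sum.cong[OF refl])
    fix B assume B: "B \<in> J"
    show "coord (curvature A H F D (e B) (x + y) z) B = coord (curvature A H F D (e B) x z) B + coord (curvature A H F D (e B) y z) B"
      unfolding curvature_add(2)[OF D frame_span_section[OF eJ[OF B]] frame_span_section[OF x] frame_span_section[OF z] frame_span_section[OF y]]
      by (rule coord_add[OF curvature_frame_span[OF eJ[OF B] x z] curvature_frame_span[OF eJ[OF B] y z] B])
  qed
  have smul_u: "?\<Psi> (smul f x) z = f * ?\<Psi> x z" if x: "x \<in> frame_span J'" and f: "f \<in> C" and z: "z \<in> frame_span J" for x f z
    unfolding sum_distrib_left
  proof (rule sum.cong[OF refl])
    fix B assume B: "B \<in> J"
    show "coord (curvature A H F D (e B) (smul f x) z) B = f * coord (curvature A H F D (e B) x z) B"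
      unfolding curvature_smul(2)[OF D frame_span_section[OF eJ[OF B]] frame_span_section[OF x] frame_span_section[OF z] f frame_span_orthogonal[OF eJ[OF B] x]]
      by (rule coord_smul[OF curvature_frame_span[OF eJ[OF B] x z] f B])
  qed
  have add_v: "?\<Psi> x (y + z) = ?\<Psi> x y + ?\<Psi> x z" if x: "x \<in> frame_span J'" and y: "y \<in> frame_span J" and z: "z \<in> frame_span J" for x y z
    unfolding sum.distrib[symmetric]
  proof (rule sum.cong[OF refl])
    fix B assume B: "B \<in> J"
    show "coord (curvature A H F D (e B) x (y + z)) B = coord (curvature A H F D (e B) x y) B + coord (curvature A H F D (e B) x z) B"
      unfolding curvature_add(3)[OF D frame_span_section[OF eJ[OF B]] frame_span_section[OF x] frame_span_section[OF y] frame_span_section[OF z]]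
      by (rule coord_add[OF curvature_frame_span[OF eJ[OF B] x y] curvature_frame_span[OF eJ[OF B] x z] B])
  qed
  have smul_v: "?\<Psi> x (smul f z) = f * ?\<Psi> x z" if x: "x \<in> frame_span J'" and f: "f \<in> C" and z: "z \<in> frame_span J" for x f z
    unfolding sum_distrib_left
  proof (rule sum.cong[OF refl])
    fix B assume B: "B \<in> J"
    show "coord (curvature A H F D (e B) x (smul f z)) B = f * coord (curvature A H F D (e B) x z) B"
      unfolding curvature_smul(3)[OF D frame_span_section[OF eJ[OF B]] frame_span_section[OF x] frame_span_section[OF z] f frame_span_orthogonal[OF eJ[OF B] x]]
      by (rule coord_smul[OF curvature_frame_span[OF eJ[OF B] x z] f B])
  qed
  have frame: "?\<Psi> (e a) (e i) = 0" if "a \<in> J'" "i \<in> J" for a i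
    using zero[OF that] ricci_trace[OF J eJ'[OF that(1)] eJ[OF that(2)]] by (simp only:)
  have ev: "?\<Psi> (e a) v = 0" if a: "a \<in> J'" for a
    by (rule tensor_zero[where \<Psi> = "?\<Psi> (e a)" and J = J])
      (intro J_subset add_v smul_v frame eJ' a v; assumption)+
  have "?\<Psi> u v = 0"
    by (rule tensor_zero[where \<Psi> = "\<lambda>u. ?\<Psi> u v" and J = J' and u = u])
      (intro J_subset add_u smul_u v u ev; assumption)+
  then show ?thesis unfolding ricci_trace[OF J u v] .
qed

text \<open>The mixed Christoffel symbols are structure constants. The pure ones, which the torsion leaves
  undetermined, occur in the three terms of the curvature. In the trace those from the second and the
  third term cancel, while those from the first one add up to the divergence.\<close>

lemma ricci_frame:
  assumes J: "J = {k..<k + n}" "k + n \<le> N"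
    and dv: "\<And>B. B \<in> J \<Longrightarrow> (\<Sum>j\<in>J. (\<lambda>_. \<eta> j) * \<Gamma> j B j) = (\<lambda>_. d B)"
    and a: "a \<in> J'" and i: "i \<in> J"
  shows "ricci A H F D (frame_span J) (e a) (e i) =
    (\<lambda>_. (\<Sum>k\<in>J. \<eta> k * c a i k * d k) - (\<Sum>j\<in>J. \<Sum>b\<in>J'. \<eta> j * \<eta> b * c j a b * c b i j))"
proof (rule ext)
  fix p
  note aN = J_less(2)[OF a] and iN = J_less(1)[OF i]
  note cl = generalized_connectionD(1)[OF D]
  have eJ: "e B \<in> frame_span J" if "B \<in> J" for B by (rule e_frame_span[OF J_less(1)[OF that] that])
  have eJ': "e B \<in> frame_span J'" if "B \<in> J'" for B by (rule e_frame_span[OF J_less(2)[OF that] that])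
  note ea = e_section[OF aN] and ei = e_section[OF iN]
  define G where "G B B' B'' = \<Gamma> B B' B'' p" for B B' B''
  have R: "pairing (curvature A H F D (e j) (e a) (e i)) (e j) p =
      (\<Sum>k\<in>J. \<eta> k * c a i k * G j k j) - (anchor (e a) (\<Gamma> j i j) p - (\<Sum>k\<in>J. \<eta> k * G j i k * c a j k))
      - ((\<Sum>k\<in>J. \<eta> k * c j a k * G k i j) + (\<Sum>b\<in>J'. \<eta> b * c j a b * c b i j))"
    if j: "j \<in> J" for j
  proof -
    note jN = J_less(1)[OF j] and ej = e_section[OF J_less(1)[OF j]]
    note Dji = cl[OF ej ei] and Dai = cl[OF ea ei] and Daj = cl[OF ea ej] and br = dorfman_sections[OF ej ea]
    have 1: "pairing (D (e j) (D (e a) (e i))) (e j) p = (\<Sum>k\<in>J. \<eta> k * c a i k * G j k j)"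
    proof -
      have "D (e j) (D (e a) (e i)) = (\<Sum>k\<in>J. smul (\<lambda>_. \<eta> k * c a i k) (D (e j) (e k)))"
        unfolding D_mixed[OF a i] by (rule D_sum_right[OF D ej]) (rule e_section[OF J_less(1)])
      then have "pairing (D (e j) (D (e a) (e i))) (e j) =
          pairing (\<Sum>k\<in>J. smul (\<lambda>_. \<eta> k * c a i k) (D (e j) (e k))) (e j)" by (rule arg_cong)
      also have "\<dots> = (\<Sum>k\<in>J. pairing (smul (\<lambda>_. \<eta> k * c a i k) (D (e j) (e k))) (e j))"
        by (rule pairing_sum_left[OF _ ej]) (intro sections_smul smooth_fns_const cl ej e_section[OF J_less(1)])
      also have "\<dots> = (\<Sum>k\<in>J. (\<lambda>_. \<eta> k * c a i k) * \<Gamma> j k j)"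
        unfolding \<Gamma>_def
        by (rule sum.cong[OF refl], rule pairing_smul_left[OF _ ej smooth_fns_const]) (intro cl ej e_section[OF J_less(1)])
      finally show ?thesis by (simp add: sum_fun_apply G_def)
    qed
    have 2: "pairing (D (e a) (D (e j) (e i))) (e j) p =
        anchor (e a) (\<Gamma> j i j) p - (\<Sum>k\<in>J. \<eta> k * G j i k * c a j k)"
    proof -
      have "anchor (e a) (\<Gamma> j i j) = pairing (D (e a) (D (e j) (e i))) (e j) + pairing (D (e j) (e i)) (D (e a) (e j))"
        unfolding \<Gamma>_def by (rule generalized_connectionD(6)[OF D ea Dji ej])
      moreover have "pairing (D (e j) (e i)) (D (e a) (e j)) p = (\<Sum>k\<in>J. \<eta> k * G j i k * c a j k)"
      proof -
        have "pairing (D (e j) (e i)) (D (e a) (e j)) p = (\<Sum>B<N. \<eta> B * G j i B * \<Gamma> a j B p)"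
          unfolding pairing_expand[OF Dji Daj] by (simp add: sum_fun_apply G_def \<Gamma>_def)
        also have "\<dots> = (\<Sum>B\<in>J. \<eta> B * G j i B * \<Gamma> a j B p)"
        proof (rule sum.mono_neutral_right)
          have "\<Gamma> a j B = 0" if "B < N" "B \<notin> J" for B
            unfolding \<Gamma>_def by (rule frame_span_pairing[OF preserves[OF ea eJ[OF j]] that])
          then show "\<forall>B\<in>{..<N} - J. \<eta> B * G j i B * \<Gamma> a j B p = 0" by simp
        qed (use J_subset in auto)
        also have "\<dots> = (\<Sum>k\<in>J. \<eta> k * G j i k * c a j k)"
          by (rule sum.cong[OF refl]) (simp add: \<Gamma>_mixed[OF a j])
        finally show ?thesis .
      qed
      ultimately show ?thesis by simp
    qed
    have 3: "pairing (D (dorfman A H F (e j) (e a)) (e i)) (e j) p =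
        (\<Sum>k\<in>J. \<eta> k * c j a k * G k i j) + (\<Sum>b\<in>J'. \<eta> b * c j a b * c b i j)"
    proof -
      have tens: "pairing (D (dorfman A H F (e j) (e a)) (e i)) (e j) =
          (\<Sum>B\<in>{..<N}. coord (dorfman A H F (e j) (e a)) B * pairing (D (e B) (e i)) (e j))"
      proof (rule tensor_expand[where \<Psi> = "\<lambda>u. pairing (D u (e i)) (e j)" and J = "{..<N}"])
        show "dorfman A H F (e j) (e a) \<in> frame_span {..<N}" using br unfolding frame_span_all .
        fix x assume "x \<in> frame_span {..<N}"
        then have x: "x \<in> sections A" unfolding frame_span_all .
        show "pairing (D (smul f x) (e i)) (e j) = f * pairing (D x (e i)) (e j)" if f: "f \<in> C" for f
          unfolding generalized_connectionD(3)[OF D x ei f] by (rule pairing_smul_left[OF cl[OF x ei] ej f])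
        fix y assume "y \<in> frame_span {..<N}"
        then have y: "y \<in> sections A" unfolding frame_span_all .
        show "pairing (D (x + y) (e i)) (e j) = pairing (D x (e i)) (e j) + pairing (D y (e i)) (e j)"
          unfolding generalized_connectionD(2)[OF D x ei y] by (rule pairing_add_left[OF cl[OF x ei] cl[OF y ei] ej])
      qed simp
      have "pairing (D (dorfman A H F (e j) (e a)) (e i)) (e j) p = (\<Sum>B<N. \<eta> B * c j a B * G B i j)"
        unfolding tens sum_fun_apply
        by (rule sum.cong[OF refl]) (simp add: coord_def G_def \<Gamma>_def e_bracket[OF jN aN])
      also have "\<dots> = (\<Sum>k\<in>J. \<eta> k * c j a k * G k i j) + (\<Sum>b\<in>J'. \<eta> b * c j a b * G b i j)"
        by (rule sum_split)
      also have "(\<Sum>b\<in>J'. \<eta> b * c j a b * G b i j) = (\<Sum>b\<in>J'. \<eta> b * c j a b * c b i j)"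
        by (rule sum.cong[OF refl]) (simp add: G_def \<Gamma>_mixed[OF _ i j])
      finally show ?thesis .
    qed
    show ?thesis
      unfolding curvature_def
        pairing_diff_left[OF sections_diff[OF cl[OF ej Dai] cl[OF ea Dji]] cl[OF br ei] ej]
        pairing_diff_left[OF cl[OF ej Dai] cl[OF ea Dji] ej] minus_apply 1 2 3 by (rule refl)
  qed
  \<comment> \<open>The derivatives of the pure symbols add up to the derivative of the divergence of \<open>e i\<close>, a constant.\<close>
  have flat: "(\<Sum>j\<in>J. \<eta> j * anchor (e a) (\<Gamma> j i j) p) = 0"
  proof -
    have sm: "\<Gamma> j i j \<in> C" if "j \<in> J" for j by (intro \<Gamma>_smooth J_less(1) that i)
    note X = anchor_field[OF ea]
    have "0 = anchor (e a) (\<Sum>j\<in>J. (\<lambda>_. \<eta> j) * \<Gamma> j i j)"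
      unfolding dv[OF i] vector_fields_const[OF A X] by (rule refl)
    also have "\<dots> = (\<Sum>j\<in>J. anchor (e a) ((\<lambda>_. \<eta> j) * \<Gamma> j i j))"
      by (rule field_sum[OF X]) (intro smooth_fns_mult smooth_fns_const sm)
    also have "\<dots> = (\<Sum>j\<in>J. (\<lambda>_. \<eta> j) * anchor (e a) (\<Gamma> j i j))"
      by (rule sum.cong[OF refl], rule field_const_mult[OF X sm])
    finally have "0 p = (\<Sum>j\<in>J. (\<lambda>_. \<eta> j) * anchor (e a) (\<Gamma> j i j)) p" by (rule fun_cong)
    then show ?thesis by (simp add: sum_fun_apply)
  qed
  have dvp: "(\<Sum>j\<in>J. \<eta> j * G j B j) = d B" if "B \<in> J" for B
    using fun_cong[OF dv[OF that], of p] by (simp add: sum_fun_apply G_def)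
  have div: "(\<Sum>j\<in>J. \<eta> j * (\<Sum>k\<in>J. \<eta> k * c a i k * G j k j)) = (\<Sum>k\<in>J. \<eta> k * c a i k * d k)"
  proof -
    have "(\<Sum>j\<in>J. \<eta> j * (\<Sum>k\<in>J. \<eta> k * c a i k * G j k j)) = (\<Sum>j\<in>J. \<Sum>k\<in>J. \<eta> k * c a i k * (\<eta> j * G j k j))"
      by (simp only: sum_distrib_left) (simp only: ac_simps)
    also have "\<dots> = (\<Sum>k\<in>J. \<Sum>j\<in>J. \<eta> k * c a i k * (\<eta> j * G j k j))" by (rule sum.swap)
    also have "\<dots> = (\<Sum>k\<in>J. \<eta> k * c a i k * d k)"
      by (rule sum.cong[OF refl]) (simp add: sum_distrib_left[symmetric] dvp)
    finally show ?thesis .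
  qed
  \<comment> \<open>Exchange \<open>j\<close> and \<open>k\<close>; the structure constants are totally skew.\<close>
  have cancel: "(\<Sum>j\<in>J. \<eta> j * (\<Sum>k\<in>J. \<eta> k * G j i k * c a j k)) = (\<Sum>j\<in>J. \<eta> j * (\<Sum>k\<in>J. \<eta> k * c j a k * G k i j))"
  proof -
    have "(\<Sum>j\<in>J. \<eta> j * (\<Sum>k\<in>J. \<eta> k * c j a k * G k i j)) = (\<Sum>j\<in>J. \<Sum>k\<in>J. \<eta> j * (\<eta> k * c j a k * G k i j))"
      by (simp only: sum_distrib_left)
    also have "\<dots> = (\<Sum>k\<in>J. \<Sum>j\<in>J. \<eta> j * (\<eta> k * c j a k * G k i j))" by (rule sum.swap)
    also have "\<dots> = (\<Sum>k\<in>J. \<Sum>j\<in>J. \<eta> k * (\<eta> j * G k i j * c a k j))"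
    proof (intro sum.cong[OF refl])
      fix k j assume "k \<in> J" "j \<in> J"
      then have "c j a k = c a k j"
        using c_swap12[of a j k] c_swap23[of a j k] J_less aN by auto
      then show "\<eta> j * (\<eta> k * c j a k * G k i j) = \<eta> k * (\<eta> j * G k i j * c a k j)" by simp
    qed
    finally show ?thesis by (simp only: sum_distrib_left)
  qed
  have mixed: "(\<Sum>j\<in>J. \<eta> j * (\<Sum>b\<in>J'. \<eta> b * c j a b * c b i j)) = (\<Sum>j\<in>J. \<Sum>b\<in>J'. \<eta> j * \<eta> b * c j a b * c b i j)"
    by (simp only: sum_distrib_left mult.assoc)
  have "ricci A H F D (frame_span J) (e a) (e i) p = (\<Sum>j\<in>J. \<eta> j * pairing (curvature A H F D (e j) (e a) (e i)) (e j) p)"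
    unfolding ricci_trace[OF J eJ'[OF a] eJ[OF i]] sum_fun_apply coord_def times_fun_apply by (rule refl)
  also have "\<dots> = (\<Sum>j\<in>J. \<eta> j * (\<Sum>k\<in>J. \<eta> k * c a i k * G j k j) - \<eta> j * anchor (e a) (\<Gamma> j i j) p
      + \<eta> j * (\<Sum>k\<in>J. \<eta> k * G j i k * c a j k) - \<eta> j * (\<Sum>k\<in>J. \<eta> k * c j a k * G k i j)
      - \<eta> j * (\<Sum>b\<in>J'. \<eta> b * c j a b * c b i j))"
    by (rule sum.cong[OF refl]) (simp only: R algebra_simps)
  also have "\<dots> = (\<Sum>k\<in>J. \<eta> k * c a i k * d k) - (\<Sum>j\<in>J. \<Sum>b\<in>J'. \<eta> j * \<eta> b * c j a b * c b i j)"
    unfolding sum_subtractf sum.distrib div flat cancel mixed by simp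
  finally show "ricci A H F D (frame_span J) (e a) (e i) p =
    (\<Sum>k\<in>J. \<eta> k * c a i k * d k) - (\<Sum>j\<in>J. \<Sum>b\<in>J'. \<eta> j * \<eta> b * c j a b * c b i j)" .
qed

end

section \<open>Existence of Levi-Civita connections with given divergence\<close>

context courant_frame
begin

lemma divergence_trace:
  assumes D: "generalized_connection A D" and u: "u \<in> sections A"
  shows "connection_divergence A D u = (\<Sum>B<N. coord (D (e B) u) B)"
proof -
  have "sec_trace A (frame_span {0..<0 + N}) (\<lambda>w. D w u) = (\<Sum>B\<in>{0..<0 + N}. coord (D (e B) u) B)"
  proof (rule sec_trace_frame_span)
    fix w assume "w \<in> frame_span {0..<0 + N}"
    then have w: "w \<in> sections A" by (rule frame_span_section)
    show "D w u \<in> frame_span {0..<0 + N}"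
      using generalized_connectionD(1)[OF D w u] unfolding frame_span_all[symmetric] by (simp add: atLeast0LessThan)
    show "D (smul f w) u = smul f (D w u)" if "f \<in> C" for f
      by (rule generalized_connectionD(3)[OF D w u that])
    show "D (w + z) u = D w u + D z u" if "z \<in> frame_span {0..<0 + N}" for z
      by (rule generalized_connectionD(2)[OF D w u frame_span_section[OF that]])
  qed simp
  then show ?thesis unfolding connection_divergence_def frame_span_all[symmetric] by (simp only: atLeast0LessThan add_0)
qed

lemma coord_add: "u \<in> sections A \<Longrightarrow> w \<in> sections A \<Longrightarrow> B < N \<Longrightarrow> coord (u + w) B = coord u B + coord w B"
  unfolding coord_def by (simp only: pairing_add_left e_section distrib_left)

lemma coord_smul: "u \<in> sections A \<Longrightarrow> f \<in> C \<Longrightarrow> B < N \<Longrightarrow> coord (smul f u) B = f * coord u B"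
  unfolding coord_def by (simp only: pairing_smul_left e_section mult.left_commute)

lemma coord_frame: "B < N \<Longrightarrow> B' < N \<Longrightarrow> coord (e B) B' = (\<lambda>_. if B = B' then 1 else 0)"
  unfolding coord_def e_pairing const_fun_simps using \<eta>_square by auto

lemma pairing_eq_coord: "B < N \<Longrightarrow> pairing u (e B) p = \<eta> B * coord u B p"
  using \<eta>_square[of B] by (simp add: coord_def mult.assoc[symmetric])

lemma coord_eqI:
  assumes "u \<in> sections A" "w \<in> sections A" "\<And>B. B < N \<Longrightarrow> coord u B = coord w B"
  shows "u = w"
proof (rule section_eqI[OF assms(1,2)])
  fix B assume B: "B < N"
  show "pairing u (e B) = pairing w (e B)"
    by (rule ext) (simp only: pairing_eq_coord[OF B] assms(3)[OF B])
qed

lemma pairing_coord: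
  assumes u: "u \<in> sections A" and w: "w \<in> sections A"
  shows "pairing u w = (\<Sum>B<N. (\<lambda>_. \<eta> B) * (coord u B * coord w B))"
  unfolding pairing_expand[OF u w]
proof (intro sum.cong refl ext)
  fix B p assume "B \<in> {..<N}"
  then have B: "B < N" by simp
  have "\<eta> B * (\<eta> B * coord u B p) * (\<eta> B * coord w B p) = (\<eta> B * \<eta> B) * (\<eta> B * (coord u B p * coord w B p))"
    by (simp only: ac_simps)
  then show "((\<lambda>_. \<eta> B) * pairing u (e B) * pairing w (e B)) p = ((\<lambda>_. \<eta> B) * (coord u B * coord w B)) p"
    by (simp add: pairing_eq_coord[OF B] \<eta>_square[OF B])
qed

lemma anchor_expand:
  assumes u: "u \<in> sections A"
  shows "anchor u f = (\<Sum>B<N. coord u B * anchor (e B) f)"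
proof -
  have "anchor u f = anchor (\<Sum>B<N. smul (coord u B) (e B)) f"
    using coord_expand[OF u] by (rule arg_cong)
  then show ?thesis by (simp only: anchor_sum anchor_smul)
qed

text \<open>The difference of two divergence operators is a tensor, so it is determined by its values on the
  frame.\<close>

lemma divergence_eqI:
  assumes D: "generalized_connection A D" and \<delta>: "divergence_operator A \<delta>"
    and frame: "\<And>B. B < N \<Longrightarrow> connection_divergence A D (e B) = \<delta> (e B)"
    and u: "u \<in> sections A"
  shows "connection_divergence A D u = \<delta> u"
proof -
  note cl = generalized_connectionD(1)[OF D]
  have \<delta>_add: "\<delta> (x + y) = \<delta> x + \<delta> y" if "x \<in> sections A" "y \<in> sections A" for x y
    using \<delta> that unfolding divergence_operator_def by blast
  have \<delta>_smul: "\<delta> (smul f x) = anchor x f + f * \<delta> x" if "x \<in> sections A" "f \<in> C" for x f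
    using \<delta> that unfolding divergence_operator_def by blast
  have "connection_divergence A D u - \<delta> u = 0"
  proof (rule tensor_zero[where \<Psi> = "\<lambda>u. connection_divergence A D u - \<delta> u" and J = "{..<N}"])
    fix x assume "x \<in> frame_span {..<N}"
    then have x: "x \<in> sections A" unfolding frame_span_all .
    show "connection_divergence A D (smul f x) - \<delta> (smul f x) = f * (connection_divergence A D x - \<delta> x)"
      if f: "f \<in> C" for f
    proof -
      have "connection_divergence A D (smul f x) = (\<Sum>B<N. coord (D (e B) (smul f x)) B)"
        by (rule divergence_trace[OF D sections_smul[OF x f]])
      also have "\<dots> = (\<Sum>B<N. coord x B * anchor (e B) f + f * coord (D (e B) x) B)"
      proof (rule sum.cong[OF refl])
        fix B assume "B \<in> {..<N}"
        then have B: "B < N" by simp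
        note eB = e_section[OF B]
        note af = anchor_smooth[OF eB f]
        show "coord (D (e B) (smul f x)) B = coord x B * anchor (e B) f + f * coord (D (e B) x) B"
          unfolding generalized_connectionD(5)[OF D eB x f]
            coord_add[OF sections_smul[OF x af] sections_smul[OF cl[OF eB x] f] B]
            coord_smul[OF x af B] coord_smul[OF cl[OF eB x] f B] by (simp only: mult.commute)
      qed
      also have "\<dots> = anchor x f + f * connection_divergence A D x"
        unfolding sum.distrib anchor_expand[OF x] divergence_trace[OF D x] sum_distrib_left by (rule refl)
      finally show ?thesis unfolding \<delta>_smul[OF x f] by (simp only: algebra_simps)
    qed
    fix y assume "y \<in> frame_span {..<N}"
    then have y: "y \<in> sections A" unfolding frame_span_all .
    have "connection_divergence A D (x + y) = connection_divergence A D x + connection_divergence A D y"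
      unfolding divergence_trace[OF D x] divergence_trace[OF D y] divergence_trace[OF D sections_add[OF x y]] sum.distrib[symmetric]
    proof (rule sum.cong[OF refl])
      fix B assume "B \<in> {..<N}"
      then have B: "B < N" by simp
      show "coord (D (e B) (x + y)) B = coord (D (e B) x) B + coord (D (e B) y) B"
        unfolding generalized_connectionD(4)[OF D e_section[OF B] x y]
        by (rule coord_add[OF cl[OF e_section[OF B] x] cl[OF e_section[OF B] y] B])
    qed
    then show "connection_divergence A D (x + y) - \<delta> (x + y) =
        connection_divergence A D x - \<delta> x + (connection_divergence A D y - \<delta> y)"
      unfolding \<delta>_add[OF x y] by simp
  next
    fix B assume "B \<in> {..<N}"
    then show "connection_divergence A D (e B) - \<delta> (e B) = 0" using frame by simp
  qed (use u in \<open>simp_all add: frame_span_all\<close>)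
  then show ?thesis by simp
qed

text \<open>The derivatives of \<open>f\<close> produced by the connection are cancelled by those produced by the Dorfman
  bracket, including the one that comes from its symmetric part.\<close>

lemma torsion_tensor:
  assumes D: "generalized_connection A D"
    and u: "u \<in> sections A" and v: "v \<in> sections A" and w: "w \<in> sections A"
  shows "z \<in> sections A \<Longrightarrow> gen_torsion A H F D (u + z) v w = gen_torsion A H F D u v w + gen_torsion A H F D z v w"
    and "z \<in> sections A \<Longrightarrow> gen_torsion A H F D u (v + z) w = gen_torsion A H F D u v w + gen_torsion A H F D u z w"
    and "z \<in> sections A \<Longrightarrow> gen_torsion A H F D u v (w + z) = gen_torsion A H F D u v w + gen_torsion A H F D u v z"
    and "f \<in> C \<Longrightarrow> gen_torsion A H F D (smul f u) v w = f * gen_torsion A H F D u v w"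
    and "f \<in> C \<Longrightarrow> gen_torsion A H F D u (smul f v) w = f * gen_torsion A H F D u v w"
    and "f \<in> C \<Longrightarrow> gen_torsion A H F D u v (smul f w) = f * gen_torsion A H F D u v w"
proof -
  note cl = generalized_connectionD(1)[OF D] and a1 = generalized_connectionD(2)[OF D] and a2 = generalized_connectionD(4)[OF D]
    and s1 = generalized_connectionD(3)[OF D] and s2 = generalized_connectionD(5)[OF D]
  have T: "gen_torsion A H F D x y t = pairing (D x y) t - pairing (D y x) t - pairing (dorfman A H F x y) t + pairing y (D t x)"
    if x: "x \<in> sections A" and y: "y \<in> sections A" and t: "t \<in> sections A" for x y t
    unfolding gen_torsion_def pairing_diff_left[OF sections_diff[OF cl[OF x y] cl[OF y x]] dorfman_sections[OF x y] t]
      pairing_diff_left[OF cl[OF x y] cl[OF y x] t] by (rule refl)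
  {
    assume z: "z \<in> sections A"
    show "gen_torsion A H F D (u + z) v w = gen_torsion A H F D u v w + gen_torsion A H F D z v w"
      unfolding T[OF sections_add[OF u z] v w] T[OF u v w] T[OF z v w] a1[OF u v z] a2[OF v u z] a2[OF w u z]
        dorfman_add_left[OF v u z] pairing_add_left[OF cl[OF u v] cl[OF z v] w] pairing_add_left[OF cl[OF v u] cl[OF v z] w]
        pairing_add_right[OF cl[OF w u] cl[OF w z] v] pairing_add_left[OF dorfman_sections[OF u v] dorfman_sections[OF z v] w]
      by simp
    show "gen_torsion A H F D u (v + z) w = gen_torsion A H F D u v w + gen_torsion A H F D u z w"
      unfolding T[OF u sections_add[OF v z] w] T[OF u v w] T[OF u z w] a1[OF v u z] a2[OF u v z]
        dorfman_add_right[OF u v z] pairing_add_left[OF cl[OF u v] cl[OF u z] w] pairing_add_left[OF cl[OF v u] cl[OF z u] w]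
        pairing_add_left[OF v z cl[OF w u]] pairing_add_left[OF dorfman_sections[OF u v] dorfman_sections[OF u z] w]
      by simp
    show "gen_torsion A H F D u v (w + z) = gen_torsion A H F D u v w + gen_torsion A H F D u v z"
      unfolding T[OF u v sections_add[OF w z]] T[OF u v w] T[OF u v z] a1[OF w u z]
        pairing_add_right[OF w z cl[OF u v]] pairing_add_right[OF w z cl[OF v u]]
        pairing_add_right[OF w z dorfman_sections[OF u v]] pairing_add_right[OF cl[OF w u] cl[OF z u] v]
      by simp
  }
  assume f: "f \<in> C"
  note uf = anchor_smooth[OF u f] and vf = anchor_smooth[OF v f] and wf = anchor_smooth[OF w f] and B = dorfman_sections[OF u v]
  show "gen_torsion A H F D (smul f u) v w = f * gen_torsion A H F D u v w"
    unfolding T[OF sections_smul[OF u f] v w] T[OF u v w] s1[OF u v f] s2[OF v u f] s2[OF w u f]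
      pairing_dorfman_smul_left[OF v u f w] pairing_smul_left[OF cl[OF u v] w f]
      pairing_add_left[OF sections_smul[OF u vf] sections_smul[OF cl[OF v u] f] w]
      pairing_smul_left[OF u w vf] pairing_smul_left[OF cl[OF v u] w f]
      pairing_add_right[OF sections_smul[OF u wf] sections_smul[OF cl[OF w u] f] v]
      pairing_smul_right[OF u v wf] pairing_smul_right[OF cl[OF w u] v f] pairing_sym[of v u]
    by (simp only: algebra_simps)
  show "gen_torsion A H F D u (smul f v) w = f * gen_torsion A H F D u v w"
    unfolding T[OF u sections_smul[OF v f] w] T[OF u v w] s1[OF v u f] s2[OF u v f]
      dorfman_smul_right[OF u v f] pairing_smul_left[OF cl[OF v u] w f]
      pairing_add_left[OF sections_smul[OF v uf] sections_smul[OF cl[OF u v] f] w]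
      pairing_add_left[OF sections_smul[OF v uf] sections_smul[OF B f] w]
      pairing_smul_left[OF v w uf] pairing_smul_left[OF cl[OF u v] w f] pairing_smul_left[OF B w f]
      pairing_smul_left[OF v cl[OF w u] f]
    by (simp only: algebra_simps)
  show "gen_torsion A H F D u v (smul f w) = f * gen_torsion A H F D u v w"
    unfolding T[OF u v sections_smul[OF w f]] T[OF u v w] s1[OF w u f]
      pairing_smul_right[OF w cl[OF u v] f] pairing_smul_right[OF w cl[OF v u] f]
      pairing_smul_right[OF w B f] pairing_smul_right[OF cl[OF w u] v f]
    by (simp only: algebra_simps)
qed

lemma torsion_zeroI:
  assumes D: "generalized_connection A D"
    and frame: "\<And>B B' B''. B < N \<Longrightarrow> B' < N \<Longrightarrow> B'' < N \<Longrightarrow> gen_torsion A H F D (e B) (e B') (e B'') = 0"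
    and u: "u \<in> sections A" and v: "v \<in> sections A" and w: "w \<in> sections A"
  shows "gen_torsion A H F D u v w = 0"
proof -
  have 1: "gen_torsion A H F D (e B) (e B') z = 0" if B: "B < N" "B' < N" and z: "z \<in> sections A" for B B' z
    by (rule tensor_zero[where \<Psi> = "\<lambda>z. gen_torsion A H F D (e B) (e B') z" and J = "{..<N}"])
      (simp_all add: torsion_tensor[OF D e_section[OF B(1)] e_section[OF B(2)]] frame[OF B] z frame_span_all)
  have 2: "gen_torsion A H F D (e B) z w = 0" if B: "B < N" and z: "z \<in> sections A" for B z
    by (rule tensor_zero[where \<Psi> = "\<lambda>z. gen_torsion A H F D (e B) z w" and J = "{..<N}"])
      (simp_all add: torsion_tensor(2,5)[OF D e_section[OF B] _ w] 1[OF B _ w] z frame_span_all)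
  show ?thesis
    by (rule tensor_zero[where \<Psi> = "\<lambda>z. gen_torsion A H F D z v w" and J = "{..<N}"])
      (simp_all add: torsion_tensor(1,4)[OF D _ v w] 2[OF _ v] u frame_span_all)
qed

text \<open>The connection with Christoffel symbols \<open>G\<close>. The last index of \<open>G\<close> is lowered, whence the
  factor \<open>\<eta> K\<close>.\<close>

definition frame_connection :: "(nat \<Rightarrow> nat \<Rightarrow> nat \<Rightarrow> real) \<Rightarrow> 'g Esec \<Rightarrow> 'g Esec \<Rightarrow> 'g Esec" where
  "frame_connection G u v = (\<Sum>K<N. smul (anchor u (coord v K) +
     (\<Sum>B<N. \<Sum>B'<N. coord u B * coord v B' * (\<lambda>_. \<eta> K * G B B' K))) (e K))"

lemma frame_connection_coeff_smooth:
  assumes u: "u \<in> sections A" and v: "v \<in> sections A" and K: "K < N"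
  shows "anchor u (coord v K) + (\<Sum>B<N. \<Sum>B'<N. coord u B * coord v B' * (\<lambda>_. \<eta> K * G B B' K)) \<in> C"
  by (rule smooth_fns_add[OF anchor_smooth[OF u coord_smooth[OF v K]]], rule smooth_fns_sum, rule smooth_fns_sum)
    (auto intro!: smooth_fns_mult smooth_fns_const coord_smooth u v)

lemma frame_connection_section:
  "u \<in> sections A \<Longrightarrow> v \<in> sections A \<Longrightarrow> frame_connection G u v \<in> sections A"
  unfolding frame_connection_def
  by (rule sections_sum, rule sections_smul[OF e_section frame_connection_coeff_smooth]) simp_all

lemma coord_frame_connection:
  assumes u: "u \<in> sections A" and v: "v \<in> sections A" and K: "K < N"
  shows "coord (frame_connection G u v) K =
    anchor u (coord v K) + (\<Sum>B<N. \<Sum>B'<N. coord u B * coord v B' * (\<lambda>_. \<eta> K * G B B' K))"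
proof -
  let ?f = "\<lambda>K. anchor u (coord v K) + (\<Sum>B<N. \<Sum>B'<N. coord u B * coord v B' * (\<lambda>_. \<eta> K * G B B' K))"
  have "coord (\<Sum>K\<in>{..<N}. smul (?f K) (e K)) K = (if K \<in> {..<N} then ?f K else 0)"
    by (rule coord_combination[where f = ?f, OF subset_refl K]) (simp only: frame_connection_coeff_smooth[OF u v] lessThan_iff)
  then show ?thesis unfolding frame_connection_def using K by simp
qed

lemma frame_connection_frame:
  assumes B: "B < N" and B': "B' < N" and K: "K < N"
  shows "pairing (frame_connection G (e B) (e B')) (e K) = (\<lambda>_. G B B' K)"
proof (rule ext)
  fix p
  note eB = e_section[OF B] and eB' = e_section[OF B']
  have "coord (frame_connection G (e B) (e B')) K p =
      (\<Sum>I<N. \<Sum>I'<N. (if B = I then 1 else 0) * (if B' = I' then 1 else 0) * (\<eta> K * G I I' K))"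
    unfolding coord_frame_connection[OF eB eB' K] coord_frame[OF B' K] vector_fields_const[OF A anchor_field[OF eB]]
      plus_fun_apply zero_fun_apply sum_fun_apply times_fun_apply add_0_left
    by (intro sum.cong refl) (simp add: coord_frame[OF B] coord_frame[OF B'])
  also have "\<dots> = (\<Sum>I<N. \<Sum>I'<N. if B = I then if B' = I' then \<eta> K * G I I' K else 0 else 0)"
    by (intro sum.cong refl) simp
  also have "\<dots> = (\<Sum>I<N. if B = I then (\<Sum>I'<N. if B' = I' then \<eta> K * G I I' K else 0) else 0)"
    by (rule sum.cong) simp_all
  also have "\<dots> = \<eta> K * G B B' K" using B B' by simp
  finally show "pairing (frame_connection G (e B) (e B')) (e K) p = G B B' K"
    using \<eta>_square[OF K] by (simp add: pairing_eq_coord[OF K] mult.assoc[symmetric])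
qed

lemma generalized_connection_frame_connection:
  assumes skew: "\<And>B B' K. B < N \<Longrightarrow> B' < N \<Longrightarrow> K < N \<Longrightarrow> G B K B' = - G B B' K"
  shows "generalized_connection A (frame_connection G)"
  unfolding generalized_connection_def
proof (intro conjI ballI)
  let ?D = "frame_connection G"
  note cl = frame_connection_section[where G = G]
  fix u v assume u: "u \<in> sections A" and v: "v \<in> sections A"
  show "?D u v \<in> sections A" by (rule cl[OF u v])
  {
    fix u' assume u': "u' \<in> sections A"
    show "?D (u + u') v = ?D u v + ?D u' v"
    proof (rule coord_eqI[OF cl[OF sections_add[OF u u'] v] sections_add[OF cl[OF u v] cl[OF u' v]]])
      fix K assume K: "K < N"
      have "(\<Sum>B<N. \<Sum>B'<N. coord (u + u') B * coord v B' * (\<lambda>_. \<eta> K * G B B' K)) =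
        (\<Sum>B<N. \<Sum>B'<N. coord u B * coord v B' * (\<lambda>_. \<eta> K * G B B' K)) + (\<Sum>B<N. \<Sum>B'<N. coord u' B * coord v B' * (\<lambda>_. \<eta> K * G B B' K))"
        unfolding sum.distrib[symmetric]
        by (intro sum.cong refl) (simp only: coord_add[OF u u'] lessThan_iff distrib_right)
      then show "coord (?D (u + u') v) K = coord (?D u v + ?D u' v) K"
        unfolding coord_add[OF cl[OF u v] cl[OF u' v] K] coord_frame_connection[OF u v K] coord_frame_connection[OF u' v K]
          coord_frame_connection[OF sections_add[OF u u'] v K] anchor_add plus_fun_apply[of "anchor u"]
        by (simp only: ac_simps)
    qed
  }
  {
    fix v' assume v': "v' \<in> sections A"
    show "?D u (v + v') = ?D u v + ?D u v'"
    proof (rule coord_eqI[OF cl[OF u sections_add[OF v v']] sections_add[OF cl[OF u v] cl[OF u v']]])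
      fix K assume K: "K < N"
      have "(\<Sum>B<N. \<Sum>B'<N. coord u B * coord (v + v') B' * (\<lambda>_. \<eta> K * G B B' K)) =
        (\<Sum>B<N. \<Sum>B'<N. coord u B * coord v B' * (\<lambda>_. \<eta> K * G B B' K)) + (\<Sum>B<N. \<Sum>B'<N. coord u B * coord v' B' * (\<lambda>_. \<eta> K * G B B' K))"
        unfolding sum.distrib[symmetric]
        by (intro sum.cong refl) (simp only: coord_add[OF v v'] lessThan_iff distrib_right distrib_left)
      then show "coord (?D u (v + v')) K = coord (?D u v + ?D u v') K"
        unfolding coord_add[OF cl[OF u v] cl[OF u v'] K] coord_frame_connection[OF u v K] coord_frame_connection[OF u v' K]
          coord_frame_connection[OF u sections_add[OF v v'] K] coord_add[OF v v' K]
          vector_fields_derivation(1)[OF A anchor_field[OF u] coord_smooth[OF v K] coord_smooth[OF v' K]]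
        by (simp only: ac_simps)
    qed
  }
  {
    fix w assume w: "w \<in> sections A"
    show "anchor u (pairing v w) = pairing (?D u v) w + pairing v (?D u w)"
    proof (rule ext)
      fix p
      note X = anchor_field[OF u]
      have sm: "(\<lambda>_. \<eta> B) * (coord v B * coord w B) \<in> C" "coord v B * coord w B \<in> C" if "B \<in> {..<N}" for B
        using that by (auto intro!: smooth_fns_mult smooth_fns_const coord_smooth v w)
      have "anchor u (pairing v w) = (\<Sum>B<N. anchor u ((\<lambda>_. \<eta> B) * (coord v B * coord w B)))"
        unfolding pairing_coord[OF v w] by (rule field_sum[OF X sm(1)])
      also have "\<dots> = (\<Sum>B<N. (\<lambda>_. \<eta> B) * (anchor u (coord v B) * coord w B + coord v B * anchor u (coord w B)))"
      proof (rule sum.cong[OF refl])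
        fix B assume B: "B \<in> {..<N}"
        then have "B < N" by simp
        show "anchor u ((\<lambda>_. \<eta> B) * (coord v B * coord w B)) = (\<lambda>_. \<eta> B) * (anchor u (coord v B) * coord w B + coord v B * anchor u (coord w B))"
          unfolding field_const_mult[OF X sm(2)[OF B]]
            vector_fields_derivation(2)[OF A X coord_smooth[OF v \<open>B < N\<close>] coord_smooth[OF w \<open>B < N\<close>]] by (rule refl)
      qed
      finally have lhs: "anchor u (pairing v w) p =
          (\<Sum>K<N. \<eta> K * (anchor u (coord v K) p * coord w K p)) + (\<Sum>K<N. \<eta> K * (anchor u (coord w K) p * coord v K p))"
        by (simp add: sum_fun_apply distrib_left sum.distrib mult.commute[of "coord v _ p"])
      have half: "pairing (?D u x) y p = (\<Sum>K<N. \<eta> K * (anchor u (coord x K) p * coord y K p)) +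
          (\<Sum>K<N. \<Sum>B<N. \<Sum>B'<N. coord u B p * (coord x B' p * coord y K p * G B B' K))"
        if x: "x \<in> sections A" and y: "y \<in> sections A" for x y
      proof -
        have "pairing (?D u x) y p = (\<Sum>K<N. \<eta> K * (coord (?D u x) K p * coord y K p))"
          unfolding pairing_coord[OF cl[OF u x] y] by (simp add: sum_fun_apply)
        also have "\<dots> = (\<Sum>K<N. \<eta> K * (anchor u (coord x K) p * coord y K p) +
          (\<Sum>B<N. \<Sum>B'<N. coord u B p * (coord x B' p * coord y K p * G B B' K)))"
        proof (rule sum.cong[OF refl])
          fix K assume "K \<in> {..<N}"
          then have K: "K < N" by simp
          have "\<eta> K * ((\<Sum>B<N. \<Sum>B'<N. coord u B p * coord x B' p * (\<eta> K * G B B' K)) * coord y K p) =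
              (\<Sum>B<N. \<Sum>B'<N. (\<eta> K * \<eta> K) * (coord u B p * (coord x B' p * coord y K p * G B B' K)))"
            by (simp only: sum_distrib_left sum_distrib_right) (simp only: ac_simps)
          also have "\<dots> = (\<Sum>B<N. \<Sum>B'<N. coord u B p * (coord x B' p * coord y K p * G B B' K))"
            by (simp only: \<eta>_square[OF K] mult_1)
          finally show "\<eta> K * (coord (?D u x) K p * coord y K p) = \<eta> K * (anchor u (coord x K) p * coord y K p) +
              (\<Sum>B<N. \<Sum>B'<N. coord u B p * (coord x B' p * coord y K p * G B B' K))"
            unfolding coord_frame_connection[OF u x K] by (simp add: sum_fun_apply distrib_left distrib_right)
        qed
        finally show ?thesis by (simp only: sum.distrib)
      qed
      \<comment> \<open>The zero-order terms cancel since \<open>G\<close> is skew in its last two indices.\<close>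
      have "(\<Sum>K<N. \<Sum>B<N. \<Sum>B'<N. coord u B p * (coord w B' p * coord v K p * G B B' K)) =
          (\<Sum>B<N. \<Sum>K<N. \<Sum>B'<N. coord u B p * (coord w B' p * coord v K p * G B B' K))" by (rule sum.swap)
      also have "\<dots> = (\<Sum>B<N. \<Sum>B'<N. \<Sum>K<N. coord u B p * (coord w B' p * coord v K p * G B B' K))"
        by (rule sum.cong[OF refl], rule sum.swap)
      also have "\<dots> = (\<Sum>B'<N. \<Sum>B<N. \<Sum>K<N. coord u B p * (coord w B' p * coord v K p * G B B' K))" by (rule sum.swap)
      also have "\<dots> = - (\<Sum>K<N. \<Sum>B<N. \<Sum>B'<N. coord u B p * (coord v B' p * coord w K p * G B B' K))"
        unfolding sum_negf[symmetric]
      proof (intro sum.cong refl)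
        fix B' B K assume "B' \<in> {..<N}" "B \<in> {..<N}" "K \<in> {..<N}"
        then have "G B K B' = - G B B' K" by (intro skew) simp_all
        then show "coord u B p * (coord w B' p * coord v K p * G B B' K) = - (coord u B p * (coord v K p * coord w B' p * G B K B'))"
          by simp
      qed
      finally show "anchor u (pairing v w) p = (pairing (?D u v) w + pairing v (?D u w)) p"
        unfolding plus_fun_apply pairing_sym[of v "?D u w"] half[OF v w] half[OF w v] lhs by simp
    qed
  }
next
  let ?D = "frame_connection G"
  note cl = frame_connection_section[where G = G]
  fix f u v assume f: "f \<in> C" and u: "u \<in> sections A" and v: "v \<in> sections A"
  show "?D (smul f u) v = smul f (?D u v)"
  proof (rule coord_eqI[OF cl[OF sections_smul[OF u f] v] sections_smul[OF cl[OF u v] f]])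
    fix K assume K: "K < N"
    have "(\<Sum>B<N. \<Sum>B'<N. coord (smul f u) B * coord v B' * (\<lambda>_. \<eta> K * G B B' K)) =
        f * (\<Sum>B<N. \<Sum>B'<N. coord u B * coord v B' * (\<lambda>_. \<eta> K * G B B' K))"
      unfolding sum_distrib_left
      by (intro sum.cong refl) (simp only: coord_smul[OF u f] lessThan_iff mult.assoc)
    then show "coord (?D (smul f u) v) K = coord (smul f (?D u v)) K"
      unfolding coord_smul[OF cl[OF u v] f K] coord_frame_connection[OF u v K]
        coord_frame_connection[OF sections_smul[OF u f] v K] anchor_smul by (simp only: distrib_left)
  qed
  show "?D u (smul f v) = smul (anchor u f) v + smul f (?D u v)"
  proof (rule coord_eqI[OF cl[OF u sections_smul[OF v f]] sections_add[OF sections_smul[OF v anchor_smooth[OF u f]] sections_smul[OF cl[OF u v] f]]])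
    fix K assume K: "K < N"
    have "(\<Sum>B<N. \<Sum>B'<N. coord u B * coord (smul f v) B' * (\<lambda>_. \<eta> K * G B B' K)) =
        f * (\<Sum>B<N. \<Sum>B'<N. coord u B * coord v B' * (\<lambda>_. \<eta> K * G B B' K))"
      unfolding sum_distrib_left
      by (intro sum.cong refl) (simp only: coord_smul[OF v f] lessThan_iff mult.assoc mult.left_commute[of f])
    then show "coord (?D u (smul f v)) K = coord (smul (anchor u f) v + smul f (?D u v)) K"
      unfolding coord_add[OF sections_smul[OF v anchor_smooth[OF u f]] sections_smul[OF cl[OF u v] f] K]
        coord_smul[OF cl[OF u v] f K] coord_smul[OF v anchor_smooth[OF u f] K] coord_smul[OF v f K] coord_frame_connection[OF u v K]
        coord_frame_connection[OF u sections_smul[OF v f] K]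
        vector_fields_derivation(2)[OF A anchor_field[OF u] f coord_smooth[OF v K]]
      by (simp only: distrib_left ac_simps)
  qed
qed

definition gram :: "nat \<Rightarrow> nat \<Rightarrow> real" where
  "gram B B' = (if B = B' then \<eta> B else 0)"

text \<open>The indices below \<open>m\<close> belong to one summand of \<open>E\<close>, the others to the second one. Symbols that involve
  both summands are dictated by the torsion. Within a summand, \<open>c / 3\<close> has the prescribed torsion since
  \<open>c\<close> is totally skew. The correction has vanishing cyclic sum, so it does not change the torsion.
  In a summand of dimension \<open>n\<close> the trace of \<open>gram B B' * d K - gram B K * d B'\<close> over the first and the last
  index is \<open>(1 - n) d B'\<close>; therefore the divisor \<open>n - 1\<close> produces the divergence \<open>d\<close>.\<close>

definition levi_civita_symbol :: "nat \<Rightarrow> (nat \<Rightarrow> real) \<Rightarrow> nat \<Rightarrow> nat \<Rightarrow> nat \<Rightarrow> real" where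
  "levi_civita_symbol m d B B' K =
    (if (B' < m) \<noteq> (K < m) then 0
     else if (B < m) \<noteq> (K < m) then c B B' K
     else c B B' K / 3 - (gram B B' * d K - gram B K * d B') / (if B < m then real m - 1 else real (N - m) - 1))"

lemma levi_civita_symbol_skew:
  assumes "B < N" "B' < N" "K < N"
  shows "levi_civita_symbol m d B K B' = - levi_civita_symbol m d B B' K"
  using c_swap23[OF assms] unfolding levi_civita_symbol_def by (auto simp: diff_divide_distrib)

lemma levi_civita_symbol_torsion:
  assumes "B < N" "B' < N" "K < N"
  shows "levi_civita_symbol m d B B' K - levi_civita_symbol m d B' B K - c B B' K + levi_civita_symbol m d K B B' = 0"
proof -
  have gram_sym: "gram B' B = gram B B'" "gram K B = gram B K" "gram K B' = gram B' K"
    by (simp_all add: gram_def)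
  have c_perm: "c B' B K = - c B B' K" "c K B B' = c B B' K"
    using c_swap12[OF assms] c_swap23[OF assms] c_swap12[OF assms(1,3,2)] by simp_all
  show ?thesis
    unfolding levi_civita_symbol_def c_perm gram_sym
    by (cases "B < m"; cases "B' < m"; cases "K < m") (simp_all add: diff_divide_distrib)
qed

lemma levi_civita_symbol_trace:
  assumes m: "2 \<le> m" "m + 2 \<le> N" and K: "K < N"
  shows "(\<Sum>B<N. \<eta> B * levi_civita_symbol m d B K B) = d K"
proof -
  have cz: "c B K B = 0" if "B < N" for B
    using c_swap12[OF that that K] c_swap23[OF that that K] by simp
  let ?P = "if K < m then {..<m} else {m..<N}" and ?n = "if K < m then real m - 1 else real (N - m) - 1"
  have n0: "?n \<noteq> 0" using m by auto
  have card: "real (card ?P) = ?n + 1" using m K by auto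
  have "(\<Sum>B<N. \<eta> B * levi_civita_symbol m d B K B) = (\<Sum>B\<in>?P. \<eta> B * levi_civita_symbol m d B K B)"
    using m by (intro sum.mono_neutral_right) (auto simp: levi_civita_symbol_def)
  also have "\<dots> = (\<Sum>B\<in>?P. (d K - (if B = K then d K else 0)) / ?n)"
  proof (rule sum.cong[OF refl])
    fix B assume B: "B \<in> ?P"
    then have BN: "B < N" and same: "(B < m) = (K < m)" using m K by (auto split: if_splits)
    have t1: "\<eta> B * (gram B K * d B) = (if B = K then d K else 0)"
      using \<eta>_square[OF BN] by (auto simp: gram_def mult.assoc[symmetric])
    have t2: "\<eta> B * (gram B B * d K) = d K"
      using \<eta>_square[OF BN] by (simp add: gram_def mult.assoc[symmetric])
    have "x * (0 / 3 - (X - Y) / n) = (x * Y - x * X) / n" for x X Y n :: real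
      by (simp add: diff_divide_distrib right_diff_distrib)
    then show "\<eta> B * levi_civita_symbol m d B K B = (d K - (if B = K then d K else 0)) / ?n"
      unfolding levi_civita_symbol_def using same cz[OF BN] t1 t2 by simp
  qed
  also have "\<dots> = (real (card ?P) * d K - d K) / ?n"
    using K by (simp add: sum_divide_distrib[symmetric] sum_subtractf)
  also have "\<dots> = d K" unfolding card using n0 by (simp add: field_simps)
  finally show ?thesis .
qed

lemma levi_civita_exists:
  assumes m: "2 \<le> m" "m + 2 \<le> N"
    and \<delta>: "divergence_operator A \<delta>" and d: "\<And>B. B < N \<Longrightarrow> \<delta> (e B) = (\<lambda>_. d B)"
  obtains D where "levi_civita A H F (frame_span {m..<N}) D" "\<And>u. u \<in> sections A \<Longrightarrow> connection_divergence A D u = \<delta> u"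
proof -
  let ?G = "levi_civita_symbol m d"
  let ?D = "frame_connection ?G"
  have D: "generalized_connection A ?D"
    by (rule generalized_connection_frame_connection) (rule levi_civita_symbol_skew)
  note cl = generalized_connectionD(1)[OF D]
  have T: "gen_torsion A H F ?D u v w = 0" if "u \<in> sections A" "v \<in> sections A" "w \<in> sections A" for u v w
  proof (rule torsion_zeroI[OF D _ that])
    fix B B' K assume B: "B < N" "B' < N" "K < N"
    note E = e_section[OF B(1)] e_section[OF B(2)] e_section[OF B(3)]
    have "gen_torsion A H F ?D (e B) (e B') (e K) = pairing (?D (e B) (e B')) (e K) - pairing (?D (e B') (e B)) (e K)
      - pairing (dorfman A H F (e B) (e B')) (e K) + pairing (?D (e K) (e B)) (e B')"
      unfolding gen_torsion_def pairing_sym[of "e B'"]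
        pairing_diff_left[OF sections_diff[OF cl[OF E(1,2)] cl[OF E(2,1)]] dorfman_sections[OF E(1,2)] E(3)]
        pairing_diff_left[OF cl[OF E(1,2)] cl[OF E(2,1)] E(3)] by (rule refl)
    then show "gen_torsion A H F ?D (e B) (e B') (e K) = 0"
      unfolding frame_connection_frame[OF B] frame_connection_frame[OF B(2,1,3)] frame_connection_frame[OF B(3,1,2)] e_bracket[OF B]
      using levi_civita_symbol_torsion[OF B, of m d] by (simp add: fun_eq_iff)
  qed
  have pres: "?D u w \<in> frame_span {m..<N}" if u: "u \<in> sections A" and w: "w \<in> frame_span {m..<N}" for u w
  proof (rule frame_spanI)
    note ws = frame_span_section[OF w]
    show "?D u w \<in> sections A" by (rule cl[OF u ws])
    fix K assume K: "K < N" "K \<notin> {m..<N}"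
    have wz: "coord w B = 0" if "B < N" "B \<notin> {m..<N}" for B by (rule coord_zero[OF frame_span_pairing[OF w that]])
    have "(\<Sum>B<N. \<Sum>B'<N. coord u B * coord w B' * (\<lambda>_. \<eta> K * ?G B B' K)) = 0"
    proof (intro sum.neutral ballI)
      fix B B' assume "B' \<in> {..<N}"
      then have "coord w B' = 0 \<or> ?G B B' K = 0" using K wz[of B'] by (cases "B' < m") (auto simp: levi_civita_symbol_def)
      then show "coord u B * coord w B' * (\<lambda>_. \<eta> K * ?G B B' K) = 0" by (auto simp: fun_eq_iff)
    qed
    then have "coord (?D u w) K = 0"
      unfolding coord_frame_connection[OF u ws K(1)] wz[OF K] field_zero_fun[OF anchor_field[OF u]] by simp
    then show "pairing (?D u w) (e K) = 0"
      by (intro ext) (simp add: pairing_eq_coord[OF K(1)])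
  qed
  have "connection_divergence A ?D u = \<delta> u" if u: "u \<in> sections A" for u
  proof (rule divergence_eqI[OF D \<delta> _ u])
    fix K assume K: "K < N"
    have "(\<Sum>B<N. coord (?D (e B) (e K)) B) = (\<Sum>B<N. (\<lambda>_. \<eta> B * ?G B K B))"
      by (rule sum.cong[OF refl]) (simp only: coord_def lessThan_iff frame_connection_frame[OF _ K] const_fun_simps)
    then show "connection_divergence A ?D (e K) = \<delta> (e K)"
      unfolding divergence_trace[OF D e_section[OF K]] d[OF K] using levi_civita_symbol_trace[OF m K, of d]
      by (simp add: fun_eq_iff sum_fun_apply)
  qed
  moreover have "levi_civita A H F (frame_span {m..<N}) ?D"
    unfolding levi_civita_def using D T pres by blast
  ultimately show ?thesis using that by blast
qed

end

section \<open>The Einstein condition in terms of structure constants\<close>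

text \<open>The formula of \<open>ricci_frame\<close> for the Ricci tensor with trace over the summand of \<open>J\<close>.\<close>

definition ricci_coeff :: "(nat \<Rightarrow> real) \<Rightarrow> (nat \<Rightarrow> nat \<Rightarrow> nat \<Rightarrow> real) \<Rightarrow> (nat \<Rightarrow> real) \<Rightarrow> nat set \<Rightarrow> nat set \<Rightarrow> nat \<Rightarrow> nat \<Rightarrow> real" where
  "ricci_coeff N c d J J' a i =
    (\<Sum>k\<in>J. N k * c a i k * d k) - (\<Sum>j\<in>J. \<Sum>b\<in>J'. N j * N b * c j a b * c b i j)"

context courant_frame
begin

lemma orth_compl_frame_span:
  assumes "J \<union> J' = {..<N}" "J \<inter> J' = {}"
  shows "orth_compl A (frame_span J) = frame_span J'"
proof (intro set_eqI iffI)
  fix u assume "u \<in> orth_compl A (frame_span J)"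
  then have u: "u \<in> sections A" "\<And>w. w \<in> frame_span J \<Longrightarrow> pairing u w = 0" unfolding orth_compl_def by auto
  show "u \<in> frame_span J'"
  proof (rule frame_spanI[OF u(1)])
    fix B assume "B < N" "B \<notin> J'"
    then have "B \<in> J" using assms(1) by auto
    then show "pairing u (e B) = 0" using \<open>B < N\<close> by (intro u(2) e_frame_span)
  qed
next
  fix u assume u: "u \<in> frame_span J'"
  have "pairing u w = 0" if w: "w \<in> frame_span J" for w
    unfolding pairing_coord[OF frame_span_section[OF u] frame_span_section[OF w]]
  proof (rule sum.neutral, rule ballI)
    fix B assume "B \<in> {..<N}"
    then have "coord u B = 0 \<or> coord w B = 0"
      using coord_zero[OF frame_span_pairing[OF u]] coord_zero[OF frame_span_pairing[OF w]] assms(2) by blast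
    then show "(\<lambda>_. \<eta> B) * (coord u B * coord w B) = 0" by auto
  qed
  then show "u \<in> orth_compl A (frame_span J)" unfolding orth_compl_def using frame_span_section[OF u] by blast
qed

end

lemma (in adapted_connection) divergence_frame:
  assumes "B \<in> J"
  shows "connection_divergence A D (e B) = (\<Sum>j\<in>J. (\<lambda>_. \<eta> j) * \<Gamma> j B j)"
proof -
  note B = J_less(1)[OF assms]
  have "connection_divergence A D (e B) = (\<Sum>j<N. coord (D (e j) (e B)) j)"
    by (rule divergence_trace[OF D e_section[OF B]])
  also have "\<dots> = (\<Sum>j\<in>J. coord (D (e j) (e B)) j)"
  proof (rule sum.mono_neutral_right)
    show "\<forall>j\<in>{..<N} - J. coord (D (e j) (e B)) j = 0"
      using coord_zero[OF frame_span_pairing[OF preserves[OF e_section e_frame_span[OF B assms]]]] by blast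
  qed (use J_subset in auto)
  finally show ?thesis unfolding coord_def \<Gamma>_def .
qed

lemma (in adapted_connection) ricci_frame_coeff:
  assumes J: "J = {k..<k + n}" "k + n \<le> N"
    and \<delta>: "\<And>B. B < N \<Longrightarrow> connection_divergence A D (e B) = (\<lambda>_. d B)"
    and "a \<in> J'" "i \<in> J"
  shows "ricci A H F D (frame_span J) (e a) (e i) = (\<lambda>_. ricci_coeff \<eta> c d J J' a i)"
  unfolding ricci_coeff_def
  by (rule ricci_frame[OF J _ assms(4,5)]) (simp only: divergence_frame[symmetric] \<delta> J_less)

context courant_frame
begin

text \<open>By \<open>ricci_frame\<close> all Levi-Civita connections with divergence \<open>\<delta>\<close> have the same Ricci tensors on the
  frame. In one direction this evaluates the given connection, in the other one the connection
  constructed above.\<close>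

theorem einstein_iff:
  assumes m: "2 \<le> m" "m + 2 \<le> N"
    and \<delta>: "divergence_operator A \<delta>" and d: "\<And>B. B < N \<Longrightarrow> \<delta> (e B) = (\<lambda>_. d B)"
  shows "generalized_einstein A H F (frame_span {m..<N}) \<delta> \<longleftrightarrow>
    (\<forall>a\<in>{m..<N}. \<forall>i\<in>{..<m}. ricci_coeff \<eta> c d {..<m} {m..<N} a i = 0 \<and> ricci_coeff \<eta> c d {m..<N} {..<m} i a = 0)"
    (is "?E \<longleftrightarrow> ?R")
proof -
  let ?P = "{..<m}" and ?M = "{m..<N}"
  have PM: "?P \<union> ?M = {..<N}" "?P \<inter> ?M = {}" "?M \<union> ?P = {..<N}" "?M \<inter> ?P = {}" using m by auto
  have Pi: "?P = {0..<0 + m}" "0 + m \<le> N" and Mi: "?M = {m..<m + (N - m)}" "m + (N - m) \<le> N" using m by auto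
  have orth: "orth_compl A (frame_span ?M) = frame_span ?P" by (rule orth_compl_frame_span[OF PM(3,4)])
  have eP: "e i \<in> frame_span ?P" if "i \<in> ?P" for i using that m by (intro e_frame_span) auto
  have eM: "e a \<in> frame_span ?M" if "a \<in> ?M" for a using that by (intro e_frame_span) auto
  have adapted: "adapted_connection A H F N e \<eta> c D ?M ?P \<and> adapted_connection A H F N e \<eta> c D ?P ?M"
    if lc: "levi_civita A H F (frame_span ?M) D" for D
  proof -
    note l = lc[unfolded levi_civita_def]
    have 1: "generalized_connection A D" using l by (elim conjE)
    have 2: "gen_torsion A H F D u v w = 0" if "u \<in> sections A" "v \<in> sections A" "w \<in> sections A" for u v w
      by (rule bspec[OF bspec[OF bspec[OF l[THEN conjunct2, THEN conjunct1] that(1)] that(2)] that(3)])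
    have 3: "D u v \<in> frame_span ?M" if "u \<in> sections A" "v \<in> frame_span ?M" for u v
      by (rule bspec[OF bspec[OF l[THEN conjunct2, THEN conjunct2] that(1)] that(2)])
    interpret M: adapted_connection A H F N e \<eta> c D ?M ?P
      by unfold_locales (rule 1 | rule 2; assumption | rule PM | rule 3; assumption)+
    have "adapted_connection A H F N e \<eta> c D ?P ?M"
      by unfold_locales (rule 1 | rule 2; assumption | rule PM | rule M.preserves'; assumption)+
    then show ?thesis using M.adapted_connection_axioms by blast
  qed
  show ?thesis
  proof
    assume ?E
    then obtain D where lc: "levi_civita A H F (frame_span ?M) D"
      and dv: "\<And>u. u \<in> sections A \<Longrightarrow> connection_divergence A D u = \<delta> u"
      and r1: "\<And>u v. u \<in> frame_span ?M \<Longrightarrow> v \<in> frame_span ?P \<Longrightarrow> ricci A H F D (frame_span ?P) u v = 0"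
      and r2: "\<And>u v. u \<in> frame_span ?P \<Longrightarrow> v \<in> frame_span ?M \<Longrightarrow> ricci A H F D (frame_span ?M) u v = 0"
      unfolding generalized_einstein_def orth by blast
    interpret M: adapted_connection A H F N e \<eta> c D ?M ?P using adapted[OF lc] by blast
    interpret P: adapted_connection A H F N e \<eta> c D ?P ?M using adapted[OF lc] by blast
    have dvf: "connection_divergence A D (e B) = (\<lambda>_. d B)" if "B < N" for B
      using dv[OF e_section[OF that]] d[OF that] by (rule trans)
    show ?R
    proof (intro ballI conjI)
      fix a i assume a: "a \<in> ?M" and i: "i \<in> ?P"
      have "(\<lambda>_. ricci_coeff \<eta> c d ?P ?M a i) = (0 :: 'g sfun)"
        using P.ricci_frame_coeff[OF Pi dvf a i] r1[OF eM[OF a] eP[OF i]] by (simp only:)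
      from fun_cong[OF this, of undefined] show "ricci_coeff \<eta> c d ?P ?M a i = 0" by simp
      have "(\<lambda>_. ricci_coeff \<eta> c d ?M ?P i a) = (0 :: 'g sfun)"
        using M.ricci_frame_coeff[OF Mi dvf i a] r2[OF eP[OF i] eM[OF a]] by (simp only:)
      from fun_cong[OF this, of undefined] show "ricci_coeff \<eta> c d ?M ?P i a = 0" by simp
    qed
  next
    assume R: ?R
    obtain D where lc: "levi_civita A H F (frame_span ?M) D"
      and dv: "\<And>u. u \<in> sections A \<Longrightarrow> connection_divergence A D u = \<delta> u"
      by (rule levi_civita_exists[OF m \<delta> d]) blast+
    interpret M: adapted_connection A H F N e \<eta> c D ?M ?P using adapted[OF lc] by blast
    interpret P: adapted_connection A H F N e \<eta> c D ?P ?M using adapted[OF lc] by blast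
    have dvf: "connection_divergence A D (e B) = (\<lambda>_. d B)" if "B < N" for B
      using dv[OF e_section[OF that]] d[OF that] by (rule trans)
    have f1: "ricci A H F D (frame_span ?P) (e a) (e i) = 0" if "a \<in> ?M" "i \<in> ?P" for a i
    proof -
      have "ricci A H F D (frame_span ?P) (e a) (e i) = (\<lambda>_. ricci_coeff \<eta> c d ?P ?M a i)"
        by (rule P.ricci_frame_coeff[OF Pi dvf that])
      also have "\<dots> = 0" using bspec[OF bspec[OF R that(1)] that(2)] by (simp add: fun_eq_iff)
      finally show ?thesis .
    qed
    have f2: "ricci A H F D (frame_span ?M) (e i) (e a) = 0" if "i \<in> ?P" "a \<in> ?M" for a i
    proof -
      have "ricci A H F D (frame_span ?M) (e i) (e a) = (\<lambda>_. ricci_coeff \<eta> c d ?M ?P i a)"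
        by (rule M.ricci_frame_coeff[OF Mi dvf that])
      also have "\<dots> = 0" using bspec[OF bspec[OF R that(2)] that(1)] by (simp add: fun_eq_iff)
      finally show ?thesis .
    qed
    have "ricci A H F D (frame_span ?P) u v = 0" if "u \<in> frame_span ?M" "v \<in> frame_span ?P" for u v
      by (rule P.ricci_zeroI[OF Pi f1 that])
    moreover have "ricci A H F D (frame_span ?M) u v = 0" if "u \<in> frame_span ?P" "v \<in> frame_span ?M" for u v
      by (rule M.ricci_zeroI[OF Mi f2 that])
    ultimately show ?E unfolding generalized_einstein_def orth using lc dv by blast
  qed
qed

end

section \<open>The frame of a left-invariant pseudo-Riemannian metric\<close>

lemma one_form_zero:
  assumes A: "smooth_atlas A" and \<xi>: "\<xi> \<in> one_forms A" shows "\<xi> 0 = 0"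
  using one_formsD(2)[OF \<xi> vector_fields_0[OF A] vector_fields_0[OF A]] by simp

lemma two_form_zero:
  assumes A: "smooth_atlas A" and F: "F \<in> two_forms A" shows "F 0 Y = 0"
proof (cases "Y \<in> vector_fields A")
  case True
  show ?thesis unfolding two_formsD(3)[OF F vector_fields_0[OF A] True]
      one_form_zero[OF A two_formsD(1)[OF F True]] by simp
qed (rule one_formsD(4)[OF two_formsD(1)[OF F vector_fields_0[OF A]]])

text \<open>For \<open>B > 0\<close> the frame element \<open>e B\<close> is \<open>v x + \<sigma> g (v x)\<close> with \<open>x = frame_index B\<close> and
  \<open>\<sigma> = frame_sign B\<close>.\<close>

definition frame_index :: "nat \<Rightarrow> nat" where "frame_index B = (if B \<le> 3 then B else B - 3)"
definition frame_sign :: "nat \<Rightarrow> real" where "frame_sign B = (if B \<le> 3 then 1 else - 1)"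

text \<open>The scalar squares of \<open>e 0, \<dots>, e 6\<close>.\<close>

definition frame_norm :: "(nat \<Rightarrow> real) \<Rightarrow> nat \<Rightarrow> real" where
  "frame_norm \<epsilon> B = (if B = 0 then 1 else frame_sign B * \<epsilon> (frame_index B))"

text \<open>The scalar product of \<open>[e B, e B']\<close> with \<open>e B''\<close>, where \<open>b x y z\<close> stands for \<open>g([v x, v y], v z)\<close> and
  \<open>Hc\<close>, \<open>Fc\<close> are the components of \<open>H\<close> and \<open>F\<close>.\<close>

definition frame_coeff :: "(nat \<Rightarrow> nat \<Rightarrow> nat \<Rightarrow> real) \<Rightarrow> (nat \<Rightarrow> nat \<Rightarrow> nat \<Rightarrow> real) \<Rightarrow> (nat \<Rightarrow> nat \<Rightarrow> real) \<Rightarrow> nat \<Rightarrow> nat \<Rightarrow> nat \<Rightarrow> real" where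
  "frame_coeff b Hc Fc B B' B'' = (let x = frame_index B; y = frame_index B'; z = frame_index B'' in
    if B = 0 then (if B' = 0 \<or> B'' = 0 then 0 else Fc y z)
    else if B' = 0 then (if B'' = 0 then 0 else Fc z x)
    else if B'' = 0 then Fc x y
    else (frame_sign B'' * b x y z + frame_sign B' * b z x y + frame_sign B * b y z x - Hc x y z) / 2)"

text \<open>\<open>K x y z\<close> is the coefficient of \<open>v z\<close> in \<open>[v x, v y]\<close>.\<close>

locale metric_frame = lie_group_frame mul unit ginv A v
  for mul :: "'g::{t2_space, second_countable_topology} \<Rightarrow> 'g \<Rightarrow> 'g"
    and unit :: 'g and ginv :: "'g \<Rightarrow> 'g" and A :: "('g, real^3) atlas"
    and v :: "nat \<Rightarrow> 'g vfield" +
  fixes g :: "'g vfield \<Rightarrow> 'g oneform" and \<epsilon> :: "nat \<Rightarrow> real"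
    and K :: "nat \<Rightarrow> nat \<Rightarrow> nat \<Rightarrow> real"
    and H :: "'g threeform" and Hc :: "nat \<Rightarrow> nat \<Rightarrow> nat \<Rightarrow> real"
    and F :: "'g twoform" and Fc :: "nat \<Rightarrow> nat \<Rightarrow> real"
  assumes g: "pseudo_riemannian_metric A g"
    and orthonormal: "a \<in> {1..3} \<Longrightarrow> b \<in> {1..3} \<Longrightarrow> g (v a) (v b) = (\<lambda>_. if a = b then \<epsilon> a else 0)"
    and \<epsilon>_square: "a \<in> {1..3} \<Longrightarrow> \<epsilon> a * \<epsilon> a = 1"
    and bracket: "a \<in> {1..3} \<Longrightarrow> b \<in> {1..3} \<Longrightarrow> vbracket (v a) (v b) = lincomb3 (K a b) v"
    and K_skew: "K b a z = - K a b z"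
    and H: "H \<in> three_forms A"
    and H_frame: "a \<in> {1..3} \<Longrightarrow> b \<in> {1..3} \<Longrightarrow> z \<in> {1..3} \<Longrightarrow> H (v a) (v b) (v z) = (\<lambda>_. Hc a b z)"
    and Hc_skew: "Hc b a z = - Hc a b z" "Hc a z b = - Hc a b z"
    and F: "F \<in> two_forms A"
    and F_frame: "a \<in> {1..3} \<Longrightarrow> b \<in> {1..3} \<Longrightarrow> F (v a) (v b) = (\<lambda>_. Fc a b)"
    and Fc_skew: "a \<in> {1..3} \<Longrightarrow> b \<in> {1..3} \<Longrightarrow> Fc b a = - Fc a b"
begin

lemma in13: "1 \<in> {1..3::nat}" "2 \<in> {1..3::nat}" "3 \<in> {1..3::nat}" by auto

lemma g_form: "X \<in> vector_fields A \<Longrightarrow> g X \<in> one_forms A"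
  and g_sym: "X \<in> vector_fields A \<Longrightarrow> Y \<in> vector_fields A \<Longrightarrow> g X Y = g Y X"
  using g unfolding pseudo_riemannian_metric_def by (elim conjE; blast)+

lemma form_lincomb3:
  assumes \<xi>: "\<xi> \<in> one_forms A"
  shows "\<xi> (lincomb3 x v) = (\<lambda>_. x 1) * \<xi> (v 1) + (\<lambda>_. x 2) * \<xi> (v 2) + (\<lambda>_. x 3) * \<xi> (v 3)"
proof -
  note V = vector_fields_smul[OF A v_field[OF in13(1)] smooth_fns_const] vector_fields_smul[OF A v_field[OF in13(2)] smooth_fns_const]
    vector_fields_smul[OF A v_field[OF in13(3)] smooth_fns_const]
  show ?thesis unfolding lincomb3_eq one_formsD(2)[OF \<xi> vector_fields_add[OF A V(1) V(2)] V(3)] one_formsD(2)[OF \<xi> V(1) V(2)]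
      one_formsD(3)[OF \<xi> smooth_fns_const v_field[OF in13(1)]] one_formsD(3)[OF \<xi> smooth_fns_const v_field[OF in13(2)]]
      one_formsD(3)[OF \<xi> smooth_fns_const v_field[OF in13(3)]] by (rule refl)
qed

lemma g_bracket:
  assumes "x \<in> {1..3}" "y \<in> {1..3}" "z \<in> {1..3}"
  shows "g (v z) (vbracket (v x) (v y)) = (\<lambda>_. \<epsilon> z * K x y z)"
  unfolding bracket[OF assms(1,2)] form_lincomb3[OF g_form[OF v_field[OF assms(3)]]]
    orthonormal[OF assms(3) in13(1)] orthonormal[OF assms(3) in13(2)] orthonormal[OF assms(3) in13(3)]
  using assms(3) unfolding in_1_3 by (auto simp: fun_eq_iff)

definition field_coord :: "'g vfield \<Rightarrow> nat \<Rightarrow> 'g sfun" where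
  "field_coord X a = (\<lambda>_. \<epsilon> a) * g X (v a)"

lemma field_coord_smooth: "X \<in> vector_fields A \<Longrightarrow> a \<in> {1..3} \<Longrightarrow> field_coord X a \<in> smooth_fns A"
  unfolding field_coord_def by (intro smooth_fns_mult smooth_fns_const one_formsD(1)[OF g_form] v_field)

text \<open>The difference of the two sides is orthogonal to the frame.\<close>

lemma field_expand:
  assumes X: "X \<in> vector_fields A"
  shows "X = (\<lambda>k. field_coord X 1 * v 1 k) + (\<lambda>k. field_coord X 2 * v 2 k) + (\<lambda>k. field_coord X 3 * v 3 k)"
proof -
  have neg: "- field_coord X a \<in> smooth_fns A" if "a \<in> {1..3}" for a
    by (rule smooth_fns_uminus[OF field_coord_smooth[OF X that]])
  let ?Z = "\<lambda>a k. - field_coord X a * v a k"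
  have Z: "?Z a \<in> vector_fields A" if "a \<in> {1..3}" for a
    by (rule vector_fields_smul[OF A v_field[OF that] neg[OF that]])
  let ?Y = "X + ?Z 1 + ?Z 2 + ?Z 3"
  note s1 = vector_fields_add[OF A X Z[OF in13(1)]]
  note s2 = vector_fields_add[OF A s1 Z[OF in13(2)]]
  note Y = vector_fields_add[OF A s2 Z[OF in13(3)]]
  have "?Y = 0"
  proof (rule field_zero_if_orthogonal_to_frame[OF g Y])
    fix b :: nat assume b: "b \<in> {1..3}"
    note gb = g_form[OF v_field[OF b]]
    have "g ?Y (v b) = g (v b) ?Y" by (rule g_sym[OF Y v_field[OF b]])
    also have "\<dots> = g (v b) X + - field_coord X 1 * g (v b) (v 1) + - field_coord X 2 * g (v b) (v 2) + - field_coord X 3 * g (v b) (v 3)"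
      unfolding one_formsD(2)[OF gb s2 Z[OF in13(3)]] one_formsD(2)[OF gb s1 Z[OF in13(2)]] one_formsD(2)[OF gb X Z[OF in13(1)]]
        one_formsD(3)[OF gb neg[OF in13(1)] v_field[OF in13(1)]] one_formsD(3)[OF gb neg[OF in13(2)] v_field[OF in13(2)]]
        one_formsD(3)[OF gb neg[OF in13(3)] v_field[OF in13(3)]] by (rule refl)
    also have "\<dots> = 0"
    proof (rule ext)
      fix p
      have "\<epsilon> b * g X (v b) p * \<epsilon> b = g X (v b) p"
        using \<epsilon>_square[OF b] by (simp add: mult.commute mult.left_commute)
      then show "(g (v b) X + - field_coord X 1 * g (v b) (v 1) + - field_coord X 2 * g (v b) (v 2) + - field_coord X 3 * g (v b) (v 3)) p = 0 p"
        unfolding orthonormal[OF b in13(1)] orthonormal[OF b in13(2)] orthonormal[OF b in13(3)] field_coord_def g_sym[OF v_field[OF b] X]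
        using b unfolding in_1_3 by auto
    qed
    finally show "g ?Y (v b) = 0" .
  qed
  then have "?Y k p = 0" for k p by simp
  then have *: "X k p - field_coord X 1 p * v 1 k p - field_coord X 2 p * v 2 k p - field_coord X 3 p * v 3 k p = 0" for k p
    unfolding plus_fun_apply times_fun_apply uminus_apply by (simp only: mult_minus_left add_uminus_conv_diff)
  show ?thesis
  proof (intro ext)
    fix k p
    show "X k p = ((\<lambda>k. field_coord X 1 * v 1 k) + (\<lambda>k. field_coord X 2 * v 2 k) + (\<lambda>k. field_coord X 3 * v 3 k)) k p"
      using *[of k p] unfolding plus_fun_apply times_fun_apply by linarith
  qed
qed

lemma form_expand:
  assumes \<xi>: "\<xi> \<in> one_forms A" and X: "X \<in> vector_fields A"
  shows "\<xi> X = field_coord X 1 * \<xi> (v 1) + field_coord X 2 * \<xi> (v 2) + field_coord X 3 * \<xi> (v 3)"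
proof -
  have V: "(\<lambda>k. field_coord X a * v a k) \<in> vector_fields A" if "a \<in> {1..3}" for a
    by (rule vector_fields_smul[OF A v_field[OF that] field_coord_smooth[OF X that]])
  have "\<xi> X = \<xi> ((\<lambda>k. field_coord X 1 * v 1 k) + (\<lambda>k. field_coord X 2 * v 2 k) + (\<lambda>k. field_coord X 3 * v 3 k))"
    by (rule arg_cong[OF field_expand[OF X]])
  then show ?thesis
    unfolding one_formsD(2)[OF \<xi> vector_fields_add[OF A V[OF in13(1)] V[OF in13(2)]] V[OF in13(3)]]
      one_formsD(2)[OF \<xi> V[OF in13(1)] V[OF in13(2)]] one_formsD(3)[OF \<xi> field_coord_smooth[OF X in13(1)] v_field[OF in13(1)]]
      one_formsD(3)[OF \<xi> field_coord_smooth[OF X in13(2)] v_field[OF in13(2)]] one_formsD(3)[OF \<xi> field_coord_smooth[OF X in13(3)] v_field[OF in13(3)]] .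
qed

text \<open>Brackets of frame fields are left-invariant fields; the Leibniz rule extends this to combinations
  with smooth coefficients.\<close>

lemma vbracket_field:
  assumes X: "X \<in> vector_fields A" and Y: "Y \<in> vector_fields A"
  shows "vbracket X Y \<in> vector_fields A"
proof -
  have VV: "vbracket (v a) (v b) \<in> vector_fields A" if "a \<in> {1..3}" "b \<in> {1..3}" for a b
    unfolding bracket[OF that] using lincomb3_lie_algebra[of "K a b"] unfolding lie_algebra_def by blast
  have fV: "(\<lambda>k. field_coord Z b * v b k) \<in> vector_fields A" if "Z \<in> vector_fields A" "b \<in> {1..3}" for b Z
    by (rule vector_fields_smul[OF A v_field[OF that(2)] field_coord_smooth[OF that]])
  have vY: "vbracket (v a) Y \<in> vector_fields A" if a: "a \<in> {1..3}" for a
  proof -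
    have *: "vbracket (v a) (\<lambda>k. field_coord Y b * v b k) \<in> vector_fields A" if b: "b \<in> {1..3}" for b
      unfolding vbracket_smul_right[OF A v_field[OF a] v_field[OF b] field_coord_smooth[OF Y b]]
      by (rule vector_fields_add[OF A vector_fields_smul[OF A VV[OF a b] field_coord_smooth[OF Y b]]
            vector_fields_smul[OF A v_field[OF b] vector_fields_smooth[OF v_field[OF a] field_coord_smooth[OF Y b]]]])
    have "vbracket (v a) Y = vbracket (v a) ((\<lambda>k. field_coord Y 1 * v 1 k) + (\<lambda>k. field_coord Y 2 * v 2 k) + (\<lambda>k. field_coord Y 3 * v 3 k))"
      by (rule arg_cong[OF field_expand[OF Y]])
    also have "\<dots> \<in> vector_fields A"
      unfolding vbracket_add_right[OF A v_field[OF a] vector_fields_add[OF A fV[OF Y in13(1)] fV[OF Y in13(2)]] fV[OF Y in13(3)]]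
        vbracket_add_right[OF A v_field[OF a] fV[OF Y in13(1)] fV[OF Y in13(2)]]
      by (intro vector_fields_add[OF A] * in13)
    finally show ?thesis .
  qed
  have *: "vbracket (\<lambda>k. field_coord X b * v b k) Y \<in> vector_fields A" if b: "b \<in> {1..3}" for b
    unfolding vbracket_smul_left[OF A Y v_field[OF b] field_coord_smooth[OF X b]]
    by (rule vector_fields_add[OF A vector_fields_smul[OF A vY[OF b] field_coord_smooth[OF X b]]
          vector_fields_smul[OF A v_field[OF b] smooth_fns_uminus[OF vector_fields_smooth[OF Y field_coord_smooth[OF X b]]]]])
  have "vbracket X Y = vbracket ((\<lambda>k. field_coord X 1 * v 1 k) + (\<lambda>k. field_coord X 2 * v 2 k) + (\<lambda>k. field_coord X 3 * v 3 k)) Y"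
    by (rule arg_cong[OF field_expand[OF X], of "\<lambda>X. vbracket X Y"])
  also have "\<dots> \<in> vector_fields A"
    unfolding vbracket_add_left[OF A Y vector_fields_add[OF A fV[OF X in13(1)] fV[OF X in13(2)]] fV[OF X in13(3)]]
      vbracket_add_left[OF A Y fV[OF X in13(1)] fV[OF X in13(2)]]
    by (intro vector_fields_add[OF A] * in13)
  finally show ?thesis .
qed

sublocale courant_algebroid A H F
  by unfold_locales (rule A vbracket_field H F; assumption?)+

abbreviation "E \<equiv> frame_e g v"

lemma E_0: "E 0 = (0, 0, 1)"
  by (simp add: frame_e_def)

lemma E_pos:
  assumes "B \<noteq> 0"
  shows "E B = (v (frame_index B), (\<lambda>Z. (\<lambda>_. frame_sign B) * g (v (frame_index B)) Z), 0)"
  using assms by (simp add: frame_e_def frame_index_def frame_sign_def fun_eq_iff)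

lemma frame_index_in: "B \<noteq> 0 \<Longrightarrow> B < 7 \<Longrightarrow> frame_index B \<in> {1..3}"
  by (auto simp: frame_index_def)

lemma E_section:
  assumes "B < 7" shows "E B \<in> sections A"
proof (cases "B = 0")
  case True
  then show ?thesis unfolding True E_0 sections_iff
    by (intro conjI vector_fields_0[OF A] one_forms_0 smooth_fns_1)
next
  case False
  note v = v_field[OF frame_index_in[OF False assms]]
  show ?thesis unfolding E_pos[OF False] sections_iff
    by (intro conjI v one_forms_smul g_form smooth_fns_const smooth_fns_0)
qed

lemma pairing_E_0: "(X, \<xi>, l) \<in> sections A \<Longrightarrow> pairing (X, \<xi>, l) (E 0) = l"
  unfolding E_0 sections_iff by (rule ext) (simp add: one_form_zero[OF A])

lemma pairing_E_pos:
  assumes "B \<noteq> 0"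
  shows "pairing (X, \<xi>, l) (E B) = (\<lambda>p. (\<xi> (v (frame_index B)) p + frame_sign B * g (v (frame_index B)) X p) / 2)"
  unfolding E_pos[OF assms] by (rule ext) simp

lemma E_pairing:
  assumes B: "B < 7" and B': "B' < 7"
  shows "pairing (E B) (E B') = (\<lambda>_. if B = B' then frame_norm \<epsilon> B else 0)"
proof (cases "B' = 0")
  case True
  show ?thesis
  proof (cases "B = 0")
    case True
    then show ?thesis using \<open>B' = 0\<close> pairing_E_0[OF E_section[OF B, unfolded True E_0]] unfolding E_0[symmetric]
      by (simp add: frame_norm_def fun_eq_iff)
  next
    case False
    then show ?thesis using \<open>B' = 0\<close> pairing_E_0[OF E_section[OF B, unfolded E_pos[OF False]]] unfolding E_pos[OF False, symmetric]
      by (simp add: fun_eq_iff)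
  qed
next
  case B'0: False
  note i' = frame_index_in[OF B'0 B']
  show ?thesis
  proof (cases "B = 0")
    case True
    show ?thesis unfolding True E_0 pairing_E_pos[OF B'0] one_form_zero[OF A g_form[OF v_field[OF i']]]
      using B'0 by (simp add: fun_eq_iff)
  next
    case False
    note i = frame_index_in[OF False B]
    show ?thesis unfolding E_pos[OF False] pairing_E_pos[OF B'0] orthonormal[OF i i'] orthonormal[OF i' i]
      using B B' False B'0 by (auto simp: fun_eq_iff frame_norm_def frame_index_def frame_sign_def split: if_splits)
  qed
qed

lemma sum_less_7: "(\<Sum>B<7. f B) = f 0 + (f 1 + (f 2 + (f 3 + (f 4 + (f 5 + f (6::nat))))))"
proof -
  have "{..<7::nat} = {0, 1, 2, 3, 4, 5, 6}" by auto
  then show ?thesis by simp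
qed

text \<open>The elements \<open>e a\<close> and \<open>e (a + 3)\<close> contribute half the sum and half the difference of the components
  of the vector field and of the one-form along \<open>v a\<close>.\<close>

lemma E_expand:
  assumes u: "u \<in> sections A"
  shows "u = (\<Sum>B<7. smul ((\<lambda>_. frame_norm \<epsilon> B) * pairing u (E B)) (E B))"
proof -
  obtain X \<xi> l where ueq: "u = (X, \<xi>, l)" by (rule prod_cases3)
  have X: "X \<in> V" and x: "\<xi> \<in> one_forms A" and l: "l \<in> C" using u unfolding ueq sections_iff by auto
  define w where "w B = (\<lambda>_. frame_norm \<epsilon> B) * pairing u (E B)" for B
  have w0: "w 0 = l" unfolding w_def ueq pairing_E_0[OF u[unfolded ueq]] by (simp add: frame_norm_def fun_eq_iff)
  have w: "w a p = \<epsilon> a * (\<xi> (v a) p + g X (v a) p) / 2" "w (a + 3) p = - \<epsilon> a * (\<xi> (v a) p - g X (v a) p) / 2"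
    if a: "a \<in> {1..3}" for a p
    using a unfolding w_def ueq g_sym[OF X v_field[OF a]]
    by (auto simp: pairing_E_pos frame_norm_def frame_index_def frame_sign_def)
  have E: "E 1 = (v 1, g (v 1), 0)" "E 2 = (v 2, g (v 2), 0)" "E 3 = (v 3, g (v 3), 0)"
     "E 4 = (v 1, - g (v 1), 0)" "E 5 = (v 2, - g (v 2), 0)" "E 6 = (v 3, - g (v 3), 0)"
    by (simp_all add: frame_e_def)
  note w13 = w[OF in13(1)] w[OF in13(2)] w[OF in13(3)]
  have w456: "w 4 p = - \<epsilon> 1 * (\<xi> (v 1) p - g X (v 1) p) / 2" "w 5 p = - \<epsilon> 2 * (\<xi> (v 2) p - g X (v 2) p) / 2"
    "w 6 p = - \<epsilon> 3 * (\<xi> (v 3) p - g X (v 3) p) / 2" for p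
    using w13(2)[of p] w13(4)[of p] w13(6)[of p] by simp_all
  have "(\<Sum>B<7. smul (w B) (E B)) = (X, \<xi>, l)"
    unfolding sum_less_7 E_0 E smul.simps w0 add_Pair
  proof (intro prod.inject[THEN iffD2] conjI ext)
    fix k p
    have "X k p = field_coord X 1 p * v 1 k p + field_coord X 2 p * v 2 k p + field_coord X 3 p * v 3 k p"
      using fun_cong[OF fun_cong[OF field_expand[OF X]], of k p] by simp
    then show "((\<lambda>k. l * 0 k) + ((\<lambda>k. w 1 * v 1 k) + ((\<lambda>k. w 2 * v 2 k) + ((\<lambda>k. w 3 * v 3 k) +
        ((\<lambda>k. w 4 * v 1 k) + ((\<lambda>k. w 5 * v 2 k) + (\<lambda>k. w 6 * v 3 k))))))) k p = X k p"
      by (simp add: field_coord_def w13 w456 del: One_nat_def) (simp add: field_simps)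
  next
    fix Z p
    show "((\<lambda>Z. l * 0 Z) + ((\<lambda>Z. w 1 * g (v 1) Z) + ((\<lambda>Z. w 2 * g (v 2) Z) + ((\<lambda>Z. w 3 * g (v 3) Z) +
        ((\<lambda>Z. w 4 * (- g (v 1)) Z) + ((\<lambda>Z. w 5 * (- g (v 2)) Z) + (\<lambda>Z. w 6 * (- g (v 3)) Z))))))) Z p = \<xi> Z p"
    proof (cases "Z \<in> V")
      case True
      have gs: "g Z (v 1) = g (v 1) Z" "g Z (v 2) = g (v 2) Z" "g Z (v 3) = g (v 3) Z"
        by (intro g_sym True v_field in13)+
      have "\<xi> Z p = field_coord Z 1 p * \<xi> (v 1) p + field_coord Z 2 p * \<xi> (v 2) p + field_coord Z 3 p * \<xi> (v 3) p"
        using fun_cong[OF form_expand[OF x True], of p] by simp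
      then show ?thesis
        by (simp add: field_coord_def gs w13 w456 del: One_nat_def) (simp add: field_simps)
    next
      case False
      have z: "g (v a) Z = 0" if "a \<in> {1..3}" for a by (rule one_formsD(4)[OF g_form[OF v_field[OF that]] False])
      show ?thesis using z[OF in13(1)] z[OF in13(2)] z[OF in13(3)] one_formsD(4)[OF x False] by simp
    qed
  qed (simp add: fun_eq_iff)
  then show ?thesis unfolding w_def ueq by (rule sym)
qed

lemma vbracket_zero: "X \<in> V \<Longrightarrow> vbracket X 0 = 0" "X \<in> V \<Longrightarrow> vbracket 0 X = 0"
proof -
  assume X: "X \<in> V"
  have "X 0 = 0" using vector_fields_const[OF A X, of 0] by (simp add: zero_fun_def)
  then show "vbracket X 0 = 0" "vbracket 0 X = 0" by (simp_all add: vbracket_def fun_eq_iff)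
qed

abbreviation "struct_coeff \<equiv> frame_coeff (\<lambda>x y z. \<epsilon> z * K x y z) Hc Fc"

text \<open>The frame elements have constant components, so in the Dorfman bracket all derivatives of functions
  vanish and only the brackets of the \<open>v a\<close> and the components of \<open>H\<close> and \<open>F\<close> survive.\<close>

lemma E_bracket:
  assumes B: "B < 7" and B': "B' < 7" and B'': "B'' < 7"
  shows "pairing (dorfman A H F (E B) (E B')) (E B'') = (\<lambda>_. struct_coeff B B' B'')"
proof -
  let ?x = "frame_index B" and ?y = "frame_index B'" and ?z = "frame_index B''"
  note zero = vector_fields_0[OF A]
  obtain X \<xi> l where EB: "E B = (X, \<xi>, l)" by (rule prod_cases3)
  obtain Y \<eta> m where EB': "E B' = (Y, \<eta>, m)" by (rule prod_cases3)
  note sB = E_section[OF B, unfolded EB] and sB' = E_section[OF B', unfolded EB']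
  have X: "X \<in> V" and x: "\<xi> \<in> one_forms A" and Y: "Y \<in> V" and e: "\<eta> \<in> one_forms A"
    using sB sB' unfolding sections_iff by auto
  have s: "(vbracket X Y, (\<lambda>Z. if Z \<in> V then dorfman_form X \<xi> l Y \<eta> m Z else 0), X m - Y l + F X Y) \<in> sections A"
    using dorfman_sections[OF sB sB'] unfolding dorfman_eq[OF sB sB'] .
  have lm: "l = (\<lambda>_. if B = 0 then 1 else 0)" "m = (\<lambda>_. if B' = 0 then 1 else 0)"
    using EB EB' E_0 E_pos[of B] E_pos[of B'] by (auto simp: fun_eq_iff split: if_splits)
  have X1: "X m = 0" and Y1: "Y l = 0" unfolding lm by (rule vector_fields_const[OF A X], rule vector_fields_const[OF A Y])
  have XB: "X = (if B = 0 then 0 else v ?x)" and YB: "Y = (if B' = 0 then 0 else v ?y)"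
    and xB: "\<xi> = (if B = 0 then 0 else (\<lambda>Z. (\<lambda>_. frame_sign B) * g (v ?x) Z))"
    and eB: "\<eta> = (if B' = 0 then 0 else (\<lambda>Z. (\<lambda>_. frame_sign B') * g (v ?y) Z))"
    using EB EB' E_0 E_pos[of B] E_pos[of B'] by (auto split: if_splits)
  have FXY: "F X Y = (\<lambda>_. if B = 0 \<or> B' = 0 then 0 else Fc ?x ?y)"
    unfolding XB YB using frame_index_in[OF _ B] frame_index_in[OF _ B'] one_form_zero[OF A two_formsD(1)[OF F v_field]]
    by (auto simp: F_frame two_form_zero[OF A F] fun_eq_iff)
  show ?thesis
  proof (cases "B'' = 0")
    case True
    show ?thesis
      unfolding EB EB' dorfman_eq[OF sB sB'] True pairing_E_0[OF s] unfolding X1 Y1 FXY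
      using True by (simp add: frame_coeff_def Let_def fun_eq_iff)
  next
    case z0: False
    note z = frame_index_in[OF z0 B''] and vz = v_field[OF frame_index_in[OF z0 B'']]
    have Zl: "v ?z l = 0" unfolding lm by (rule vector_fields_const[OF A vz])
    have gbr: "g (v ?z) (vbracket X Y) = (\<lambda>_. if B = 0 \<or> B' = 0 then 0 else \<epsilon> ?z * K ?x ?y ?z)"
      unfolding XB YB using frame_index_in[OF _ B] frame_index_in[OF _ B']
      by (auto simp: vbracket_zero zero v_field one_form_zero[OF A g_form[OF vz]] g_bracket[OF _ _ z] fun_eq_iff)
    have t1: "X (\<eta> (v ?z)) = 0"
    proof (cases "B' = 0")
      case True
      then show ?thesis unfolding eB using field_zero_fun[OF X] by simp
    next
      case False
      then show ?thesis unfolding eB by (simp add: orthonormal[OF frame_index_in[OF False B'] z] const_fun_simps vector_fields_const[OF A X])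
    qed
    have t2: "Y (\<xi> (v ?z)) = 0"
    proof (cases "B = 0")
      case True
      then show ?thesis unfolding xB using field_zero_fun[OF Y] by simp
    next
      case False
      then show ?thesis unfolding xB by (simp add: orthonormal[OF frame_index_in[OF False B] z] const_fun_simps vector_fields_const[OF A Y])
    qed
    have t3: "v ?z (\<xi> Y) = 0"
    proof (cases "B = 0 \<or> B' = 0")
      case True
      then have "\<xi> Y = 0" unfolding xB YB using one_form_zero[OF A g_form[OF v_field[OF frame_index_in[OF _ B]]]]
        by (auto simp: fun_eq_iff)
      then show ?thesis using field_zero_fun[OF vz] by simp
    next
      case False
      then show ?thesis unfolding xB YB
        by (simp add: orthonormal[OF frame_index_in[OF _ B] frame_index_in[OF _ B']] const_fun_simps vector_fields_const[OF A vz])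
    qed
    have t4: "\<eta> (vbracket X (v ?z)) = (\<lambda>_. if B = 0 \<or> B' = 0 then 0 else frame_sign B' * (\<epsilon> ?y * K ?x ?z ?y))"
      unfolding XB eB using frame_index_in[OF _ B] frame_index_in[OF _ B']
      by (auto simp: vbracket_zero vz one_form_zero[OF A g_form[OF v_field]]
          g_bracket[OF frame_index_in[OF _ B] z frame_index_in[OF _ B']] fun_eq_iff)
    have t5: "\<xi> (vbracket Y (v ?z)) = (\<lambda>_. if B = 0 \<or> B' = 0 then 0 else frame_sign B * (\<epsilon> ?x * K ?y ?z ?x))"
      unfolding YB xB using frame_index_in[OF _ B] frame_index_in[OF _ B']
      by (auto simp: vbracket_zero vz one_form_zero[OF A g_form[OF v_field]]
          g_bracket[OF frame_index_in[OF _ B'] z frame_index_in[OF _ B]] fun_eq_iff)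
    have t6: "H Y X (v ?z) = (\<lambda>_. if B = 0 \<or> B' = 0 then 0 else Hc ?y ?x ?z)"
    proof (cases "B' = 0")
      case True
      have "H 0 X (v ?z) = 0"
        unfolding three_formsD(3)[OF H zero X] using two_form_zero[OF A three_formsD(1)[OF H X]] by simp
      then show ?thesis using True unfolding YB by (simp add: fun_eq_iff)
    next
      case False
      note y = frame_index_in[OF False B']
      show ?thesis using False two_form_zero[OF A three_formsD(1)[OF H v_field[OF y]], of "v ?z"] frame_index_in[OF _ B]
        unfolding XB YB by (auto simp: H_frame[OF y frame_index_in[OF _ B] z] fun_eq_iff)
    qed
    have t7: "F X (v ?z) = (\<lambda>_. if B = 0 then 0 else Fc ?x ?z)"
      unfolding XB by (auto simp: F_frame[OF frame_index_in[OF _ B] z] two_form_zero[OF A F] fun_eq_iff)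
    have t8: "F Y (v ?z) = (\<lambda>_. if B' = 0 then 0 else Fc ?y ?z)"
      unfolding YB by (auto simp: F_frame[OF frame_index_in[OF _ B'] z] two_form_zero[OF A F] fun_eq_iff)
    have form: "dorfman_form X \<xi> l Y \<eta> m (v ?z) p =
        (if B = 0 then (if B' = 0 then 0 else 2 * Fc ?y ?z) else if B' = 0 then - 2 * Fc ?x ?z
         else frame_sign B * (\<epsilon> ?x * K ?y ?z ?x) - frame_sign B' * (\<epsilon> ?y * K ?x ?z ?y) + Hc ?y ?x ?z)" for p
      unfolding dorfman_form_def t1 t2 t3 t4 t5 t6 t7 t8 Zl by (simp add: two_apply lm)
    show ?thesis
    proof (rule ext)
      fix p
      have "pairing (dorfman A H F (E B) (E B')) (E B'') p =
          (dorfman_form X \<xi> l Y \<eta> m (v ?z) p + frame_sign B'' * g (v ?z) (vbracket X Y) p) / 2"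
        unfolding EB EB' dorfman_eq[OF sB sB'] pairing_E_pos[OF z0] using vz by simp
      also have "\<dots> = struct_coeff B B' B''"
        unfolding form gbr using z0 Fc_skew[OF frame_index_in[OF _ B] z] Hc_skew(1)[of ?y ?x ?z] K_skew[of ?x ?z ?y]
        by (simp add: frame_coeff_def Let_def)
      finally show "pairing (dorfman A H F (E B) (E B')) (E B'') p = struct_coeff B B' B''" .
    qed
  qed
qed

lemma struct_coeff_skew:
  assumes "B < 7" "B' < 7" "B'' < 7"
  shows "struct_coeff B' B B'' = - struct_coeff B B' B''" "struct_coeff B B'' B' = - struct_coeff B B' B''"
proof -
  let ?x = "frame_index B" and ?y = "frame_index B'" and ?z = "frame_index B''"
  have f: "B \<noteq> 0 \<Longrightarrow> B' \<noteq> 0 \<Longrightarrow> Fc ?y ?x = - Fc ?x ?y" "B \<noteq> 0 \<Longrightarrow> B'' \<noteq> 0 \<Longrightarrow> Fc ?z ?x = - Fc ?x ?z"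
     "B' \<noteq> 0 \<Longrightarrow> B'' \<noteq> 0 \<Longrightarrow> Fc ?z ?y = - Fc ?y ?z"
    using Fc_skew frame_index_in assms by blast+
  show "struct_coeff B' B B'' = - struct_coeff B B' B''"
    using f K_skew[of ?x ?y ?z] K_skew[of ?y ?z ?x] K_skew[of ?x ?z ?y] Hc_skew(1)[of ?y ?x ?z]
    by (simp add: frame_coeff_def Let_def field_simps)
  show "struct_coeff B B'' B' = - struct_coeff B B' B''"
    using f K_skew[of ?x ?y ?z] K_skew[of ?y ?z ?x] K_skew[of ?x ?z ?y] Hc_skew(2)[of ?x ?z ?y]
    by (simp add: frame_coeff_def Let_def field_simps)
qed

sublocale courant_frame A H F 7 E "frame_norm \<epsilon>" struct_coeff
proof
  fix B B' B'' :: nat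
  assume B: "B < 7"
  show "E B \<in> sections A" by (rule E_section[OF B])
  show "frame_norm \<epsilon> B * frame_norm \<epsilon> B = 1"
    using \<epsilon>_square[OF frame_index_in[OF _ B]] by (cases "B = 0") (auto simp: frame_norm_def frame_sign_def)
  assume B': "B' < 7"
  show "pairing (E B) (E B') = (\<lambda>_. if B = B' then frame_norm \<epsilon> B else 0)" by (rule E_pairing[OF B B'])
  assume B'': "B'' < 7"
  show "pairing (dorfman A H F (E B) (E B')) (E B'') = (\<lambda>_. struct_coeff B B' B'')" by (rule E_bracket[OF B B' B''])
  show "struct_coeff B' B B'' = - struct_coeff B B' B''" "struct_coeff B B'' B' = - struct_coeff B B' B''" by (rule struct_coeff_skew[OF B B' B''])+
next
  fix u assume "u \<in> sections A"
  then show "u = (\<Sum>B<7. smul ((\<lambda>_. frame_norm \<epsilon> B) * pairing u (E B)) (E B))" by (rule E_expand)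
qed

lemma E_minus_frame_span: "E_minus A g = frame_span {4..<7}"
proof (intro set_eqI iffI)
  fix u assume "u \<in> E_minus A g"
  then obtain X where u: "u = (X, - g X, 0)" and X: "X \<in> V" unfolding E_minus_def by blast
  have s: "(X, - g X, 0) \<in> sections A"
    unfolding sections_iff by (intro conjI X one_forms_uminus g_form smooth_fns_0)
  show "u \<in> frame_span {4..<7}"
  proof (rule frame_spanI)
    show "u \<in> sections A" using s unfolding u .
    fix B :: nat assume B: "B < 7" "B \<notin> {4..<7}"
    show "pairing u (E B) = 0"
    proof (cases "B = 0")
      case True
      show ?thesis unfolding u True pairing_E_0[OF s] by (rule refl)
    next
      case False
      have "frame_sign B = 1" using B by (simp add: frame_sign_def)
      then show ?thesis unfolding u pairing_E_pos[OF False] g_sym[OF v_field[OF frame_index_in[OF False B(1)]] X]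
        by (simp add: fun_eq_iff)
    qed
  qed
next
  fix u assume u: "u \<in> frame_span {4..<7}"
  obtain X \<xi> l where ueq: "u = (X, \<xi>, l)" by (rule prod_cases3)
  note s = frame_span_section[OF u, unfolded ueq]
  have X: "X \<in> V" and x: "\<xi> \<in> one_forms A" using s unfolding sections_iff by auto
  have z: "pairing (X, \<xi>, l) (E B) = 0" if "B < 4" for B
    using frame_span_pairing[OF u, of B] that unfolding ueq by simp
  have l: "l = 0" using z[of 0] unfolding pairing_E_0[OF s] by simp
  have xv: "\<xi> (v a) = - g X (v a)" if a: "a \<in> {1..3}" for a
  proof (rule ext)
    fix p
    have a': "a \<noteq> 0" "a < 4" "frame_index a = a" "frame_sign a = 1" using a by (auto simp: frame_index_def frame_sign_def)
    have "(\<xi> (v a) p + g (v a) X p) / 2 = 0"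
      using fun_cong[OF z[OF a'(2)], of p] unfolding pairing_E_pos[OF a'(1)] a' by simp
    then show "\<xi> (v a) p = (- g X (v a)) p" unfolding g_sym[OF v_field[OF a] X] by simp
  qed
  have "\<xi> = - g X"
  proof (rule ext)
    fix Z
    show "\<xi> Z = (- g X) Z"
    proof (cases "Z \<in> V")
      case True
      show ?thesis unfolding form_expand[OF x True] form_expand[OF one_forms_uminus[OF g_form[OF X]] True]
          xv[OF in13(1)] xv[OF in13(2)] xv[OF in13(3)] by simp
    qed (use one_formsD(4)[OF x] one_formsD(4)[OF g_form[OF X]] in simp)
  qed
  then show "u \<in> E_minus A g" unfolding E_minus_def ueq l using X by blast
qed

end

section \<open>Structure constants for the matrix L5\<close>

text \<open>The quotient of the Vandermonde determinants of \<open>(a, b, c)\<close> and of \<open>(1, 2, 3)\<close>: the sign of a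
  permutation, in a form in which skew-symmetry is a polynomial identity.\<close>

definition orientation :: "nat \<Rightarrow> nat \<Rightarrow> nat \<Rightarrow> real" where
  "orientation a b c = (if a \<in> {1..3} \<and> b \<in> {1..3} \<and> c \<in> {1..3}
     then (real b - real a) * (real c - real a) * (real c - real b) / 2 else 0)"

lemma orientation_skew: "orientation b a c = - orientation a b c" "orientation a c b = - orientation a b c"
  by (simp_all add: orientation_def field_simps)

lemma frame_index_values: "frame_index 1 = 1" "frame_index 2 = 2" "frame_index 3 = 3" "frame_index 4 = 1" "frame_index 5 = 2" "frame_index 6 = 3"
  and frame_sign_values: "frame_sign 1 = 1" "frame_sign 2 = 1" "frame_sign 3 = 1" "frame_sign 4 = - 1" "frame_sign 5 = - 1" "frame_sign 6 = - 1"
  by (simp_all add: frame_index_def frame_sign_def)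

lemma orientation_values:
  "orientation 1 2 3 = 1" "orientation 2 3 1 = 1" "orientation 3 1 2 = 1" "orientation 2 1 3 = - 1" "orientation 3 2 1 = - 1" "orientation 1 3 2 = - 1"
  "orientation a a b = 0" "orientation a b a = 0" "orientation b a a = 0"
  by (simp_all add: orientation_def)

text \<open>The square root enters through \<open>s\<^sup>2 = 1 / 2\<close> only; with a parameter \<open>s\<close> the Ricci tensor is
  polynomial.\<close>

definition L5_matrix :: "real \<Rightarrow> real \<Rightarrow> nat \<Rightarrow> nat \<Rightarrow> real" where
  "L5_matrix s \<alpha> i j = [[\<alpha>, s, 0], [s, \<alpha>, s], [0, - s, \<alpha>]] ! (i - 1) ! (j - 1)"

lemma L5_matrix_entries:
  "L5_matrix s \<alpha> 1 1 = \<alpha>" "L5_matrix s \<alpha> 1 2 = s" "L5_matrix s \<alpha> 1 3 = 0"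
  "L5_matrix s \<alpha> 2 1 = s" "L5_matrix s \<alpha> 2 2 = \<alpha>" "L5_matrix s \<alpha> 2 3 = s"
  "L5_matrix s \<alpha> 3 1 = 0" "L5_matrix s \<alpha> 3 2 = - s" "L5_matrix s \<alpha> 3 3 = \<alpha>"
  by (simp_all add: L5_matrix_def)

lemma sum_less_4: "(\<Sum>B<4. f B) = f 0 + f 1 + f 2 + f (3::nat)"
proof -
  have "{..<4::nat} = {0, 1, 2, 3}" by auto
  then show ?thesis by (simp add: add.assoc)
qed

lemma sum_4_7: "(\<Sum>B\<in>{4..<7}. f B) = f 4 + f 5 + f (6::nat)"
proof -
  have "{4..<7::nat} = {4, 5, 6}" by auto
  then show ?thesis by (simp add: add.assoc)
qed

text \<open>The coefficient of \<open>v z\<close> in \<open>[v x, v y]\<close>: the bracket of \<open>v x\<close> and \<open>v y\<close> is \<open>\<plusminus> \<epsilon> w L(v w)\<close> for the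
  remaining index \<open>w\<close>.\<close>

definition bracket_coeff :: "(nat \<Rightarrow> real) \<Rightarrow> (nat \<Rightarrow> nat \<Rightarrow> real) \<Rightarrow> nat \<Rightarrow> nat \<Rightarrow> nat \<Rightarrow> real" where
  "bracket_coeff \<epsilon> L x y z = orientation x y 1 * \<epsilon> 1 * L z 1 + orientation x y 2 * \<epsilon> 2 * L z 2 + orientation x y 3 * \<epsilon> 3 * L z 3"

lemma square_one_cancel: "e * e = 1 \<Longrightarrow> e * (e * x) = (x :: real)"
  and square_half_cancel: "s * s = 1 / 2 \<Longrightarrow> s * (s * x) = (x / 2 :: real)"
  by (simp_all add: mult.assoc[symmetric])

text \<open>The components of the two Ricci tensors, with \<open>e\<close> for \<open>\<epsilon> 1\<close>. In the solution of the equations the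
  component on \<open>e a\<close> and \<open>e i\<close> is referred to by the digits of \<open>a\<close> and \<open>i\<close>.\<close>

lemma ricci_equations:
  fixes e s \<alpha> h :: real
  assumes e: "\<epsilon> 1 = e" "\<epsilon> 2 = e" "\<epsilon> 3 = - e" "e * e = 1" and s: "s * s = 1 / 2"
    and N: "N = frame_norm \<epsilon>"
    and c: "c = frame_coeff (\<lambda>x y z. \<epsilon> z * bracket_coeff \<epsilon> (L5_matrix s \<alpha>) x y z) (\<lambda>x y z. h * orientation x y z) Fc"
    and Fc: "Fc 1 1 = 0" "Fc 2 2 = 0" "Fc 3 3 = 0" "Fc 2 1 = - Fc 1 2" "Fc 3 1 = - Fc 1 3" "Fc 3 2 = - Fc 2 3"
  shows "ricci_coeff N c d {..<4} {4..<7} 4 0 = - (\<alpha> * Fc 2 3) - h * Fc 2 3 - Fc 1 2 * d 2 * e + Fc 1 3 * d 3 * e + Fc 1 3 * s"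
    and "ricci_coeff N c d {4..<7} {..<4} 0 4 = - (\<alpha> * Fc 2 3) - h * Fc 2 3 - Fc 1 2 * d 5 * e + Fc 1 3 * d 6 * e + Fc 1 3 * s"
    and "ricci_coeff N c d {..<4} {4..<7} 4 1 = - (\<alpha> * \<alpha> / 2) + h * h / 2 - Fc 1 2 * Fc 1 2 * e + Fc 1 3 * Fc 1 3 * e - d 3 * s * e - 1"
    and "ricci_coeff N c d {4..<7} {..<4} 1 4 = - (\<alpha> * \<alpha> / 2) + h * h / 2 - Fc 1 2 * Fc 1 2 * e + Fc 1 3 * Fc 1 3 * e - d 6 * s * e - 1"
    and "ricci_coeff N c d {..<4} {4..<7} 4 2 = - (\<alpha> * d 3 * e / 2) - \<alpha> * s + h * d 3 * e / 2 + Fc 1 2 * d 0 + Fc 1 3 * Fc 2 3 * e"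
    and "ricci_coeff N c d {4..<7} {..<4} 2 4 = \<alpha> * d 6 * e / 2 - \<alpha> * s + h * d 6 * e / 2 + Fc 1 3 * Fc 2 3 * e + d 5 * s * e"
    and "ricci_coeff N c d {..<4} {4..<7} 4 3 = - (\<alpha> * d 2 * e / 2) + h * d 2 * e / 2 + Fc 1 2 * Fc 2 3 * e + Fc 1 3 * d 0 - d 1 * s * e - 1"
    and "ricci_coeff N c d {4..<7} {..<4} 3 4 = \<alpha> * d 5 * e / 2 + h * d 5 * e / 2 + Fc 1 2 * Fc 2 3 * e - d 6 * s * e - 1"
    and "ricci_coeff N c d {..<4} {4..<7} 5 0 = \<alpha> * Fc 1 3 + h * Fc 1 3 + Fc 1 2 * d 1 * e - Fc 1 2 * s + Fc 2 3 * d 3 * e - Fc 2 3 * s"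
    and "ricci_coeff N c d {4..<7} {..<4} 0 5 = \<alpha> * Fc 1 3 + h * Fc 1 3 + Fc 1 2 * d 4 * e - Fc 1 2 * s + Fc 2 3 * d 6 * e - Fc 2 3 * s"
    and "ricci_coeff N c d {..<4} {4..<7} 5 1 = \<alpha> * d 3 * e / 2 - \<alpha> * s - h * d 3 * e / 2 - Fc 1 2 * d 0 + Fc 1 3 * Fc 2 3 * e + d 2 * s * e"
    and "ricci_coeff N c d {4..<7} {..<4} 1 5 = - (\<alpha> * d 6 * e / 2) - \<alpha> * s - h * d 6 * e / 2 + Fc 1 3 * Fc 2 3 * e"
    and "ricci_coeff N c d {..<4} {4..<7} 5 2 = - (\<alpha> * \<alpha> / 2) + h * h / 2 - Fc 1 2 * Fc 1 2 * e + Fc 2 3 * Fc 2 3 * e - d 1 * s * e + d 3 * s * e"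
    and "ricci_coeff N c d {4..<7} {..<4} 2 5 = - (\<alpha> * \<alpha> / 2) + h * h / 2 - Fc 1 2 * Fc 1 2 * e + Fc 2 3 * Fc 2 3 * e - d 4 * s * e + d 6 * s * e"
    and "ricci_coeff N c d {..<4} {4..<7} 5 3 = \<alpha> * d 1 * e / 2 - \<alpha> * s - h * d 1 * e / 2 - Fc 1 2 * Fc 1 3 * e + Fc 2 3 * d 0 + d 2 * s * e"
    and "ricci_coeff N c d {4..<7} {..<4} 3 5 = - (\<alpha> * d 4 * e / 2) - \<alpha> * s - h * d 4 * e / 2 - Fc 1 2 * Fc 1 3 * e"
    and "ricci_coeff N c d {..<4} {4..<7} 6 0 = \<alpha> * Fc 1 2 + h * Fc 1 2 + Fc 1 3 * d 1 * e + Fc 1 3 * s + Fc 2 3 * d 2 * e"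
    and "ricci_coeff N c d {4..<7} {..<4} 0 6 = \<alpha> * Fc 1 2 + h * Fc 1 2 + Fc 1 3 * d 4 * e + Fc 1 3 * s + Fc 2 3 * d 5 * e"
    and "ricci_coeff N c d {..<4} {4..<7} 6 1 = \<alpha> * d 2 * e / 2 - h * d 2 * e / 2 + Fc 1 2 * Fc 2 3 * e - Fc 1 3 * d 0 - d 3 * s * e - 1"
    and "ricci_coeff N c d {4..<7} {..<4} 1 6 = - (\<alpha> * d 5 * e / 2) - h * d 5 * e / 2 + Fc 1 2 * Fc 2 3 * e - d 4 * s * e - 1"
    and "ricci_coeff N c d {..<4} {4..<7} 6 2 = - (\<alpha> * d 1 * e / 2) - \<alpha> * s + h * d 1 * e / 2 - Fc 1 2 * Fc 1 3 * e - Fc 2 3 * d 0"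
    and "ricci_coeff N c d {4..<7} {..<4} 2 6 = \<alpha> * d 4 * e / 2 - \<alpha> * s + h * d 4 * e / 2 - Fc 1 2 * Fc 1 3 * e + d 5 * s * e"
    and "ricci_coeff N c d {..<4} {4..<7} 6 3 = \<alpha> * \<alpha> / 2 - h * h / 2 - Fc 1 3 * Fc 1 3 * e - Fc 2 3 * Fc 2 3 * e - d 1 * s * e - 1"
    and "ricci_coeff N c d {4..<7} {..<4} 3 6 = \<alpha> * \<alpha> / 2 - h * h / 2 - Fc 1 3 * Fc 1 3 * e - Fc 2 3 * Fc 2 3 * e - d 4 * s * e - 1"
  by (simp_all add: ricci_coeff_def sum_less_4 sum_4_7 N c frame_norm_def frame_coeff_def Let_def frame_index_values frame_sign_values bracket_coeff_def orientation_values L5_matrix_entries e Fc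
      algebra_simps e(4) s square_one_cancel[OF e(4)] square_half_cancel[OF s] add_divide_distrib diff_divide_distrib
      del: One_nat_def)

section \<open>Solving the equations\<close>

text \<open>Suitable combinations of the components are solvable one after the other. Write \<open>x, y, z\<close> for
  the components \<open>12, 13, 23\<close> of \<open>F\<close>. The equation \<open>(x + z)\<^sup>2 = 0\<close> gives \<open>z = - x\<close>, the equation
  \<open>y (d 3 - d 1) = 0\<close> leads to \<open>y = 0\<close>, and \<open>F \<noteq> 0\<close> becomes \<open>x \<noteq> 0\<close>. From then on the equations determine \<open>d 2\<close>, \<open>d 5\<close> and \<open>h\<close> as multiples of \<open>\<alpha>\<close>, and a
  remaining equation says \<open>\<alpha>\<^sup>2 = 0\<close>.\<close>

lemma einstein_system:
  fixes e s \<alpha> h :: real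
  assumes e: "\<epsilon> 1 = e" "\<epsilon> 2 = e" "\<epsilon> 3 = - e" "e = 1 \<or> e = - 1" and s: "s * s = 1 / 2"
    and N: "N = frame_norm \<epsilon>"
    and c: "c = frame_coeff (\<lambda>x y z. \<epsilon> z * bracket_coeff \<epsilon> (L5_matrix s \<alpha>) x y z) (\<lambda>x y z. h * orientation x y z) Fc"
    and Fc: "Fc 1 1 = 0" "Fc 2 2 = 0" "Fc 3 3 = 0" "Fc 2 1 = - Fc 1 2" "Fc 3 1 = - Fc 1 3" "Fc 3 2 = - Fc 2 3"
    and F0: "Fc 1 2 \<noteq> 0 \<or> Fc 1 3 \<noteq> 0 \<or> Fc 2 3 \<noteq> 0"
  shows "(\<forall>a\<in>{4..<7}. \<forall>i\<in>{..<4}. ricci_coeff N c d {..<4} {4..<7} a i = 0 \<and> ricci_coeff N c d {4..<7} {..<4} i a = 0)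
    \<longleftrightarrow> \<alpha> = 0 \<and> h = 0 \<and> Fc 1 3 = 0 \<and> Fc 2 3 = - Fc 1 2 \<and> (Fc 1 2)\<^sup>2 = - e - d 1 * s \<and>
      d 0 = 0 \<and> d 2 = 0 \<and> d 5 = 0 \<and> d 1 = d 3 \<and> d 3 = d 4 \<and> d 4 = d 6 \<and> e + d 1 * s < 0"
    (is "?L \<longleftrightarrow> ?R")
proof -
  have ee: "e * e = 1" using e(4) by auto
  have s0: "s \<noteq> 0" and e0: "e \<noteq> 0" using s e(4) by auto
  note eqs = ricci_equations[where d = d, OF e(1-3) ee s N c Fc]
  have M: "(4::nat) \<in> {4..<7}" "(5::nat) \<in> {4..<7}" "(6::nat) \<in> {4..<7}"
    and P: "(0::nat) \<in> {..<4}" "(1::nat) \<in> {..<4}" "(2::nat) \<in> {..<4}" "(3::nat) \<in> {..<4}" by auto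
  show ?thesis
  proof
    assume L: ?L
    have p: "ricci_coeff N c d {..<4} {4..<7} a i = 0" "ricci_coeff N c d {4..<7} {..<4} i a = 0"
      if "a \<in> {4..<7}" "i \<in> {..<4}" for a i using bspec[OF bspec[OF L that(1)] that(2)] by auto
    note p40 = p(1)[OF M(1) P(1), unfolded eqs] and p41 = p(1)[OF M(1) P(2), unfolded eqs]
      and m41 = p(2)[OF M(1) P(2), unfolded eqs] and p42 = p(1)[OF M(1) P(3), unfolded eqs]
      and m42 = p(2)[OF M(1) P(3), unfolded eqs] and p43 = p(1)[OF M(1) P(4), unfolded eqs]
      and m43 = p(2)[OF M(1) P(4), unfolded eqs]
      and p51 = p(1)[OF M(2) P(2), unfolded eqs] and m51 = p(2)[OF M(2) P(2), unfolded eqs]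
      and p52 = p(1)[OF M(2) P(3), unfolded eqs] and p60 = p(1)[OF M(3) P(1), unfolded eqs]
      and p61 = p(1)[OF M(3) P(2), unfolded eqs] and p63 = p(1)[OF M(3) P(4), unfolded eqs]
      and m63 = p(2)[OF M(3) P(4), unfolded eqs]
    have d64: "d 6 = d 3" "d 4 = d 1"
    proof -
      have "d 6 * s * e = d 3 * s * e" "d 4 * s * e = d 1 * s * e" using p41 m41 p63 m63 by linarith+
      then show "d 6 = d 3" "d 4 = d 1" using s0 e0 by simp_all
    qed
    \<comment> \<open>The components 41 and 63, minus the components 43 and 61, give the square of \<open>x + z\<close> up to a sign.\<close>
    have "Fc 1 2 * Fc 1 2 * e + 2 * (Fc 1 2 * Fc 2 3 * e) + Fc 2 3 * Fc 2 3 * e = 0"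
      using p41 p63 p43 p61 by linarith
    then have "e * ((Fc 1 2 + Fc 2 3) * (Fc 1 2 + Fc 2 3)) = 0" by (simp add: algebra_simps)
    then have z: "Fc 2 3 = - Fc 1 2" using e0 by (auto simp: eq_neg_iff_add_eq_0 add.commute)
    \<comment> \<open>The difference of the components 40 and 60.\<close>
    have yd: "Fc 1 3 = 0 \<or> d 3 = d 1"
    proof -
      have "e * (Fc 1 3 * (d 3 - d 1)) = 0" using p40 p60 unfolding z by (simp only: algebra_simps)
      then show ?thesis using e0 by auto
    qed
    have d13: "(d 3 - d 1) * s * e = (\<alpha> * \<alpha> - h * h) / 2"
      using p52 unfolding z by (simp add: algebra_simps)
    have yy: "4 * (Fc 1 3 * Fc 1 3 * e) = 3 * (\<alpha> * \<alpha> - h * h)"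
      using p41 p63 p52 unfolding z by (simp add: algebra_simps)
    \<comment> \<open>If \<open>d 3 = d 1\<close> then \<open>\<alpha>\<^sup>2 = h\<^sup>2\<close>, and \<open>y\<^sup>2 = 0\<close> follows too.\<close>
    have y: "Fc 1 3 = 0" using yd d13 yy e0 by auto
    have hh: "h * h = \<alpha> * \<alpha>" using yy y by simp
    then have d31: "d 3 = d 1" using d13 s0 e0 by simp
    have x0: "Fc 1 2 \<noteq> 0" using F0 y z by auto
    have d2: "d 2 * e = 2 * \<alpha>"
    proof -
      have "Fc 1 3 * Fc 2 3 * e = 0" using y by simp
      then have "d 2 * s * e = 2 * (\<alpha> * s)" using p42 p51 by linarith
      then have "s * (d 2 * e - 2 * \<alpha>) = 0" by (simp add: algebra_simps)
      then show ?thesis using s0 by simp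
    qed
    have d5: "d 5 * e = 2 * \<alpha>"
    proof -
      have "Fc 1 3 * Fc 2 3 * e = 0" using y by simp
      then have "d 5 * s * e = 2 * (\<alpha> * s)" using m42 m51 by linarith
      then have "s * (d 5 * e - 2 * \<alpha>) = 0" by (simp add: algebra_simps)
      then show ?thesis using s0 by simp
    qed
    have h: "h = \<alpha>"
    proof -
      have "Fc 1 2 * (h + \<alpha> - d 2 * e) = 0" using p40 y unfolding z by (simp add: algebra_simps)
      then show ?thesis using x0 d2 by simp
    qed
    \<comment> \<open>Comparing 43 for the two Ricci tensors leaves \<open>\<alpha> d\<^sub>5 = 0\<close>, where \<open>d\<^sub>5 = \<plusminus> 2 \<alpha>\<close>.\<close>
    have a: "\<alpha> = 0"
    proof -
      have "\<alpha> * (d 5 * e) = 0" using m43 p43 h y d64 d31 by (simp add: algebra_simps)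
      then show ?thesis unfolding d5 by simp
    qed
    have d250: "d 2 = 0" "d 5 = 0" using d2 d5 a e0 by auto
    have d0: "d 0 = 0" using p42 a h y x0 by simp
    have d46: "d 4 = d 6" using d64 d31 by simp
    have x2: "(Fc 1 2)\<^sup>2 = - e - d 1 * s"
    proof -
      have "e * (Fc 1 2 * Fc 1 2) = e * (- e - d 1 * s)" using p41 y a h d31 ee by (simp add: algebra_simps)
      then show ?thesis using e0 by (simp add: power2_eq_square)
    qed
    moreover have "(Fc 1 2)\<^sup>2 > 0" using x0 by simp
    ultimately have "e + d 1 * s < 0" by linarith
    then show ?R using a h y z x2 d0 d250 d31 d64 d46 by simp
  next
    assume R: ?R
    then have 0: "\<alpha> = 0" "h = 0" "Fc 1 3 = 0" "Fc 2 3 = - Fc 1 2" "d 0 = 0" "d 2 = 0" "d 5 = 0"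
      "d 3 = d 1" "d 4 = d 1" "d 6 = d 1" by simp_all
    have x2: "Fc 1 2 * Fc 1 2 = - e - d 1 * s" using R by (simp add: power2_eq_square)
    have x2e: "e * (Fc 1 2 * Fc 1 2) = - 1 - d 1 * s * e" unfolding x2 using ee by (simp add: algebra_simps)
    show ?L
    proof (intro ballI)
      fix a i :: nat assume "a \<in> {4..<7}" "i \<in> {..<4}"
      then have "a = 4 \<or> a = 5 \<or> a = 6" "i = 0 \<or> i = 1 \<or> i = 2 \<or> i = 3" by auto
      then show "ricci_coeff N c d {..<4} {4..<7} a i = 0 \<and> ricci_coeff N c d {4..<7} {..<4} i a = 0"
        by (elim disjE) (simp_all only: eqs 0, (insert x2e, simp_all add: algebra_simps)?)
    qed
  qed
qed

section \<open>The Lie algebra e(1,1)\<close>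

definition boost :: "real^2^2" where "boost = (\<chi> i j. if i = j then 0 else 1)"

lemma boost_entries: "boost $ 1 $ 1 = 0" "boost $ 1 $ 2 = 1" "boost $ 2 $ 1 = 1" "boost $ 2 $ 2 = 0"
  by (simp_all add: boost_def)

lemma isom11_entries:
  assumes "(M, b) \<in> isom11"
  shows "M $ 1 $ 1 * M $ 1 $ 1 - M $ 2 $ 1 * M $ 2 $ 1 = 1"
    "M $ 1 $ 1 * M $ 1 $ 2 - M $ 2 $ 1 * M $ 2 $ 2 = 0"
    "M $ 1 $ 2 * M $ 1 $ 2 - M $ 2 $ 2 * M $ 2 $ 2 = - 1"
proof -
  have "(transpose M ** eta11 ** M) $ i $ j = eta11 $ i $ j" for i j
    using assms unfolding isom11_def by simp
  from this[of 1 1] this[of 1 2] this[of 2 2]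
  show "M $ 1 $ 1 * M $ 1 $ 1 - M $ 2 $ 1 * M $ 2 $ 1 = 1"
    "M $ 1 $ 1 * M $ 1 $ 2 - M $ 2 $ 1 * M $ 2 $ 2 = 0"
    "M $ 1 $ 2 * M $ 1 $ 2 - M $ 2 $ 2 * M $ 2 $ 2 = - 1"
    by (simp_all add: matrix_matrix_mult_def transpose_def eta11_def sum_2 algebra_simps)
qed

text \<open>Differentiating the defining relation of the isometry group at the identity gives one inclusion;
  the curves of hyperbolic rotations, with a linear translation part, give the other.\<close>

lemma e11_eq: "e11 = {(t *\<^sub>R boost, b) | t b. True}"
proof (intro set_eqI iffI)
  fix x :: "(real^2^2) \<times> (real^2)" assume "x \<in> e11"
  then obtain \<gamma> where \<gamma>0: "\<gamma> 0 = (mat 1, 0)" and iso: "\<And>t. \<gamma> t \<in> isom11"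
    and der: "(\<gamma> has_vector_derivative x) (at (0::real))" unfolding e11_def by blast
  obtain M' b' where x: "x = (M', b')" by (rule prod.exhaust)
  define m where "m i j t = fst (\<gamma> t) $ i $ j" for i j :: 2 and t
  have dm: "(m i j has_real_derivative M' $ i $ j) (at 0)" for i j
  proof -
    have bl: "bounded_linear (\<lambda>y :: (real^2^2) \<times> (real^2). fst y $ i $ j)"
      by (intro bounded_linear_compose[OF bounded_linear_vec_nth] bounded_linear_fst)
    from bounded_linear.has_vector_derivative[OF bl der]
    show ?thesis unfolding m_def has_real_derivative_iff_has_vector_derivative by (simp add: x)
  qed
  have m0: "m 1 1 0 = 1" "m 1 2 0 = 0" "m 2 1 0 = 0" "m 2 2 0 = 1"
    unfolding m_def \<gamma>0 by (simp_all add: mat_def)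
  have rel: "m 1 1 t * m 1 1 t - m 2 1 t * m 2 1 t = 1" "m 1 1 t * m 1 2 t - m 2 1 t * m 2 2 t = 0"
    "m 1 2 t * m 1 2 t - m 2 2 t * m 2 2 t = - 1" for t
    using isom11_entries[of "fst (\<gamma> t)" "snd (\<gamma> t)"] iso[of t] unfolding m_def by simp_all
  have prod: "((\<lambda>t. m i j t * m k l t - m i' j' t * m k' l' t) has_real_derivative
      (M' $ i $ j * m k l 0 + M' $ k $ l * m i j 0 - (M' $ i' $ j' * m k' l' 0 + M' $ k' $ l' * m i' j' 0))) (at 0)"
    for i j k l i' j' k' l'
    by (intro DERIV_diff DERIV_mult dm)
  have 1: "M' $ 1 $ 1 = 0" using DERIV_unique[OF prod[of 1 1 1 1 2 1 2 1, unfolded rel] DERIV_const]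
    by (simp add: m0)
  have 2: "M' $ 1 $ 2 = M' $ 2 $ 1" using DERIV_unique[OF prod[of 1 1 1 2 2 1 2 2, unfolded rel] DERIV_const]
    by (simp add: m0)
  have 3: "M' $ 2 $ 2 = 0" using DERIV_unique[OF prod[of 1 2 1 2 2 2 2 2, unfolded rel] DERIV_const]
    by (simp add: m0)
  have "M' = (M' $ 1 $ 2) *\<^sub>R boost"
    by (simp add: vec_eq_iff forall_2 boost_entries 1 2 3)
  then show "x \<in> {(t *\<^sub>R boost, b) | t b. True}" unfolding x by blast
next
  fix x :: "(real^2^2) \<times> (real^2)" assume "x \<in> {(t *\<^sub>R boost, b) | t b. True}"
  then obtain t b where x: "x = (t *\<^sub>R boost, b)" by blast
  define \<gamma> where "\<gamma> r = (cosh (r * t) *\<^sub>R mat 1 + sinh (r * t) *\<^sub>R boost, r *\<^sub>R b)" for r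
  have "\<gamma> 0 = (mat 1, 0)" by (simp add: \<gamma>_def)
  moreover have "\<gamma> r \<in> isom11" for r
  proof -
    have "cosh (r * t) * cosh (r * t) - sinh (r * t) * sinh (r * t) = 1"
      using hyperbolic_pythagoras[of "r * t"] by (simp add: power2_eq_square)
    then show ?thesis
      by (simp add: \<gamma>_def isom11_def vec_eq_iff forall_2 matrix_matrix_mult_def transpose_def eta11_def sum_2
          mat_def boost_entries algebra_simps)
  qed
  moreover have "(\<gamma> has_vector_derivative x) (at 0)"
  proof -
    have "((\<lambda>r. cosh (r * t)) has_real_derivative 0) (at 0)" "((\<lambda>r. sinh (r * t)) has_real_derivative t) (at 0)"
      by (auto intro!: derivative_eq_intros)
    then have "((\<lambda>r. cosh (r * t) *\<^sub>R (mat 1 :: real^2^2) + sinh (r * t) *\<^sub>R boost) has_vector_derivative t *\<^sub>R boost) (at 0)"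
      by (auto intro!: derivative_eq_intros)
    moreover have "((\<lambda>r. r *\<^sub>R b) has_vector_derivative b) (at 0)"
      by (auto intro!: derivative_eq_intros)
    ultimately show ?thesis unfolding \<gamma>_def x by (rule has_vector_derivative_Pair)
  qed
  ultimately show "x \<in> e11" unfolding e11_def by blast
qed

context lie_group_frame
begin

lemma vbracket_lincomb3_right:
  assumes X: "X \<in> vector_fields A"
  shows "vbracket X (lincomb3 y v) f p =
    y 1 * vbracket X (v 1) f p + y 2 * vbracket X (v 2) f p + y 3 * vbracket X (v 3) f p"
proof -
  have in13: "1 \<in> {1..3::nat}" "2 \<in> {1..3::nat}" "3 \<in> {1..3::nat}" by auto
  note V = v_field[OF in13(1)] v_field[OF in13(2)] v_field[OF in13(3)]
  note W = vector_fields_smul[OF A V(1) smooth_fns_const] vector_fields_smul[OF A V(2) smooth_fns_const]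
    vector_fields_smul[OF A V(3) smooth_fns_const]
  show ?thesis
    unfolding lincomb3_eq vbracket_add_right[OF A X vector_fields_add[OF A W(1) W(2)] W(3)] vbracket_add_right[OF A X W(1) W(2)]
      vbracket_smul_right[OF A X V(1) smooth_fns_const] vbracket_smul_right[OF A X V(2) smooth_fns_const]
      vbracket_smul_right[OF A X V(3) smooth_fns_const] vector_fields_const[OF A X] by simp
qed

lemma vbracket_lincomb3:
  "vbracket (lincomb3 x v) (lincomb3 y v) f p =
    (x 1 * y 2 - x 2 * y 1) * vbracket (v 1) (v 2) f p + (x 2 * y 3 - x 3 * y 2) * vbracket (v 2) (v 3) f p
    + (x 3 * y 1 - x 1 * y 3) * vbracket (v 3) (v 1) f p"
proof -
  have in13: "1 \<in> {1..3::nat}" "2 \<in> {1..3::nat}" "3 \<in> {1..3::nat}" by auto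
  have X: "lincomb3 x v \<in> vector_fields A" using lincomb3_lie_algebra[of x] unfolding lie_algebra_def by blast
  have sw: "vbracket X Y f p = - vbracket Y X f p" for X Y
    using fun_cong[OF fun_cong[OF vbracket_swap[of X Y]], of f p] by simp
  have z: "vbracket X X f p = 0" for X by (simp add: vbracket_def)
  note L = vbracket_lincomb3_right[OF v_field[OF in13(1)], of x f p] vbracket_lincomb3_right[OF v_field[OF in13(2)], of x f p]
    vbracket_lincomb3_right[OF v_field[OF in13(3)], of x f p]
  show ?thesis
    unfolding vbracket_lincomb3_right[OF X] sw[of "lincomb3 x v" "v 1"] sw[of "lincomb3 x v" "v 2"] sw[of "lincomb3 x v" "v 3"] L z
      sw[of "v 2" "v 1"] sw[of "v 3" "v 2"] sw[of "v 1" "v 3"]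
    by (simp add: algebra_simps del: One_nat_def)
qed

text \<open>\<open>v 2\<close> and \<open>v 1 - v 3\<close> span an abelian ideal on which \<open>v 1\<close> acts with eigenvalues \<open>- r\<close> and \<open>r\<close>.
  The boost has the eigenvectors \<open>(1, - 1)\<close> and \<open>(1, 1)\<close> with eigenvalues \<open>- 1\<close> and \<open>1\<close>. So \<open>v 1\<close> corresponds to
  \<open>r\<close> times the boost, \<open>v 2\<close> to the translation by \<open>(1, - 1)\<close> and \<open>v 1 - v 3\<close> to that by \<open>(1, 1)\<close>.\<close>

lemma isomorphic_to_e11I:
  assumes r: "r \<noteq> 0"
    and b12: "vbracket (v 1) (v 2) = lincomb3 x12 v" "x12 1 = 0" "x12 2 = - r" "x12 3 = 0"
    and b23: "vbracket (v 2) (v 3) = lincomb3 x23 v" "x23 1 = 0" "x23 2 = r" "x23 3 = 0"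
    and b31: "vbracket (v 3) (v 1) = lincomb3 x31 v" "x31 1 = r" "x31 2 = 0" "x31 3 = - r"
  shows "isomorphic_to_e11 mul ginv A"
proof -
  let ?g = "lie_algebra mul ginv A"
  have in13: "1 \<in> {1..3::nat}" "2 \<in> {1..3::nat}" "3 \<in> {1..3::nat}" by auto
  have "\<forall>X\<in>?g. \<exists>c. X = lincomb3 c v"
    using v_basis unfolding lie_algebra_basis3_def by blast
  from bchoice[OF this] obtain \<kappa> where \<kappa>: "\<And>X. X \<in> ?g \<Longrightarrow> X = lincomb3 (\<kappa> X) v" by blast
  define \<phi> :: "(nat \<Rightarrow> real) \<Rightarrow> (real^2^2) \<times> (real^2)" where
    "\<phi> c = ((r * (c 1 + c 3)) *\<^sub>R boost, vector [c 2 - c 3, - c 2 - c 3])" for c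
  have \<phi>_eq: "\<phi> (\<kappa> X) = \<phi> c" if "X \<in> ?g" "X = lincomb3 c v" for X c
  proof -
    have "\<kappa> X a = c a" if "a \<in> {1..3}" for a
      by (rule lincomb3_inject[OF _ that]) (use \<kappa>[OF \<open>X \<in> ?g\<close>] \<open>X = lincomb3 c v\<close> in simp)
    from this[OF in13(1)] this[OF in13(2)] this[OF in13(3)] show ?thesis unfolding \<phi>_def by (simp only:)
  qed
  have \<phi>_inj: "c a = c' a" if "\<phi> c = \<phi> c'" "a \<in> {1..3}" for c c' a
  proof -
    have "r * (c 1 + c 3) = r * (c' 1 + c' 3)"
      using arg_cong[OF that(1), of "\<lambda>z. fst z $ 1 $ 2"] by (simp add: \<phi>_def boost_entries)
    then have 1: "c 1 + c 3 = c' 1 + c' 3" using r by simp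
    have "c 2 - c 3 = c' 2 - c' 3" "- c 2 - c 3 = - c' 2 - c' 3"
      using arg_cong[OF that(1), of "\<lambda>z. snd z $ 1"] arg_cong[OF that(1), of "\<lambda>z. snd z $ 2"] by (simp_all add: \<phi>_def)
    with 1 that(2) show ?thesis unfolding in_1_3 by auto
  qed
  have "bij_betw (\<lambda>X. \<phi> (\<kappa> X)) ?g e11" unfolding bij_betw_def
  proof
    show "inj_on (\<lambda>X. \<phi> (\<kappa> X)) ?g"
    proof (rule inj_onI)
      fix X Y assume X: "X \<in> ?g" and Y: "Y \<in> ?g" and eq: "\<phi> (\<kappa> X) = \<phi> (\<kappa> Y)"
      have "lincomb3 (\<kappa> X) v = lincomb3 (\<kappa> Y) v"
        unfolding lincomb3_def by (intro ext sum.cong refl) (simp only: \<phi>_inj[OF eq])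
      then show "X = Y" using \<kappa>[OF X] \<kappa>[OF Y] by simp
    qed
    show "(\<lambda>X. \<phi> (\<kappa> X)) ` ?g = e11"
    proof (intro set_eqI iffI)
      fix z assume "z \<in> (\<lambda>X. \<phi> (\<kappa> X)) ` ?g"
      then show "z \<in> e11" unfolding e11_eq \<phi>_def by blast
    next
      fix z assume "z \<in> e11"
      then obtain t b where z: "z = (t *\<^sub>R boost, b)" unfolding e11_eq by blast
      define c where "c a = (if a = 1 then t / r + (b $ 1 + b $ 2) / 2 else if a = 2 then (b $ 1 - b $ 2) / 2
        else - (b $ 1 + b $ 2) / 2)" for a :: nat
      have c: "c 1 = t / r + (b $ 1 + b $ 2) / 2" "c 2 = (b $ 1 - b $ 2) / 2" "c 3 = - (b $ 1 + b $ 2) / 2"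
        by (simp_all add: c_def)
      have b: "vector [c 2 - c 3, - c 2 - c 3] = b"
        unfolding c by (simp add: vec_eq_iff forall_2 field_simps)
      have t: "r * (c 1 + c 3) = t" unfolding c using r by (simp add: field_simps)
      have "\<phi> (\<kappa> (lincomb3 c v)) = \<phi> c" by (rule \<phi>_eq[OF lincomb3_lie_algebra refl])
      also have "\<dots> = z" unfolding \<phi>_def z b t by (rule refl)
      finally have "\<phi> (\<kappa> (lincomb3 c v)) = z" .
      then show "z \<in> (\<lambda>X. \<phi> (\<kappa> X)) ` ?g" by (intro image_eqI[OF _ lincomb3_lie_algebra]) (rule sym)
    qed
  qed
  moreover have "\<phi> (\<kappa> (X + Y)) = \<phi> (\<kappa> X) + \<phi> (\<kappa> Y)" if X: "X \<in> ?g" and Y: "Y \<in> ?g" for X Y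
  proof -
    have XY: "X + Y = lincomb3 (\<lambda>a. \<kappa> X a + \<kappa> Y a) v"
    proof -
      have "X + Y = lincomb3 (\<kappa> X) v + lincomb3 (\<kappa> Y) v"
        by (rule arg_cong2[where f = "(+)", OF \<kappa>[OF X] \<kappa>[OF Y]])
      also have "\<dots> = lincomb3 (\<lambda>a. \<kappa> X a + \<kappa> Y a) v"
        by (intro ext) (simp only: plus_fun_apply lincomb3_def sum.distrib[symmetric] distrib_right)
      finally show ?thesis .
    qed
    have "X + Y \<in> ?g" unfolding XY by (rule lincomb3_lie_algebra)
    from \<phi>_eq[OF this XY] show ?thesis
      by (simp add: \<phi>_def vec_eq_iff forall_2 algebra_simps)
  qed
  moreover have "\<phi> (\<kappa> (\<lambda>f p. q * X f p)) = q *\<^sub>R \<phi> (\<kappa> X)" if X: "X \<in> ?g" for X q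
  proof -
    have qX: "(\<lambda>f p. q * X f p) = lincomb3 (\<lambda>a. q * \<kappa> X a) v"
    proof (intro ext)
      fix f p
      have "X f p = lincomb3 (\<kappa> X) v f p" by (rule fun_cong[OF fun_cong[OF \<kappa>[OF X]]])
      then show "q * X f p = lincomb3 (\<lambda>a. q * \<kappa> X a) v f p"
        unfolding lincomb3_def by (simp only: sum_distrib_left mult.assoc)
    qed
    have "(\<lambda>f p. q * X f p) \<in> ?g" unfolding qX by (rule lincomb3_lie_algebra)
    from \<phi>_eq[OF this qX] show ?thesis
      by (simp add: \<phi>_def vec_eq_iff forall_2 algebra_simps)
  qed
  moreover have "\<phi> (\<kappa> (vbracket X Y)) = e11_bracket (\<phi> (\<kappa> X)) (\<phi> (\<kappa> Y))" if X: "X \<in> ?g" and Y: "Y \<in> ?g" for X Y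
  proof -
    define x y where "x = \<kappa> X" and "y = \<kappa> Y"
    define z where "z a = (x 1 * y 2 - x 2 * y 1) * x12 a + (x 2 * y 3 - x 3 * y 2) * x23 a + (x 3 * y 1 - x 1 * y 3) * x31 a" for a
    have "vbracket X Y = vbracket (lincomb3 x v) (lincomb3 y v)"
      unfolding x_def y_def by (rule arg_cong2[where f = vbracket, OF \<kappa>[OF X] \<kappa>[OF Y]])
    also have "\<dots> = lincomb3 z v"
    proof (intro ext)
      fix f p
      show "vbracket (lincomb3 x v) (lincomb3 y v) f p = lincomb3 z v f p"
        unfolding vbracket_lincomb3 b12(1) b23(1) b31(1) unfolding lincomb3_def sum_1_3 z_def by (simp only: algebra_simps)
    qed
    finally have XY: "vbracket X Y = lincomb3 z v" .
    have "vbracket X Y \<in> ?g" unfolding XY by (rule lincomb3_lie_algebra)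
    from \<phi>_eq[OF this XY] have "\<phi> (\<kappa> (vbracket X Y)) = \<phi> z" .
    also have "\<dots> = e11_bracket (\<phi> x) (\<phi> y)"
      unfolding \<phi>_def e11_bracket.simps z_def b12 b23 b31 prod.inject
      by (simp add: vec_eq_iff forall_2 matrix_vector_mult_def matrix_matrix_mult_def sum_2 boost_entries algebra_simps)
    finally show ?thesis unfolding x_def y_def .
  qed
  ultimately show ?thesis unfolding isomorphic_to_e11_def
    by (intro exI[of _ "\<lambda>X. \<phi> (\<kappa> X)"]) blast
qed

end

lemma (in metric_frame) two_form_zeroI:
  assumes "\<And>a b. a \<in> {1..3} \<Longrightarrow> b \<in> {1..3} \<Longrightarrow> Fc a b = 0"
  shows "F = 0"
proof (intro ext)
  fix X Y p
  show "F X Y p = 0 X Y p"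
  proof (cases "X \<in> V \<and> Y \<in> V")
    case True
    have F0: "F (v a) (v b) = 0" if "a \<in> {1..3}" "b \<in> {1..3}" for a b
      unfolding F_frame[OF that] assms[OF that] by (rule const_fun_simps)
    have Fv: "F (v a) Z = 0" if a: "a \<in> {1..3}" and Z: "Z \<in> V" for a Z
      unfolding form_expand[OF two_formsD(1)[OF F v_field[OF a]] Z] by (simp only: F0 a in13) simp
    have FX: "F X (v a) = 0" if a: "a \<in> {1..3}" for a
      unfolding two_formsD(3)[OF F True[THEN conjunct1] v_field[OF a]] Fv[OF a True[THEN conjunct1]] by simp
    have "F X Y = 0"
      unfolding form_expand[OF two_formsD(1)[OF F True[THEN conjunct1]] True[THEN conjunct2]] by (simp only: FX in13) simp
    then show ?thesis by simp
  next
    case False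
    show ?thesis
    proof (cases "X \<in> V")
      case True
      then have "Y \<notin> V" using False by simp
      show ?thesis unfolding one_formsD(4)[OF two_formsD(1)[OF F True] \<open>Y \<notin> V\<close>] by simp
    next
      case False
      show ?thesis unfolding two_formsD(2)[OF F False] by simp
    qed
  qed
qed

section \<open>Generalized Einstein metrics of type L5\<close>

lemma L5_eq_matrix: "L5 \<alpha> i j = L5_matrix (1 / sqrt 2) \<alpha> i j"
  by (simp add: L5_def L5_matrix_def)

lemma lincomb3_cong:
  "c 1 = c' 1 \<Longrightarrow> c 2 = c' 2 \<Longrightarrow> c 3 = c' 3 \<Longrightarrow> lincomb3 c v = lincomb3 c' v"
  unfolding lincomb3_def sum_1_3 by simp

lemma lincomb3_uminus: "lincomb3 (\<lambda>b. - c b) v = - lincomb3 c v"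
  by (intro ext) (simp add: lincomb3_def sum_negf)

lemma eq_uminus_fun: "f = - f \<Longrightarrow> f = (0 :: 'g sfun)"
  by (simp add: fun_eq_iff)

theorem theorem31:
  fixes mul :: "'g::{t2_space, second_countable_topology} \<Rightarrow> 'g \<Rightarrow> 'g"
    and unit :: 'g and ginv :: "'g \<Rightarrow> 'g"
    and A :: "('g, real^3) atlas"
    and g :: "'g vfield \<Rightarrow> 'g oneform"
    and v :: "nat \<Rightarrow> 'g vfield"
    and \<epsilon> :: "nat \<Rightarrow> real" and \<alpha> h :: real
    and H :: "'g threeform" and F :: "'g twoform" and Fc :: "nat \<Rightarrow> nat \<Rightarrow> real"
    and \<delta> :: "'g Esec \<Rightarrow> 'g sfun" and d :: "nat \<Rightarrow> real"
  assumes G: "lie_group mul unit ginv A"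
    and g: "pseudo_riemannian_metric A g" "linv2 mul ginv A g"
    and v_basis: "lie_algebra_basis3 mul ginv A v"
    and v_orthogonal: "\<And>a b. a \<in> {1..3} \<Longrightarrow> b \<in> {1..3} \<Longrightarrow> a \<noteq> b \<Longrightarrow> g (v a) (v b) = 0"
    and v_norm: "\<And>a. a \<in> {1..3} \<Longrightarrow> g (v a) (v a) = (\<lambda>_. \<epsilon> a)"
    and v_unit: "\<And>a. a \<in> {1..3} \<Longrightarrow> \<epsilon> a = 1 \<or> \<epsilon> a = - 1"
    and signature: "\<epsilon> 1 = \<epsilon> 2" "\<epsilon> 2 = - \<epsilon> 3"
    and bracket12: "vbracket (v 1) (v 2) = lincomb3 (\<lambda>b. \<epsilon> 3 * L5 \<alpha> b 3) v"
    and bracket23: "vbracket (v 2) (v 3) = lincomb3 (\<lambda>b. \<epsilon> 1 * L5 \<alpha> b 1) v"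
    and bracket31: "vbracket (v 3) (v 1) = lincomb3 (\<lambda>b. \<epsilon> 2 * L5 \<alpha> b 2) v"
    and H: "H \<in> three_forms A" "linv3 mul ginv A H" "H (v 1) (v 2) (v 3) = (\<lambda>_. h)"
    and F: "F \<in> two_forms A" "linv2 mul ginv A F" "closed_two_form A F" "F \<noteq> 0"
    and F_comp: "\<And>a b. a \<in> {1..3} \<Longrightarrow> b \<in> {1..3} \<Longrightarrow> F (v a) (v b) = (\<lambda>_. Fc a b)"
    and \<delta>: "left_invariant_divergence mul ginv A \<delta>"
    and \<delta>_comp: "\<And>B. B \<le> 6 \<Longrightarrow> \<delta> (frame_e g v B) = (\<lambda>_. d B)"
  shows "(generalized_einstein A H F (E_minus A g) \<delta> \<longleftrightarrow>
            \<alpha> = 0 \<and> h = 0 \<and> Fc 1 3 = 0 \<and> Fc 2 3 = - Fc 1 2 \<and>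
            (Fc 1 2)\<^sup>2 = - \<epsilon> 1 - d 1 / sqrt 2 \<and>
            d 0 = 0 \<and> d 2 = 0 \<and> d 5 = 0 \<and> d 1 = d 3 \<and> d 3 = d 4 \<and> d 4 = d 6 \<and>
            \<epsilon> 1 + d 1 / sqrt 2 < 0) \<and>
         (generalized_einstein A H F (E_minus A g) \<delta> \<longrightarrow> isomorphic_to_e11 mul ginv A)"
proof -
  interpret L: lie_group_frame mul unit ginv A v
    by unfold_locales (rule G v_basis)+
  let ?s = "1 / sqrt 2 :: real" and ?e = "\<epsilon> 1"
  have ss: "?s * ?s = 1 / 2" by simp
  have a123: "1 \<in> {1..3::nat}" "2 \<in> {1..3::nat}" "3 \<in> {1..3::nat}" by auto
  note V = L.v_field
  have e: "?e = 1 \<or> ?e = - 1" by (rule v_unit[OF a123(1)])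
  have \<epsilon>23: "\<epsilon> 2 = ?e" "\<epsilon> 3 = - ?e" using signature by simp_all
  define K where "K = bracket_coeff \<epsilon> (L5_matrix ?s \<alpha>)"
  define Hc where "Hc a b c = h * orientation a b c" for a b c
  \<comment> \<open>The three given brackets determine the others by skew-symmetry.\<close>
  have K: "vbracket (v a) (v b) = lincomb3 (K a b) v" if "a \<in> {1..3}" "b \<in> {1..3}" for a b
  proof -
    have zero: "vbracket (v a) (v a) = lincomb3 (K a a) v" for a
      by (intro ext) (simp add: vbracket_def lincomb3_def K_def bracket_coeff_def orientation_values)
    have 12: "vbracket (v 1) (v 2) = lincomb3 (K 1 2) v" and 23: "vbracket (v 2) (v 3) = lincomb3 (K 2 3) v"
      and 31: "vbracket (v 3) (v 1) = lincomb3 (K 3 1) v"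
      unfolding bracket12 bracket23 bracket31 K_def L5_eq_matrix
      by (intro lincomb3_cong; simp add: bracket_coeff_def orientation_values del: One_nat_def)+
    have neg: "K b a = (\<lambda>z. - K a b z)" for a b
      by (rule ext) (simp add: K_def bracket_coeff_def orientation_skew(1)[of a b])
    have sw: "vbracket (v b) (v a) = lincomb3 (K b a) v" if "vbracket (v a) (v b) = lincomb3 (K a b) v" for a b
      unfolding vbracket_swap[of "v b" "v a"] that neg[of b a] by (rule lincomb3_uminus[symmetric])
    show ?thesis
      using that unfolding in_1_3 by (elim disjE; hypsubst) (rule zero 12 23 31 sw[OF 12] sw[OF 23] sw[OF 31])+
  qed
  have Hsw: "H (v b) (v a) (v c) = - H (v a) (v b) (v c)" "H (v a) (v c) (v b) = - H (v a) (v b) (v c)"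
    if "a \<in> {1..3}" "b \<in> {1..3}" "c \<in> {1..3}" for a b c
    using three_formsD(3)[OF H(1) V[OF that(2)] V[OF that(1)]]
      two_formsD(3)[OF three_formsD(1)[OF H(1) V[OF that(1)]] V[OF that(3)] V[OF that(2)]] by simp_all
  \<comment> \<open>All components of \<open>H\<close> follow from \<open>H (v 1) (v 2) (v 3)\<close> by transpositions.\<close>
  have Hc: "H (v a) (v b) (v c) = (\<lambda>_. Hc a b c)" if "a \<in> {1..3}" "b \<in> {1..3}" "c \<in> {1..3}" for a b c
  proof -
    have z12: "H (v a) (v a) (v b) = (\<lambda>_. Hc a a b)" if "a \<in> {1..3}" "b \<in> {1..3}" for a b
      using eq_uminus_fun[OF Hsw(1)[OF that(1,1,2)]] by (simp add: Hc_def orientation_values const_fun_simps)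
    have z23: "H (v a) (v b) (v b) = (\<lambda>_. Hc a b b)" if "a \<in> {1..3}" "b \<in> {1..3}" for a b
      using eq_uminus_fun[OF Hsw(2)[OF that that(2)]] by (simp add: Hc_def orientation_values const_fun_simps)
    have h12: "H (v b) (v a) (v c) = (\<lambda>_. Hc b a c)" if "H (v a) (v b) (v c) = (\<lambda>_. Hc a b c)"
      "a \<in> {1..3}" "b \<in> {1..3}" "c \<in> {1..3}" for a b c
      unfolding Hsw(1)[OF that(2-4)] that(1) Hc_def orientation_skew(1)[of a b] by (simp add: fun_eq_iff)
    have h23: "H (v a) (v c) (v b) = (\<lambda>_. Hc a c b)" if "H (v a) (v b) (v c) = (\<lambda>_. Hc a b c)"
      "a \<in> {1..3}" "b \<in> {1..3}" "c \<in> {1..3}" for a b c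
      unfolding Hsw(2)[OF that(2-4)] that(1) Hc_def orientation_skew(2)[of a b c] by (simp add: fun_eq_iff)
    have z13: "H (v a) (v b) (v a) = (\<lambda>_. Hc a b a)" if "a \<in> {1..3}" "b \<in> {1..3}" for a b
      by (rule h12[OF z23[OF that(2,1)] that(2,1,1)])
    have 123: "H (v 1) (v 2) (v 3) = (\<lambda>_. Hc 1 2 3)" unfolding H(3) Hc_def orientation_values by simp
    note 213 = h12[OF 123 a123] and 132 = h23[OF 123 a123]
    note 231 = h23[OF 213 a123(2,1,3)] and 312 = h12[OF 132 a123(1,3,2)]
    note 321 = h12[OF 231 a123(2,3,1)]
    show ?thesis
      using that unfolding in_1_3
      by (elim disjE; hypsubst) (rule 123 213 132 231 312 321 | (rule z12 z23 z13; rule a123))+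
  qed
  have Fsk: "Fc b a = - Fc a b" if "a \<in> {1..3}" "b \<in> {1..3}" for a b
    using fun_cong[OF two_formsD(3)[OF F(1) V[OF that(2)] V[OF that(1)]], of undefined] F_comp[OF that] F_comp[OF that(2,1)]
    by simp
  interpret M: metric_frame mul unit ginv A v g \<epsilon> K H Hc F Fc
  proof (unfold_locales)
    fix a b z :: nat
    show "K b a z = - K a b z" by (simp add: K_def bracket_coeff_def orientation_skew(1)[of a b])
    show "Hc b a z = - Hc a b z" by (simp add: Hc_def orientation_skew(1)[of a b])
    show "Hc a z b = - Hc a b z" by (simp add: Hc_def orientation_skew(2)[of a b z])
    assume a: "a \<in> {1..3}"
    show "\<epsilon> a * \<epsilon> a = 1" using v_unit[OF a] by auto
    assume b: "b \<in> {1..3}"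
    show "g (v a) (v b) = (\<lambda>_. if a = b then \<epsilon> a else 0)"
      using v_norm[OF a] v_orthogonal[OF a b] by (cases "a = b") (simp_all add: zero_fun_def)
    show "vbracket (v a) (v b) = lincomb3 (K a b) v" by (rule K[OF a b])
    show "F (v a) (v b) = (\<lambda>_. Fc a b)" by (rule F_comp[OF a b])
    show "Fc b a = - Fc a b" by (rule Fsk[OF a b])
    assume z: "z \<in> {1..3}"
    show "H (v a) (v b) (v z) = (\<lambda>_. Hc a b z)" by (rule Hc[OF a b z])
  qed (rule g(1) H(1) F(1))+
  have Fc: "Fc 1 1 = 0" "Fc 2 2 = 0" "Fc 3 3 = 0" "Fc 2 1 = - Fc 1 2" "Fc 3 1 = - Fc 1 3" "Fc 3 2 = - Fc 2 3"
    using Fsk[OF a123(1,1)] Fsk[OF a123(2,2)] Fsk[OF a123(3,3)] Fsk[OF a123(1,2)] Fsk[OF a123(1,3)] Fsk[OF a123(2,3)]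
    by simp_all
  have F0: "Fc 1 2 \<noteq> 0 \<or> Fc 1 3 \<noteq> 0 \<or> Fc 2 3 \<noteq> 0"
  proof (rule ccontr)
    assume "\<not> ?thesis"
    then have "Fc a b = 0" if "a \<in> {1..3}" "b \<in> {1..3}" for a b
      using that Fc unfolding in_1_3 by (elim disjE) simp_all
    then have "F = 0" by (rule M.two_form_zeroI)
    with F(4) show False by blast
  qed
  have "divergence_operator A \<delta>" using \<delta> unfolding left_invariant_divergence_def by blast
  then have "generalized_einstein A H F (M.frame_span {4..<7}) \<delta> \<longleftrightarrow>
      (\<forall>a\<in>{4..<7}. \<forall>i\<in>{..<4}. ricci_coeff (frame_norm \<epsilon>) M.struct_coeff d {..<4} {4..<7} a i = 0
        \<and> ricci_coeff (frame_norm \<epsilon>) M.struct_coeff d {4..<7} {..<4} i a = 0)"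
    by (intro M.einstein_iff \<delta>_comp) simp_all
  also have "\<dots> \<longleftrightarrow> \<alpha> = 0 \<and> h = 0 \<and> Fc 1 3 = 0 \<and> Fc 2 3 = - Fc 1 2 \<and> (Fc 1 2)\<^sup>2 = - ?e - d 1 * ?s \<and>
      d 0 = 0 \<and> d 2 = 0 \<and> d 5 = 0 \<and> d 1 = d 3 \<and> d 3 = d 4 \<and> d 4 = d 6 \<and> ?e + d 1 * ?s < 0"
    by (rule einstein_system[OF refl \<epsilon>23 e ss refl _ Fc F0]) (simp only: K_def Hc_def[abs_def])
  finally have iff: "generalized_einstein A H F (E_minus A g) \<delta> \<longleftrightarrow>
      \<alpha> = 0 \<and> h = 0 \<and> Fc 1 3 = 0 \<and> Fc 2 3 = - Fc 1 2 \<and> (Fc 1 2)\<^sup>2 = - ?e - d 1 / sqrt 2 \<and>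
      d 0 = 0 \<and> d 2 = 0 \<and> d 5 = 0 \<and> d 1 = d 3 \<and> d 3 = d 4 \<and> d 4 = d 6 \<and> ?e + d 1 / sqrt 2 < 0"
    unfolding M.E_minus_frame_span by (simp only: times_divide_eq_right mult_1_right)
  have "isomorphic_to_e11 mul ginv A" if "\<alpha> = 0"
  proof (rule L.isomorphic_to_e11I[OF _ bracket12 _ _ _ bracket23 _ _ _ bracket31])
    show "?e * ?s \<noteq> 0" using e by auto
  qed (use that \<epsilon>23 in \<open>simp_all add: L5_eq_matrix L5_matrix_def\<close>)
  then show ?thesis using iff by blast
qed

end
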